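(* Let $\Gamma$ be a connected Coxeter graph of spherical type, and let $A = A(\Gamma)$ and $W = W(\Gamma)$. 1. There exists a proper up-to-center-epimorphism $A\to W$ if and only if $\Gamma\in\{I_2(p) : p\ge 6 \text{ and } p\equiv 2 \pmod 4\}\cup\{B_n : n\ge 3 \text{ and } n \text{ odd}\}\cup\{A_1, H_3, E_7\}$. 2. If $\varphi: A\to W$ is a proper up-to-center-epimorphism, then $W = \mathrm{Im}\,\varphi\times Z(W)$ (internal direct product).
   Context: A Coxeter matrix of rank $n$ is a symmetric matrix $M = (m_{ij})_{1\le i,j\le n}$ with $m_{ii} = 1$ and $m_{ij} = m_{ji} \in \{2,3,4,\dots,+\infty\}$ for $i\ne j$. Its Coxeter graph $\Gamma$ has vertices $1,\dots,n$; the vertices $i,j$ are joined by an edge if $m_{ij}\ge 3$, and this edge is labelled by $m_{ij}$ if $m_{ij}\ge 4$. For two letters $a,b$ and $m\in\mathbb{N}$ put $\omega(a,b:m) = (ab)^{m/2}$ if $m$ is even and $\omega(a,b:m) = (ab)^{(m-1)/2}a$ if $m$ is odd. The Artin group $A(\Gamma)$ is the group generated by $\sigma_1,\dots,\sigma_n$ subject to the relations $\omega(\sigma_i,\sigma_j:m_{ij}) = \omega(\sigma_j,\sigma_i:m_{ij})$ for $i<j$ with $m_{ij}<+\infty$. The Coxeter group $W(\Gamma)$ is the group generated by $s_1,\dots,s_n$ subject to the relations $s_i^2=1$ for all $i$ and $(s_is_j)^{m_{ij}}=1$ for $i<j$ with $m_{ij}<+\infty$. The graph $\Gamma$ is of spherical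 type if $W(\Gamma)$ is finite. The connected spherical type Coxeter graphs are the standard graphs $A_n$ ($n\ge 1$), $B_n$ ($n\ge 2$), $D_n$ ($n\ge 4$), $E_6$, $E_7$, $E_8$, $F_4$, $H_3$, $H_4$, $I_2(p)$ ($p\ge 5$), where $I_2(6)$ denotes the graph also called $G_2$. Here $I_2(p)$ is the rank 2 graph with $m_{12}=p$. Let $Z(W)$ denote the center of $W$. A homomorphism $\varphi: A\to W$ is an up-to-center-epimorphism if $W = \mathrm{Im}\,\varphi\cdot Z(W)$; it is proper if moreover it is not an epimorphism (not surjective). *)

theory Defs
  imports "HOL-Number_Theory.Cong" "HOL-Algebra.Elementary_Groups" "HOL-Library.Extended_Nat"
begin

section \<open>Groups given by generators and relations\<close>

text \<open>The letter \<open>(s, True)\<close> stands for the generator \<open>s\<close> and \<open>(s, False)\<close> for its formal inverse.\<close>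

type_synonym 's word = "('s \<times> bool) list"

definition words :: "'s set \<Rightarrow> 's word set" where
  "words S = lists (S \<times> UNIV)"

text \<open>A relation \<open>u = v\<close> is given as the pair \<open>(u, v)\<close>. The following is the smallest congruence on
  the monoid \<open>words S\<close> that contains the relations \<open>R\<close> and makes the letters \<open>(s, True)\<close> and
  \<open>(s, False)\<close> mutually inverse.\<close>

inductive_set word_cong :: "'s set \<Rightarrow> ('s word \<times> 's word) set \<Rightarrow> ('s word \<times> 's word) set"
  for S :: "'s set" and R :: "('s word \<times> 's word) set" where
  refl: "u \<in> words S \<Longrightarrow> (u, u) \<in> word_cong S R"
| sym: "(u, v) \<in> word_cong S R \<Longrightarrow> (v, u) \<in> word_cong S R"
| trans: "(u, v) \<in> word_cong S R \<Longrightarrow> (v, w) \<in> word_cong S R \<Longrightarrow> (u, w) \<in> word_cong S R"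
| mult: "(u, v) \<in> word_cong S R \<Longrightarrow> (u', v') \<in> word_cong S R \<Longrightarrow> (u @ u', v @ v') \<in> word_cong S R"
| cancel: "s \<in> S \<Longrightarrow> ([(s, b), (s, \<not> b)], []) \<in> word_cong S R"
| rel: "(u, v) \<in> R \<Longrightarrow> u \<in> words S \<Longrightarrow> v \<in> words S \<Longrightarrow> (u, v) \<in> word_cong S R"

definition presented_group :: "'s set \<Rightarrow> ('s word \<times> 's word) set \<Rightarrow> 's word set monoid" where
  "presented_group S R =
    \<lparr>carrier = words S // word_cong S R,
     mult = (\<lambda>X Y. \<Union>x\<in>X. \<Union>y\<in>Y. word_cong S R `` {x @ y}),
     one = word_cong S R `` {[]}\<rparr>"

lemma word_cong_words: "(u, v) \<in> word_cong S R \<Longrightarrow> u \<in> words S \<and> v \<in> words S"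
  by (induction rule: word_cong.induct) (auto simp: words_def)

lemma equiv_word_cong: "equiv (words S) (word_cong S R)"
  by (intro equivI refl_onI symI transI)
    (auto dest: word_cong_words intro: word_cong.refl word_cong.sym word_cong.trans)

lemma presented_group_mult:
  assumes "x \<in> words S" "y \<in> words S"
  shows "word_cong S R `` {x} \<otimes>\<^bsub>presented_group S R\<^esub> word_cong S R `` {y} = word_cong S R `` {x @ y}"
proof -
  have "congruent2 (word_cong S R) (word_cong S R) (\<lambda>x y. word_cong S R `` {x @ y})"
    by (rule congruent2I') (meson equiv_class_eq[OF equiv_word_cong] word_cong.mult)
  then show ?thesis
    using UN_equiv_class2[OF equiv_word_cong equiv_word_cong _ assms]
    by (simp add: presented_group_def)
qed

lemma word_cong_inverse:
  assumes "w \<in> words S"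
  shows "(rev (map (\<lambda>(s, b). (s, \<not> b)) w) @ w, []) \<in> word_cong S R"
  using assms
proof (induction w)
  case Nil
  then show ?case by (auto intro: word_cong.refl)
next
  case (Cons a w)
  obtain s b where a: "a = (s, b)" by force
  let ?i = "rev (map (\<lambda>(s, b). (s, \<not> b)) w)"
  have s: "s \<in> S" and w: "w \<in> words S" using Cons.prems by (auto simp: a words_def)
  have i: "?i \<in> words S" using w by (auto simp: words_def)
  have "([(s, \<not> b), (s, b)] @ w, [] @ w) \<in> word_cong S R"
    using word_cong.mult[OF word_cong.cancel[OF s, of "\<not> b"] word_cong.refl[OF w]] by simp
  from word_cong.mult[OF word_cong.refl[OF i] this] Cons.IH[OF w]
  show ?case by (simp add: a) (meson word_cong.trans)
qed

lemma group_presented_group: "group (presented_group S R)"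
proof (rule groupI)
  let ?G = "presented_group S R"
  let ?c = "\<lambda>w. word_cong S R `` {w}"
  have carr: "X \<in> carrier ?G \<longleftrightarrow> (\<exists>w\<in>words S. X = ?c w)" for X
    by (auto simp: presented_group_def quotient_def)
  have app: "x @ y \<in> words S" if "x \<in> words S" "y \<in> words S" for x y
    using that by (auto simp: words_def)
  have Nil: "[] \<in> words S" by (simp add: words_def)
  have one: "\<one>\<^bsub>?G\<^esub> = ?c []" by (simp add: presented_group_def)
  show "\<one>\<^bsub>?G\<^esub> \<in> carrier ?G" using Nil one carr by blast
  fix X assume "X \<in> carrier ?G"
  then obtain x where x: "x \<in> words S" "X = ?c x" using carr by blast
  show "\<one>\<^bsub>?G\<^esub> \<otimes>\<^bsub>?G\<^esub> X = X" by (simp add: one x presented_group_mult Nil)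
  let ?i = "rev (map (\<lambda>(s, b). (s, \<not> b)) x)"
  have i: "?i \<in> words S" using x by (auto simp: words_def)
  have "?c ?i \<otimes>\<^bsub>?G\<^esub> X = \<one>\<^bsub>?G\<^esub>"
    using equiv_class_eq[OF equiv_word_cong word_cong_inverse[OF x(1)]]
    by (simp add: one x presented_group_mult i)
  then show "\<exists>Y\<in>carrier ?G. Y \<otimes>\<^bsub>?G\<^esub> X = \<one>\<^bsub>?G\<^esub>" using i carr by blast
  fix Y assume "Y \<in> carrier ?G"
  then obtain y where y: "y \<in> words S" "Y = ?c y" using carr by blast
  show "X \<otimes>\<^bsub>?G\<^esub> Y \<in> carrier ?G"
    using x y app carr by (metis presented_group_mult)
  fix Z assume "Z \<in> carrier ?G"
  then obtain z where z: "z \<in> words S" "Z = ?c z" using carr by blast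
  show "X \<otimes>\<^bsub>?G\<^esub> Y \<otimes>\<^bsub>?G\<^esub> Z = X \<otimes>\<^bsub>?G\<^esub> (Y \<otimes>\<^bsub>?G\<^esub> Z)"
    by (simp add: x y z presented_group_mult app)
qed


section \<open>Coxeter graphs, Artin groups and Coxeter groups\<close>

text \<open>A Coxeter graph of rank \<open>n\<close> is represented by its Coxeter matrix, a function of which only the
  values on the vertices \<open>1, \<dots>, n\<close> matter.\<close>

definition coxeter_matrix :: "nat \<Rightarrow> (nat \<Rightarrow> nat \<Rightarrow> enat) \<Rightarrow> bool" where
  "coxeter_matrix n M \<longleftrightarrow>
    (\<forall>i\<in>{1..n}. M i i = 1) \<and>
    (\<forall>i\<in>{1..n}. \<forall>j\<in>{1..n}. i \<noteq> j \<longrightarrow> M i j = M j i \<and> 2 \<le> M i j)"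

definition coxeter_edges :: "nat \<Rightarrow> (nat \<Rightarrow> nat \<Rightarrow> enat) \<Rightarrow> (nat \<times> nat) set" where
  "coxeter_edges n M = {(i, j). i \<in> {1..n} \<and> j \<in> {1..n} \<and> i \<noteq> j \<and> 3 \<le> M i j}"

text \<open>The empty graph does not count as connected.\<close>

definition coxeter_connected :: "nat \<Rightarrow> (nat \<Rightarrow> nat \<Rightarrow> enat) \<Rightarrow> bool" where
  "coxeter_connected n M \<longleftrightarrow>
    1 \<le> n \<and> (\<forall>i\<in>{1..n}. \<forall>j\<in>{1..n}. (i, j) \<in> (coxeter_edges n M)\<^sup>*)"

definition gen :: "'s \<Rightarrow> 's word" where
  "gen s = [(s, True)]"

definition word_pow :: "'s word \<Rightarrow> nat \<Rightarrow> 's word" where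
  "word_pow w k = concat (replicate k w)"

definition alt_word :: "'s \<Rightarrow> 's \<Rightarrow> nat \<Rightarrow> 's word" where
  "alt_word a b m =
    (if even m then word_pow (gen a @ gen b) (m div 2)
     else word_pow (gen a @ gen b) ((m - 1) div 2) @ gen a)"

definition artin_group :: "nat \<Rightarrow> (nat \<Rightarrow> nat \<Rightarrow> enat) \<Rightarrow> nat word set monoid" where
  "artin_group n M = presented_group {1..n}
    {(alt_word i j m, alt_word j i m) | i j m.
       i \<in> {1..n} \<and> j \<in> {1..n} \<and> i < j \<and> M i j = enat m}"

definition coxeter_group :: "nat \<Rightarrow> (nat \<Rightarrow> nat \<Rightarrow> enat) \<Rightarrow> nat word set monoid" where
  "coxeter_group n M = presented_group {1..n}
    ({(word_pow (gen i) 2, []) | i. i \<in> {1..n}} \<union>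
     {(word_pow (gen i @ gen j) m, []) | i j m.
       i \<in> {1..n} \<and> j \<in> {1..n} \<and> i < j \<and> M i j = enat m})"

definition spherical_type :: "nat \<Rightarrow> (nat \<Rightarrow> nat \<Rightarrow> enat) \<Rightarrow> bool" where
  "spherical_type n M \<longleftrightarrow> finite (carrier (coxeter_group n M))"

definition coxeter_graph_iso ::
    "nat \<Rightarrow> (nat \<Rightarrow> nat \<Rightarrow> enat) \<Rightarrow> nat \<Rightarrow> (nat \<Rightarrow> nat \<Rightarrow> enat) \<Rightarrow> bool" where
  "coxeter_graph_iso n M n' M' \<longleftrightarrow>
    (\<exists>f. bij_betw f {1..n} {1..n'} \<and> (\<forall>i\<in>{1..n}. \<forall>j\<in>{1..n}. M' (f i) (f j) = M i j))"

text \<open>The standard graphs. The matrices of types \<open>A\<close>, \<open>H\<close>, \<open>E\<close> do not depend on the rank, which is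
  supplied separately; type \<open>B\<close> takes it in order to place the label \<open>4\<close>. The numbering of \<open>E\<^sub>7\<close> is
  that of Bourbaki.\<close>

definition cox_A :: "nat \<Rightarrow> nat \<Rightarrow> enat" where
  "cox_A i j = (if i = j then 1 else if i = Suc j \<or> j = Suc i then 3 else 2)"

definition cox_B :: "nat \<Rightarrow> nat \<Rightarrow> nat \<Rightarrow> enat" where
  "cox_B n i j =
    (if i = j then 1 else if {i, j} = {n - 1, n} then 4
     else if i = Suc j \<or> j = Suc i then 3 else 2)"

definition cox_H :: "nat \<Rightarrow> nat \<Rightarrow> enat" where
  "cox_H i j =
    (if i = j then 1 else if {i, j} = {1, 2} then 5
     else if i = Suc j \<or> j = Suc i then 3 else 2)"

definition cox_E :: "nat \<Rightarrow> nat \<Rightarrow> enat" where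
  "cox_E i j =
    (if i = j then 1
     else if {i, j} \<in> {{1, 3}, {2, 4}, {3, 4}, {4, 5}, {5, 6}, {6, 7}, {7, 8}} then 3 else 2)"

definition cox_I2 :: "nat \<Rightarrow> nat \<Rightarrow> nat \<Rightarrow> enat" where
  "cox_I2 p i j = (if i = j then 1 else enat p)"


section \<open>Up-to-center-epimorphisms\<close>

definition group_center :: "('a, 'm) monoid_scheme \<Rightarrow> 'a set" where
  "group_center G = {z \<in> carrier G. \<forall>g\<in>carrier G. g \<otimes>\<^bsub>G\<^esub> z = z \<otimes>\<^bsub>G\<^esub> g}"

definition up_to_center_epi ::
    "('a, 'm) monoid_scheme \<Rightarrow> ('b, 'k) monoid_scheme \<Rightarrow> ('a \<Rightarrow> 'b) \<Rightarrow> bool" where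
  "up_to_center_epi A W \<phi> \<longleftrightarrow>
    \<phi> \<in> hom A W \<and> carrier W = \<phi> ` carrier A <#>\<^bsub>W\<^esub> group_center W"

definition proper_up_to_center_epi ::
    "('a, 'm) monoid_scheme \<Rightarrow> ('b, 'k) monoid_scheme \<Rightarrow> ('a \<Rightarrow> 'b) \<Rightarrow> bool" where
  "proper_up_to_center_epi A W \<phi> \<longleftrightarrow> up_to_center_epi A W \<phi> \<and> \<phi> \<notin> epi A W"

definition internal_direct_product :: "('a, 'm) monoid_scheme \<Rightarrow> 'a set \<Rightarrow> 'a set \<Rightarrow> bool" where
  "internal_direct_product G H K \<longleftrightarrow>
    H \<lhd> G \<and> K \<lhd> G \<and> H \<inter> K = {\<one>\<^bsub>G\<^esub>} \<and> H <#>\<^bsub>G\<^esub> K = carrier G"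

end

theory Submission
  imports Defs "Jordan_Normal_Form.Determinant"
begin

text \<open>Averaging over the finite group \<open>W\<close> makes the geometric representation orthogonal, so its
  bilinear form is positive definite, and by the theorem of Tits it is faithful. A central element
  acts as a scalar \<open>\<plusminus>1\<close>, hence \<open>Z(W)\<close> has at most one nontrivial element \<open>z\<close>, acting as \<open>-1\<close>. A proper
  up-to-center-epimorphism misses \<open>z\<close>, so its image is a complement of \<open>Z(W)\<close> of index two;
  conversely such complements are the kernels of the characters \<open>\<chi> : W \<rightarrow> {1, -1}\<close> with \<open>\<chi> z = -1\<close>.

  If \<open>-1\<close> is in \<open>W\<close> and the rank is odd, then the determinant is such a character, and integrality of
  \<open>w \<lambda> - \<lambda>\<close> for weights \<open>\<lambda>\<close> excludes the types \<open>A\<close> and \<open>D\<close>, apart from rank one. If the rank is even,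
  \<open>\<chi>\<close> is neither trivial nor the determinant, so some edge has an even label, which leaves the types
  \<open>I\<^sub>2\<close>, \<open>B\<close> and \<open>F\<^sub>4\<close>. In these, as for \<open>H\<^sub>3\<close> and \<open>E\<^sub>7\<close>, a power of a Coxeter element is \<open>-1\<close>, from
  which \<open>\<chi> z\<close> is read off.\<close>

section \<open>Homomorphisms from presented groups\<close>

text \<open>The graph is known only through the positivity of its form, so the part of the
  classification that the statement needs has to be derived. Parity keeps this part small: in even
  rank only graphs with an even label matter, so E_6 and E_8 never come up, and H_4 enters only as a
  graph of even rank. Faithfulness turns statements about the linear map -1 into statements about an
  element of W, so that a character can be evaluated on any word acting as -1.

  Such words come from the Coxeter number h: in the types treated, z is the power h / 2 of a Coxeter
  element c, so \<chi> z is the power h / 2 of \<chi> c. The exponents n, 6, 5, 9 and q for B_n,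
  F_4, H_3, E_7 and I_2(2 q) are the values of h / 2. An even exponent rules out every character,
  which disposes of F_4 and of B_n for even n and leaves only odd q for I_2(2 q). For H_3, E_7 and
  B_n with n odd, both the exponent and the number of generators are odd, so the determinant takes
  the value -1.\<close>

definition word_eval :: "('a, 'm) monoid_scheme \<Rightarrow> ('s \<Rightarrow> 'a) \<Rightarrow> 's word \<Rightarrow> 'a" where
  "word_eval G f w = foldr (\<lambda>(s, b) x. (if b then f s else inv\<^bsub>G\<^esub> f s) \<otimes>\<^bsub>G\<^esub> x) w \<one>\<^bsub>G\<^esub>"

lemma word_eval_simps [simp]:
  "word_eval G f [] = \<one>\<^bsub>G\<^esub>"
  "word_eval G f ((s, b) # w) = (if b then f s else inv\<^bsub>G\<^esub> f s) \<otimes>\<^bsub>G\<^esub> word_eval G f w"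
  by (simp_all add: word_eval_def)

lemma words_simps [simp]:
  "[] \<in> words S" "(s, b) # w \<in> words S \<longleftrightarrow> s \<in> S \<and> w \<in> words S"
  "u @ v \<in> words S \<longleftrightarrow> u \<in> words S \<and> v \<in> words S"
  by (auto simp: words_def)

context
  fixes G :: "('a, 'm) monoid_scheme" (structure) and f :: "'s \<Rightarrow> 'a" and S :: "'s set"
  assumes G: "group G" and f: "f \<in> S \<rightarrow> carrier G"
begin

interpretation group G by (rule G)

lemma word_eval_closed: "w \<in> words S \<Longrightarrow> word_eval G f w \<in> carrier G"
  using f by (induction w) (auto simp: Pi_iff)

lemma word_eval_append:
  "u \<in> words S \<Longrightarrow> v \<in> words S \<Longrightarrow> word_eval G f (u @ v) = word_eval G f u \<otimes> word_eval G f v"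
proof (induction u)
  case (Cons a u)
  obtain s b where "a = (s, b)" by force
  moreover have "f s \<in> carrier G" using Cons.prems f calculation by auto
  ultimately show ?case using Cons word_eval_closed by (auto simp: m_assoc)
qed (simp add: word_eval_closed)

lemma word_eval_cong:
  assumes rel: "\<And>u v. (u, v) \<in> R \<Longrightarrow> u \<in> words S \<Longrightarrow> v \<in> words S \<Longrightarrow> word_eval G f u = word_eval G f v"
    and "(u, v) \<in> word_cong S R"
  shows "word_eval G f u = word_eval G f v"
  using assms(2)
proof (induction rule: word_cong.induct)
  case (mult u v u' v')
  then show ?case using word_cong_words by (metis word_eval_append)
next
  case (cancel s b)
  then have "f s \<in> carrier G" using f by auto
  then show ?case by (cases b) auto
qed (auto intro: rel)

text \<open>The universal property. The map evaluates a chosen representative of a class;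
  \<open>word_eval_cong\<close> makes the choice irrelevant.\<close>

lemma presented_group_hom:
  assumes rel: "\<And>u v. (u, v) \<in> R \<Longrightarrow> u \<in> words S \<Longrightarrow> v \<in> words S \<Longrightarrow> word_eval G f u = word_eval G f v"
  obtains h where "h \<in> hom (presented_group S R) G"
    "\<And>w. w \<in> words S \<Longrightarrow> h (word_cong S R `` {w}) = word_eval G f w"
proof -
  define h where "h X = word_eval G f (SOME w. w \<in> X)" for X
  have h: "h (word_cong S R `` {w}) = word_eval G f w" if "w \<in> words S" for w
  proof -
    have "w \<in> word_cong S R `` {w}" using that by (auto intro: word_cong.refl)
    then have "(w, SOME u. u \<in> word_cong S R `` {w}) \<in> word_cong S R"
      by (metis Image_singleton_iff someI)
    then show ?thesis using word_eval_cong[OF rel] unfolding h_def by metis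
  qed
  have "h \<in> hom (presented_group S R) G"
  proof (rule homI)
    fix X assume "X \<in> carrier (presented_group S R)"
    then obtain w where "w \<in> words S" "X = word_cong S R `` {w}"
      by (auto simp: presented_group_def quotient_def)
    then show "h X \<in> carrier G" using h word_eval_closed by simp
  next
    fix X Y assume "X \<in> carrier (presented_group S R)" "Y \<in> carrier (presented_group S R)"
    then obtain u v where "u \<in> words S" "X = word_cong S R `` {u}" "v \<in> words S" "Y = word_cong S R `` {v}"
      by (auto simp: presented_group_def quotient_def)
    then show "h (X \<otimes>\<^bsub>presented_group S R\<^esub> Y) = h X \<otimes> h Y"
      using h word_eval_append by (simp add: presented_group_mult)
  qed
  then show ?thesis using h that by blast
qed

end

section \<open>Coxeter groups\<close>

definition coxeter_rels :: "nat \<Rightarrow> (nat \<Rightarrow> nat \<Rightarrow> enat) \<Rightarrow> (nat word \<times> nat word) set" where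
  "coxeter_rels n M = {(word_pow (gen i) 2, []) | i. i \<in> {1..n}} \<union>
     {(word_pow (gen i @ gen j) m, []) | i j m.
       i \<in> {1..n} \<and> j \<in> {1..n} \<and> i < j \<and> M i j = enat m}"

abbreviation posw :: "'s list \<Rightarrow> 's word" where
  "posw xs \<equiv> map (\<lambda>i. (i, True)) xs"

lemma posw_words [simp]: "posw xs \<in> words S \<longleftrightarrow> set xs \<subseteq> S"
  by (induction xs) auto

lemma word_pow_posw: "word_pow (posw xs) k = posw (concat (replicate k xs))"
  by (simp add: word_pow_def map_concat)

lemma gen_posw: "gen i = posw [i]"
  by (simp add: gen_def)

locale coxeter =
  fixes n :: nat and M :: "nat \<Rightarrow> nat \<Rightarrow> enat"
  assumes coxeter_matrix: "coxeter_matrix n M"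
begin

declare One_nat_def [simp del]

abbreviation "V \<equiv> {1..n}"
abbreviation "W \<equiv> coxeter_group n M"

text \<open>The generators of \<open>W\<close> are involutions, so lists of generators without
  formal inverses already name every element (\<open>pr_surj\<close>). All later arguments are about
  such lists.\<close>

definition pr :: "nat list \<Rightarrow> nat word set" where
  "pr xs = word_cong V (coxeter_rels n M) `` {posw xs}"

lemma W_def: "W = presented_group V (coxeter_rels n M)"
  by (simp add: coxeter_group_def coxeter_rels_def)

sublocale W: group W
  unfolding W_def by (rule group_presented_group)

lemma M_diag [simp]: "i \<in> V \<Longrightarrow> M i i = 1"
  and M_sym: "i \<in> V \<Longrightarrow> j \<in> V \<Longrightarrow> M i j = M j i"
  and M_ge2: "i \<in> V \<Longrightarrow> j \<in> V \<Longrightarrow> i \<noteq> j \<Longrightarrow> 2 \<le> M i j"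
  using coxeter_matrix unfolding coxeter_matrix_def by (metis, metis, metis)

lemma pr_closed [simp]: "set xs \<subseteq> V \<Longrightarrow> pr xs \<in> carrier W"
  by (auto simp: W_def pr_def presented_group_def quotient_def intro!: exI[of _ "posw xs"])

lemma pr_Nil [simp]: "pr [] = \<one>\<^bsub>W\<^esub>"
  by (simp add: pr_def W_def presented_group_def)

lemma pr_append: "set xs \<subseteq> V \<Longrightarrow> set ys \<subseteq> V \<Longrightarrow> pr (xs @ ys) = pr xs \<otimes>\<^bsub>W\<^esub> pr ys"
  by (simp add: pr_def W_def presented_group_mult)

lemma pr_rel: 
  assumes "(posw xs, []) \<in> coxeter_rels n M" "set xs \<subseteq> V" shows "pr xs = \<one>\<^bsub>W\<^esub>"
  using equiv_class_eq[OF equiv_word_cong word_cong.rel[OF assms(1)], of V] assms(2)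
  by (simp add: pr_def W_def presented_group_def)

lemma pr_square: "i \<in> V \<Longrightarrow> pr [i, i] = \<one>\<^bsub>W\<^esub>"
  by (rule pr_rel) (auto simp: coxeter_rels_def gen_posw word_pow_def numeral_2_eq_2)

lemma pr_gen_inv: "i \<in> V \<Longrightarrow> inv\<^bsub>W\<^esub> (pr [i]) = pr [i]"
  using pr_square[of i] pr_append[of "[i]" "[i]"] by (intro W.inv_equality) auto

lemma pr_rev: "set xs \<subseteq> V \<Longrightarrow> inv\<^bsub>W\<^esub> (pr xs) = pr (rev xs)"
proof (induction xs)
  case (Cons a xs)
  then have "pr (a # xs) = pr [a] \<otimes>\<^bsub>W\<^esub> pr xs" using pr_append[of "[a]" xs] by simp
  then show ?case using Cons pr_append[of "rev xs" "[a]"] by (simp add: W.inv_mult_group pr_gen_inv)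
qed simp

lemma pr_pow:
  "set xs \<subseteq> V \<Longrightarrow> pr (concat (replicate k xs)) = pr xs [^]\<^bsub>W\<^esub> k"
proof (induction k)
  case (Suc k)
  have "set (concat (replicate k xs)) \<subseteq> V" using Suc.prems by auto
  moreover have "pr (concat (replicate (Suc k) xs)) = pr (xs @ concat (replicate k xs))" by simp
  ultimately show ?case using Suc by (simp only: pr_append W.nat_pow_Suc2 pr_closed)
qed simp

lemma pr_braid:
  assumes ij: "i \<in> V" "j \<in> V" "i \<noteq> j" and m: "M i j = enat m"
  shows "pr [i, j] [^]\<^bsub>W\<^esub> m = \<one>\<^bsub>W\<^esub>"
proof -
  have *: "pr [i, j] [^]\<^bsub>W\<^esub> m = \<one>\<^bsub>W\<^esub>" if "i \<in> V" "j \<in> V" "i < j" "M i j = enat m" for i j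
  proof -
    have "gen i @ gen j = posw [i, j]" by (simp add: gen_def)
    then have "(posw (concat (replicate m [i, j])), []) \<in> coxeter_rels n M"
      using that unfolding coxeter_rels_def by (auto simp flip: word_pow_posw)
    then show ?thesis using pr_rel that pr_pow[of "[i, j]" m] by fastforce
  qed
  show ?thesis
  proof (cases "i < j")
    \<comment> \<open>The presentation states the relation only with the smaller index first. The
      other order follows by inversion, since \<open>pr [i, j]\<close> is the inverse of
      \<open>pr [j, i]\<close>.\<close>
    case False
    then have "pr [j, i] [^]\<^bsub>W\<^esub> m = \<one>\<^bsub>W\<^esub>" using * ij m M_sym by force
    then have "inv\<^bsub>W\<^esub> (pr [j, i]) [^]\<^bsub>W\<^esub> m = \<one>\<^bsub>W\<^esub>" using ij by (simp add: W.nat_pow_inv)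
    then show ?thesis using ij by (simp add: pr_rev)
  qed (use * assms in auto)
qed

lemma pr_surj:
  assumes "x \<in> carrier W" obtains xs where "set xs \<subseteq> V" "x = pr xs"
proof -
  let ?c = "\<lambda>w. word_cong V (coxeter_rels n M) `` {w}"
  have "\<exists>xs. set xs \<subseteq> V \<and> ?c w = pr xs" if "w \<in> words V" for w
    using that
  proof (induction w)
    case (Cons a w)
    obtain s b where a: "a = (s, b)" by force
    with Cons obtain xs where xs: "set xs \<subseteq> V" "?c w = pr xs" by auto
    have s: "s \<in> V" "w \<in> words V" using Cons.prems a by auto
    have "?c [(s, \<not> b)] \<otimes>\<^bsub>W\<^esub> ?c [(s, b)] = \<one>\<^bsub>W\<^esub>"
      using s equiv_class_eq[OF equiv_word_cong word_cong.cancel[of s V "\<not> b" "coxeter_rels n M"]]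
      by (simp add: W_def presented_group_mult presented_group_def[THEN arg_cong[where f = one]])
    moreover have "?c [(s, b)] \<in> carrier W" "?c [(s, \<not> b)] \<in> carrier W" for b
      using s by (auto simp: W_def presented_group_def quotient_def intro!: exI[of _ "[(s, _)]"])
    ultimately have "?c [(s, b)] = inv\<^bsub>W\<^esub> ?c [(s, \<not> b)]"
      by (metis W.inv_equality W.inv_inv)
    then have "?c [(s, b)] = pr [s]" using pr_gen_inv[of s] s
      by (cases b) (auto simp: pr_def)
    moreover have "?c (a # w) = ?c [(s, b)] \<otimes>\<^bsub>W\<^esub> ?c w"
      using s a by (simp add: W_def presented_group_mult)
    ultimately have "?c (a # w) = pr (s # xs)" using xs s pr_append[of "[s]" xs] by simp
    then show ?case using xs s by (metis insert_subset list.set(2))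
  qed (auto simp: pr_def intro: exI[of _ "[]"])
  moreover obtain w where "w \<in> words V" "x = ?c w"
    using assms by (auto simp: W_def presented_group_def quotient_def)
  ultimately show ?thesis using that by metis
qed

lemma coxeter_hom:
  assumes G: "group G" and f: "f \<in> V \<rightarrow> carrier G"
    and sq: "\<And>i. i \<in> V \<Longrightarrow> f i \<otimes>\<^bsub>G\<^esub> f i = \<one>\<^bsub>G\<^esub>"
    and br: "\<And>i j m. i \<in> V \<Longrightarrow> j \<in> V \<Longrightarrow> i \<noteq> j \<Longrightarrow> M i j = enat m \<Longrightarrow>
      (f i \<otimes>\<^bsub>G\<^esub> f j) [^]\<^bsub>G\<^esub> m = \<one>\<^bsub>G\<^esub>"
  obtains h where "h \<in> hom W G" "\<And>i. i \<in> V \<Longrightarrow> h (pr [i]) = f i"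
proof -
  interpret G: group G by (rule G)
  have fc: "f i \<in> carrier G" if "i \<in> V" for i using f that by auto
  have pow: "word_eval G f (word_pow (gen i @ gen j) m) = (f i \<otimes>\<^bsub>G\<^esub> f j) [^]\<^bsub>G\<^esub> m"
    if "i \<in> V" "j \<in> V" for i j m
  proof (induction m)
    case (Suc m)
    have "word_pow (gen i @ gen j) m \<in> words V"
      using that by (induction m) (auto simp: word_pow_def gen_def)
    then have "word_eval G f (word_pow (gen i @ gen j) (Suc m)) =
       f i \<otimes>\<^bsub>G\<^esub> f j \<otimes>\<^bsub>G\<^esub> word_eval G f (word_pow (gen i @ gen j) m)"
      using fc that word_eval_closed[OF G f] by (simp add: word_pow_def gen_def G.m_assoc)
    then show ?case using Suc fc that by (simp only: G.nat_pow_Suc2 G.m_closed)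
  qed (simp add: word_pow_def)
  have sq': "word_eval G f (word_pow (gen i) 2) = \<one>\<^bsub>G\<^esub>" if "i \<in> V" for i
    using that fc sq by (simp add: word_pow_def gen_def numeral_2_eq_2)
  have "word_eval G f u = word_eval G f v" if "(u, v) \<in> coxeter_rels n M" for u v
    using that unfolding coxeter_rels_def by (auto simp: sq' pow br)
  then obtain h where h: "h \<in> hom W G" 
    "\<And>w. w \<in> words V \<Longrightarrow> h (word_cong V (coxeter_rels n M) `` {w}) = word_eval G f w"
    using presented_group_hom[OF G f] unfolding W_def by metis
  then have "h (pr [i]) = f i" if "i \<in> V" for i
    using that fc unfolding pr_def by simp
  then show ?thesis using h that by blast
qed

end

section \<open>The geometric representation\<close>

text \<open>The target for the reflections: all bijections of the whole function type, so that no
  space of vectors supported on the vertices has to be carved out.\<close>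

definition bij_group :: "('a \<Rightarrow> 'a) monoid" where
  "bij_group = \<lparr>carrier = {f. bij f}, mult = (\<circ>), one = id\<rparr>"

lemma bij_group_simps [simp]:
  "f \<in> carrier bij_group \<longleftrightarrow> bij f" "f \<otimes>\<^bsub>bij_group\<^esub> g = f \<circ> g" "\<one>\<^bsub>bij_group\<^esub> = id"
  by (simp_all add: bij_group_def)

lemma group_bij_group: "group bij_group"
proof (rule groupI)
  fix f :: "'a \<Rightarrow> 'a" assume "f \<in> carrier bij_group"
  then have "bij (inv_into UNIV f)" "inv_into UNIV f \<circ> f = id"
    by (auto simp: bij_imp_bij_inv bij_is_inj)
  then show "\<exists>g\<in>carrier bij_group. g \<otimes>\<^bsub>bij_group\<^esub> f = \<one>\<^bsub>bij_group\<^esub>"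
    by (intro bexI[of _ "inv_into UNIV f"]) auto
qed (auto simp: bij_comp comp_assoc bij_id)

lemma bij_group_pow: "f [^]\<^bsub>bij_group\<^esub> (k::nat) = f ^^ k"
  by (induction k) (simp_all add: nat_pow_def funpow_Suc_right bij_group_def del: funpow.simps(2))

definition unitv :: "nat \<Rightarrow> nat \<Rightarrow> real" where
  "unitv i = (\<lambda>k. if k = i then 1 else 0)"

lemma unitv_simps [simp]: "unitv i i = 1" "k \<noteq> i \<Longrightarrow> unitv i k = 0" "i \<noteq> k \<Longrightarrow> unitv i k = 0"
  by (auto simp: unitv_def)

context coxeter
begin

text \<open>A vector is given by its coordinates with respect to the simple roots; the coordinates outside
  \<open>V\<close> are ignored by the form and fixed by the group. \<open>b\<close> is the Gram matrix of the simple roots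
  and \<open>cp i x\<close> the product of \<open>x\<close> with the \<open>i\<close>-th simple root.\<close>

definition b :: "nat \<Rightarrow> nat \<Rightarrow> real" where
  "b i j = (if i = j then 1 else case M i j of enat k \<Rightarrow> - cos (pi / real k) | \<infinity> \<Rightarrow> -1)"

definition cp :: "nat \<Rightarrow> (nat \<Rightarrow> real) \<Rightarrow> real" where
  "cp i x = (\<Sum>j\<in>V. b i j * x j)"

definition refl :: "nat \<Rightarrow> (nat \<Rightarrow> real) \<Rightarrow> nat \<Rightarrow> real" where
  "refl i x = x(i := x i - 2 * cp i x)"

abbreviation act :: "nat list \<Rightarrow> (nat \<Rightarrow> real) \<Rightarrow> nat \<Rightarrow> real" where
  "act \<equiv> foldr refl"

lemma b_diag [simp]: "b i i = 1"
  by (simp add: b_def)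

lemma b_sym: "i \<in> V \<Longrightarrow> j \<in> V \<Longrightarrow> b i j = b j i"
  unfolding b_def using M_sym by (metis (no_types, lifting))

lemma cp_upd: "j \<in> V \<Longrightarrow> cp i (x(j := v)) = cp i x + b i j * (v - x j)"
proof -
  assume j: "j \<in> V"
  have "cp i (x(j := v)) = (\<Sum>k\<in>V. b i k * x k + (if k = j then b i j * (v - x j) else 0))"
    unfolding cp_def by (rule sum.cong) (auto simp: algebra_simps)
  then show ?thesis using j by (simp add: cp_def sum.distrib)
qed

lemma cp_lin: "cp i (\<lambda>k. a * x k + c * y k) = a * cp i x + c * cp i y"
  by (simp add: cp_def sum.distrib sum_distrib_left algebra_simps)

lemma cp_unitv: "j \<in> V \<Longrightarrow> cp i (unitv j) = b i j"
  by (simp add: cp_def unitv_def if_distrib cong: if_cong)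

lemma cp_cong: "(\<And>k. k \<in> V \<Longrightarrow> x k = y k) \<Longrightarrow> cp i x = cp i y"
  unfolding cp_def by (intro sum.cong) auto

lemma cp_refl: "i \<in> V \<Longrightarrow> cp j (refl i x) = cp j x - 2 * b j i * cp i x"
  by (simp add: refl_def cp_upd)

lemma refl_refl: "i \<in> V \<Longrightarrow> refl i (refl i x) = x"
  using cp_refl[of i i x] by (simp add: refl_def)

lemma bij_refl: "i \<in> V \<Longrightarrow> bij (refl i)"
  by (rule bijI') (metis refl_refl)+

lemma act_lin: "act xs (\<lambda>k. a * x k + c * y k) = (\<lambda>k. a * act xs x k + c * act xs y k)"
  by (induction xs) (auto simp: refl_def cp_lin algebra_simps)

lemma act_scale: "act xs (\<lambda>k. a * x k) = (\<lambda>k. a * act xs x k)"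
  using act_lin[of xs a x 0 x] by simp

lemma act_cong: "(\<And>k. k \<in> V \<Longrightarrow> x k = y k) \<Longrightarrow> k \<in> V \<Longrightarrow> act xs x k = act xs y k"
proof (induction xs arbitrary: k)
  case (Cons i xs)
  then show ?case by (auto simp: refl_def intro!: cp_cong)
qed auto

lemma act_outside: "k \<notin> set xs \<Longrightarrow> act xs x k = x k"
  by (induction xs) (auto simp: refl_def)

lemma sum_unitv: "finite A \<Longrightarrow> (\<Sum>i\<in>A. x i * unitv i k) = (if k \<in> A then x k else 0)"
  by (simp add: unitv_def if_distrib cong: if_cong)

lemma act_zero: "act xs (\<lambda>k. 0) = (\<lambda>k. 0)"
  using act_scale[of xs 0 "\<lambda>k. 0"] by simp

lemma act_sum: "finite A \<Longrightarrow> act xs (\<lambda>k. \<Sum>i\<in>A. x i * f i k) = (\<lambda>k. \<Sum>i\<in>A. x i * act xs (f i) k)"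
proof (induction rule: finite_induct)
  case (insert j A)
  have "act xs (\<lambda>k. x j * f j k + 1 * (\<Sum>i\<in>A. x i * f i k)) =
      (\<lambda>k. x j * act xs (f j) k + 1 * act xs (\<lambda>k. \<Sum>i\<in>A. x i * f i k) k)"
    by (rule act_lin)
  then show ?case using insert by simp
qed (simp add: act_zero)

lemma act_expand: "k \<in> V \<Longrightarrow> act xs x k = (\<Sum>i\<in>V. x i * act xs (unitv i) k)"
proof -
  assume k: "k \<in> V"
  have "act xs x k = act xs (\<lambda>k. \<Sum>i\<in>V. x i * unitv i k) k"
    using k by (intro act_cong) (auto simp: sum_unitv)
  then show ?thesis by (simp only: act_sum finite_atLeastAtMost)
qed

lemma label_angle:
  assumes "i \<in> V" "j \<in> V" "i \<noteq> j" "M i j = enat m"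
  shows "2 \<le> m" "b i j = - cos (pi / m)" "b j i = - cos (pi / m)" "0 < sin (pi / m)"
proof -
  show m: "2 \<le> m" using M_ge2[OF assms(1-3)] assms(4) by (metis enat_ord_simps(1) numeral_eq_enat)
  show "b i j = - cos (pi / m)" using assms by (simp add: b_def)
  then show "b j i = - cos (pi / m)" using assms b_sym by metis
  show "0 < sin (pi / m)" using m by (intro sin_gt_zero) (auto simp: field_simps)
qed

text \<open>In the plane spanned by two simple roots, \<open>(g (t + \<theta>), g t)\<close> are the coordinates of a point
  rotating with the phase \<open>t\<close>.\<close>

lemma refl_plane:
  fixes P Q :: real
  assumes ij: "i \<in> V" "j \<in> V" "i \<noteq> j" "M i j = enat m" and y: "cp i y = 0"
  defines "g \<equiv> \<lambda>t. P * sin t + Q * cos t"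
  shows "refl i (y(i := y i + g (t + pi / m), j := y j + g t)) =
    y(i := y i + g (t - pi / m), j := y j + g t)"
proof -
  \<comment> \<open>The addition theorems give g (t + a) + g (t - a) = 2 cos a g t for a = pi / m,
    so the reflection moves the phase of the coordinate at \<open>i\<close> to the other side of
    t.\<close>
  have "2 * cos (pi / m) * g t - g (t + pi / m) = g (t - pi / m)"
    unfolding g_def by (simp add: sin_add cos_add sin_diff cos_diff algebra_simps)
  then show ?thesis
    unfolding refl_def using ij label_angle(2)[OF ij] y by (auto simp: cp_upd fun_eq_iff algebra_simps)
qed

text \<open>Split \<open>x\<close> into a part \<open>y\<close> orthogonal to both roots, which is
  fixed, and a part in their plane, whose phase drops by 2 pi / m with each round
  \<open>[j, i]\<close>. The closed form in \<open>k\<close> serves twice: k = m gives the braid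
  relation, and k = m / 2 for even m gives -1 in rank two.\<close>

lemma dihedral_repr:
  assumes ij: "i \<in> V" "j \<in> V" "i \<noteq> j" "M i j = enat m"
  obtains y P Q where "cp i y = 0" "cp j y = 0"
    "\<forall>k. act (concat (replicate k [j, i])) x =
      y(i := y i + (P * sin ((1 - 2 * real k) * (pi / m)) + Q * cos ((1 - 2 * real k) * (pi / m))),
        j := y j + (P * sin (- 2 * real k * (pi / m)) + Q * cos (- 2 * real k * (pi / m))))"
proof -
  define c s where "c = cos (pi / m)" and "s = sin (pi / m)"
  have s: "s \<noteq> 0" "s * s + c * c = 1" using label_angle(4)[OF ij] sin_cos_squared_add3[of "pi / m"]
    by (simp_all add: s_def c_def add.commute)
  then have "s * s = 1 - c * c" by simp
  \<comment> \<open>The solution of the linear system for the component of \<open>x\<close> in the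
    plane of the two roots; its Gram determinant is 1 - c * c = s * s.\<close>
  define \<alpha> \<beta> where "\<alpha> = (cp i x + c * cp j x) / (s * s)" and "\<beta> = (cp j x + c * cp i x) / (s * s)"
  define y where "y = x(i := x i - \<alpha>, j := x j - \<beta>)"
  have "(\<alpha> - c * \<beta>) * (s * s) = cp i x * (1 - c * c)" "(\<beta> - c * \<alpha>) * (s * s) = cp j x * (1 - c * c)"
    using s(1) by (simp_all add: \<alpha>_def \<beta>_def field_simps)
  then have "\<alpha> - c * \<beta> = cp i x" "\<beta> - c * \<alpha> = cp j x"
    using s(1) unfolding \<open>s * s = 1 - c * c\<close>[symmetric] by simp_all
  then have y: "cp i y = 0" "cp j y = 0"
    using ij label_angle(2,3)[OF ij] by (simp_all add: y_def cp_upd c_def algebra_simps)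
  \<comment> \<open>Chosen so that k = 0 gives back \<open>x\<close>: the values at the phases pi /
    m and 0 must be \<alpha> and \<beta>.\<close>
  define P Q where "P = (\<alpha> - \<beta> * c) / s" and "Q = \<beta>"
  define g where "g = (\<lambda>t. P * sin t + Q * cos t)"
  have g: "g (pi / m) = \<alpha>" "g 0 = \<beta>" using s(1) by (simp_all add: g_def P_def Q_def c_def s_def)
  have "act (concat (replicate k [j, i])) x = 
    y(i := y i + g ((1 - 2 * real k) * (pi / m)), j := y j + g (- 2 * real k * (pi / m)))" for k
  proof (induction k)
    case 0
    then show ?case using g ij by (auto simp: y_def)
  next
    case (Suc k)
    let ?t = "- 2 * real k * (pi / m)"
    have "?t + pi / m = (1 - 2 * real k) * (pi / m)" by (simp add: algebra_simps)
    then have 1: "refl i (act (concat (replicate k [j, i])) x) =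
        y(i := y i + g (?t - pi / m), j := y j + g ?t)"
      using refl_plane[OF ij y(1), of P ?t Q] Suc unfolding g_def by metis
    have ji: "j \<in> V" "i \<in> V" "j \<noteq> i" "M j i = enat m" using ij M_sym by auto
    have 2: "?t - pi / m = (1 - 2 * real (Suc k)) * (pi / m)" "?t - pi / m - pi / m = - 2 * real (Suc k) * (pi / m)"
      by (simp_all add: algebra_simps)
    have "refl j (y(j := y j + g ((?t - pi / m) + pi / m), i := y i + g (?t - pi / m))) =
        y(j := y j + g (?t - pi / m - pi / m), i := y i + g (?t - pi / m))"
      using refl_plane[OF ji y(2), of P "?t - pi / m" Q] unfolding g_def .
    moreover have "?t - pi / m + pi / m = ?t" by simp
    ultimately have "refl j (y(i := y i + g (?t - pi / m), j := y j + g ?t)) =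
        y(i := y i + g (?t - pi / m), j := y j + g (?t - pi / m - pi / m))"
      using fun_upd_twist[OF ij(3)] by metis
    then have "act (concat (replicate (Suc k) [j, i])) x =
        y(i := y i + g (?t - pi / m), j := y j + g (?t - pi / m - pi / m))"
      using 1 by simp
    then show ?case unfolding 2(2) unfolding 2(1) .
  qed
  then show ?thesis using that[of y P Q] y unfolding g_def by blast
qed

lemma act_replicate: "act (concat (replicate k xs)) x = (act xs ^^ k) x"
  by (induction k) simp_all

lemma act_braid:
  assumes ij: "i \<in> V" "j \<in> V" "i \<noteq> j" "M i j = enat m"
  shows "(refl i \<circ> refl j) ^^ m = id"
proof
  fix x
  have ji: "j \<in> V" "i \<in> V" "j \<noteq> i" "M j i = enat m" using ij M_sym by auto
  obtain y P Q where "cp j y = 0" "cp i y = 0" and *: "\<forall>k. act (concat (replicate k [i, j])) x =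
      y(j := y j + (P * sin ((1 - 2 * real k) * (pi / m)) + Q * cos ((1 - 2 * real k) * (pi / m))),
        i := y i + (P * sin (- 2 * real k * (pi / m)) + Q * cos (- 2 * real k * (pi / m))))"
    by (rule dihedral_repr[OF ji, of x])
  have m: "real m \<noteq> 0" using label_angle(1)[OF ij] by simp
  \<comment> \<open>After m rounds both phases have dropped by a full turn.\<close>
  then have "(1 - 2 * real m) * (pi / m) = pi / m - 2 * pi" "- 2 * real m * (pi / m) = - (2 * pi)"
    by (simp_all add: field_simps)
  then have "act (concat (replicate m [i, j])) x = act (concat (replicate 0 [i, j])) x"
    unfolding *[rule_format] by (simp add: sin_diff cos_diff)
  then show "((refl i \<circ> refl j) ^^ m) x = id x"
    unfolding act_replicate by (simp add: comp_def)
qed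

text \<open>Choosing a word makes this a total function defined directly from \<open>act\<close>.
  That the choice is immaterial is \<open>rho_pr\<close>, which obtains it from the universal
  property of \<open>W\<close>.\<close>

definition rho :: "nat word set \<Rightarrow> (nat \<Rightarrow> real) \<Rightarrow> nat \<Rightarrow> real" where
  "rho w = act (SOME xs. set xs \<subseteq> V \<and> pr xs = w)"

lemma rho_pr:
  assumes "set xs \<subseteq> V" shows "rho (pr xs) = act xs"
proof -
  have "(refl i \<otimes>\<^bsub>bij_group\<^esub> refl j) [^]\<^bsub>bij_group\<^esub> m = \<one>\<^bsub>bij_group\<^esub>"
    if "i \<in> V" "j \<in> V" "i \<noteq> j" "M i j = enat m" for i j and m :: nat
    using act_braid[OF that] by (simp add: bij_group_pow)
  moreover have "refl i \<otimes>\<^bsub>bij_group\<^esub> refl i = \<one>\<^bsub>bij_group\<^esub>" if "i \<in> V" for i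
    using refl_refl[OF that] by (simp add: fun_eq_iff)
  ultimately obtain h where h: "h \<in> hom W bij_group" "\<And>i. i \<in> V \<Longrightarrow> h (pr [i]) = refl i"
    using coxeter_hom[OF group_bij_group, of refl] bij_refl by (metis Pi_I bij_group_simps(1))
  then interpret h: group_hom W bij_group h
    by (simp add: group_hom_def group_hom_axioms_def group_bij_group W.is_group)
  have *: "h (pr xs) = act xs" if "set xs \<subseteq> V" for xs
    using that
  proof (induction xs)
    case (Cons a xs)
    then have "h (pr (a # xs)) = h (pr [a] \<otimes>\<^bsub>W\<^esub> pr xs)" using pr_append[of "[a]" xs] by simp
    also have "\<dots> = h (pr [a]) \<circ> h (pr xs)" using Cons.prems by (subst h.hom_mult) auto
    finally show ?case using Cons h(2) by simp
  qed (use h.hom_one in \<open>simp add: id_def\<close>)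
  have "\<exists>ys. set ys \<subseteq> V \<and> pr ys = pr xs" using assms by blast
  then have "set (SOME ys. set ys \<subseteq> V \<and> pr ys = pr xs) \<subseteq> V \<and> pr (SOME ys. set ys \<subseteq> V \<and> pr ys = pr xs) = pr xs"
    by (rule someI_ex)
  then show ?thesis using * assms unfolding rho_def by metis
qed

lemma act_eq: "set xs \<subseteq> V \<Longrightarrow> set ys \<subseteq> V \<Longrightarrow> pr xs = pr ys \<Longrightarrow> act xs = act ys"
  using rho_pr by metis

lemma rho_mult: "v \<in> carrier W \<Longrightarrow> w \<in> carrier W \<Longrightarrow> rho (v \<otimes>\<^bsub>W\<^esub> w) x = rho v (rho w x)"
proof -
  assume "v \<in> carrier W" "w \<in> carrier W"
  then obtain xs ys where *: "set xs \<subseteq> V" "v = pr xs" "set ys \<subseteq> V" "w = pr ys" by (metis pr_surj)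
  have "rho (pr (xs @ ys)) = act (xs @ ys)" using * by (intro rho_pr) simp
  then show ?thesis using * by (simp add: rho_pr pr_append)
qed

end

section \<open>Faithfulness of the geometric representation\<close>

fun alt_list :: "'a \<Rightarrow> 'a \<Rightarrow> nat \<Rightarrow> 'a list" where
  "alt_list s t 0 = []"
| "alt_list s t (Suc k) = s # alt_list t s k"

lemma length_alt_list [simp]: "length (alt_list s t k) = k"
  by (induction s t k rule: alt_list.induct) auto

lemma set_alt_list: "set (alt_list s t k) \<subseteq> {s, t}"
  by (induction s t k rule: alt_list.induct) auto

lemma take_alt_list: "m \<le> k \<Longrightarrow> take m (alt_list s t k) = alt_list s t m"
proof (induction s t k arbitrary: m rule: alt_list.induct)
  case (2 s t k)
  then show ?case by (cases m) auto
qed simp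

lemma alt_list_even: "alt_list s t (2 * k) = concat (replicate k [s, t])"
  by (induction k) auto

lemma alt_list_odd: "alt_list s t (Suc (2 * k)) = concat (replicate k [s, t]) @ [s]"
  by (induction k) auto

lemma alt_listI:
  assumes "set u \<subseteq> {s, t}" "\<And>p a q. u \<noteq> p @ [a, a] @ q" "u = [] \<or> hd u = s"
  shows "u = alt_list s t (length u)"
  using assms
proof (induction u arbitrary: s t)
  case (Cons a u)
  have a: "a = s" using Cons.prems by simp
  have "u = [] \<or> hd u = t"
  proof (cases u)
    case (Cons c v)
    then have "c \<noteq> a" using Cons.prems(2)[of "[]" a v] by auto
    then show ?thesis using Cons.prems(1) a Cons by auto
  qed simp
  moreover have "u \<noteq> p @ [c, c] @ q" for p c q
    using Cons.prems(2)[of "a # p" c q] by auto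
  ultimately have "u = alt_list t s (length u)"
    using Cons.prems(1) by (intro Cons.IH) auto
  then show ?case using a by simp
qed simp

context coxeter
begin

text \<open>Cut x ^ m = 1 in the middle, where x is the product of the two generators: for m = 2 k
  the power x ^ k is its own inverse, and for m = 2 k + 1 the inverse of x ^ k is x ^ k times
  x.\<close>

lemma pr_braid':
  assumes ij: "i \<in> V" "j \<in> V" "i \<noteq> j" and m: "M i j = enat m"
  shows "pr (alt_list i j m) = pr (alt_list j i m)"
proof -
  have *: "pr (concat (replicate k [i, j])) = pr [i, j] [^]\<^bsub>W\<^esub> k"
       "pr (concat (replicate k [j, i])) = inv\<^bsub>W\<^esub> (pr [i, j]) [^]\<^bsub>W\<^esub> k" for k
    using ij by (simp_all add: pr_pow pr_rev)
  let ?x = "pr [i, j]"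
  have x: "?x \<in> carrier W" "?x [^]\<^bsub>W\<^esub> m = \<one>\<^bsub>W\<^esub>" using ij pr_braid[OF ij m] by auto
  define k where "k = m div 2"
  consider "m = 2 * k" | "m = Suc (2 * k)" unfolding k_def by linarith
  then show ?thesis
  proof cases
    case 1
    have "?x [^]\<^bsub>W\<^esub> k \<otimes>\<^bsub>W\<^esub> ?x [^]\<^bsub>W\<^esub> k = \<one>\<^bsub>W\<^esub>"
      using x 1 by (simp add: W.nat_pow_mult mult_2)
    then have "?x [^]\<^bsub>W\<^esub> k = inv\<^bsub>W\<^esub> (?x [^]\<^bsub>W\<^esub> k)" using x by (metis W.inv_equality W.nat_pow_closed)
    then show ?thesis unfolding 1 alt_list_even * using x by (simp add: W.nat_pow_inv)
  next
    case 2
    have "?x [^]\<^bsub>W\<^esub> k \<otimes>\<^bsub>W\<^esub> (?x [^]\<^bsub>W\<^esub> k \<otimes>\<^bsub>W\<^esub> ?x) = \<one>\<^bsub>W\<^esub>"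
      using x 2 by (simp add: W.nat_pow_mult mult_2 flip: W.m_assoc)
    then have "?x [^]\<^bsub>W\<^esub> k \<otimes>\<^bsub>W\<^esub> ?x = inv\<^bsub>W\<^esub> (?x [^]\<^bsub>W\<^esub> k)"
      using x by (metis W.inv_equality W.inv_inv W.inv_closed W.m_closed W.nat_pow_closed)
    then have 3: "?x [^]\<^bsub>W\<^esub> k \<otimes>\<^bsub>W\<^esub> ?x = inv\<^bsub>W\<^esub> ?x [^]\<^bsub>W\<^esub> k" using x by (simp add: W.nat_pow_inv)
    have "?x \<otimes>\<^bsub>W\<^esub> pr [j] = pr ([i, j] @ [j])" using ij by (subst pr_append) auto
    also have "\<dots> = pr [i] \<otimes>\<^bsub>W\<^esub> pr [j, j]" using ij pr_append[of "[i]" "[j, j]"] by simp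
    finally have "?x \<otimes>\<^bsub>W\<^esub> pr [j] = pr [i]" using ij by (simp add: pr_square)
    then have "?x [^]\<^bsub>W\<^esub> k \<otimes>\<^bsub>W\<^esub> pr [i] = ?x [^]\<^bsub>W\<^esub> k \<otimes>\<^bsub>W\<^esub> ?x \<otimes>\<^bsub>W\<^esub> pr [j]"
      using ij x by (simp add: W.m_assoc)
    then have "pr (concat (replicate k [i, j])) \<otimes>\<^bsub>W\<^esub> pr [i] = pr (concat (replicate k [j, i])) \<otimes>\<^bsub>W\<^esub> pr [j]"
      unfolding * 3 .
    moreover have "set (concat (replicate k [i, j])) \<subseteq> V" "set (concat (replicate k [j, i])) \<subseteq> V"
      using ij by auto
    ultimately show ?thesis unfolding 2 alt_list_odd using ij by (simp add: pr_append)
  qed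
qed

text \<open>The vector is a point rotating in the plane of the roots \<open>s\<close> and
  \<open>t\<close>: each letter raises the phase by pi / m and exchanges the roles of the two roots.
  Both coordinates are sines of angles in [0, pi] until the phase passes pi, which is what bounds
  the length \<open>q\<close>. For the initial phase pi / m the vector is a multiple of the root
  \<open>s\<close>.\<close>

lemma alt_list_act_nonneg:
  assumes st: "s \<in> V" "t \<in> V" "s \<noteq> t" "M s t = enat m"
    and "pi / m \<le> \<tau>" "\<tau> + real q * (pi / m) \<le> pi"
  shows "0 \<le> act (rev (alt_list t s q)) (\<lambda>k. if k = s then sin \<tau> else if k = t then sin (\<tau> - pi / m) else 0) k"
  using assms
proof (induction q arbitrary: s t \<tau>)
  case 0
  have "0 \<le> pi / m" by simp
  then have "0 \<le> \<tau>" "\<tau> - pi / m \<le> pi" using 0 by (simp_all del: divide_nonneg_nonneg)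
  then have "0 \<le> sin \<tau>" "0 \<le> sin (\<tau> - pi / m)" using 0 by (auto intro!: sin_ge_zero)
  then show ?case by simp
next
  case (Suc q)
  have ts: "t \<in> V" "s \<in> V" "t \<noteq> s" "M t s = enat m" using Suc.prems M_sym by auto
  let ?x = "\<lambda>\<tau> k. if k = s then sin \<tau> else if k = t then sin (\<tau> - pi / m) else 0"
  have cp0: "cp t (\<lambda>k. 0) = 0" by (simp add: cp_def)
  have "?x \<tau> = (\<lambda>k. 0)(s := sin \<tau>, t := sin (\<tau> - pi / m))" using Suc.prems by auto
  then have "cp t (?x \<tau>) = b t s * sin \<tau> + sin (\<tau> - pi / m)"
    using Suc.prems cp0 by (simp add: cp_upd)
  then have "refl t (?x \<tau>) t = 2 * cos (pi / m) * sin \<tau> - sin (\<tau> - pi / m)"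
    using Suc.prems label_angle(2)[OF ts] by (simp add: refl_def)
  also have "\<dots> = sin (\<tau> + pi / m)" by (simp add: sin_add sin_diff)
  finally have "refl t (?x \<tau>) = (\<lambda>k. if k = t then sin (\<tau> + pi / m) else if k = s then sin (\<tau> + pi / m - pi / m) else 0)"
    using Suc.prems by (auto simp: refl_def fun_eq_iff)
  moreover have "pi / m \<le> \<tau> + pi / m" using Suc.prems by (smt (verit) divide_nonneg_nonneg of_nat_0_le_iff pi_ge_zero)
  moreover have "\<tau> + pi / m + real q * (pi / m) \<le> pi" using Suc.prems by (simp add: algebra_simps add_divide_distrib)
  ultimately show ?case using Suc.IH[OF ts] by simp
qed

definition reduced :: "nat list \<Rightarrow> bool" where
  "reduced xs \<longleftrightarrow> set xs \<subseteq> V \<and> (\<forall>ys. set ys \<subseteq> V \<longrightarrow> pr ys = pr xs \<longrightarrow> length xs \<le> length ys)"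

text \<open>For reduced \<open>xs\<close> this says that the length does not drop when
  \<open>s\<close> is appended. It is phrased through words, so that no length function is
  introduced.\<close>

definition ascent :: "nat list \<Rightarrow> nat \<Rightarrow> bool" where
  "ascent xs s \<longleftrightarrow> s \<in> V \<and> (\<forall>ys. set ys \<subseteq> V \<longrightarrow> pr ys = pr (xs @ [s]) \<longrightarrow> length xs \<le> length ys)"

lemma pr_append_cong:
  assumes "set u \<subseteq> V" "set u' \<subseteq> V" "set v \<subseteq> V" "set v' \<subseteq> V" "pr u = pr u'" "pr v = pr v'"
  shows "pr (u @ v) = pr (u' @ v')"
  using assms by (simp add: pr_append)

lemma pr_square': "s \<in> V \<Longrightarrow> set p \<subseteq> V \<Longrightarrow> set q \<subseteq> V \<Longrightarrow> pr (p @ [s, s] @ q) = pr (p @ q)"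
  using pr_append[of "[s, s]" q] pr_append[of p "[s, s] @ q"] pr_append[of p q] by (simp add: pr_square)

lemma reduced_exists:
  assumes "set xs \<subseteq> V" obtains ys where "reduced ys" "pr ys = pr xs"
proof -
  let ?P = "\<lambda>ys. set ys \<subseteq> V \<and> pr ys = pr xs"
  have "?P xs" using assms by simp
  then obtain ys where "?P ys" "\<forall>zs. ?P zs \<longrightarrow> length ys \<le> length zs"
    using ex_has_least_nat[of ?P _ length] by blast
  then show ?thesis using that[of ys] by (simp add: reduced_def)
qed

text \<open>Tits: split off from \<open>xs\<close> the longest possible suffix \<open>u\<close> in \<open>s\<close> and a last letter \<open>t\<close> of \<open>xs\<close>. What
  remains has ascents at both \<open>s\<close> and \<open>t\<close>, and \<open>u\<close> is an alternating word shorter than the label of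
  \<open>s, t\<close>, which keeps the root \<open>s\<close> in the cone spanned by the roots \<open>s\<close> and \<open>t\<close>.\<close>

lemma act_unitv_nonneg:
  assumes fin: "\<And>i j. i \<in> V \<Longrightarrow> j \<in> V \<Longrightarrow> M i j \<noteq> \<infinity>"
    and "reduced xs" "ascent xs s"
  shows "0 \<le> act xs (unitv s) k"
  using assms(2,3)
proof (induction "length xs" arbitrary: xs s rule: less_induct)
  case less
  show ?case
  proof (cases xs rule: rev_cases)
    case Nil
    then show ?thesis by (simp add: unitv_def)
  next
    case (snoc xs' t)
    have V: "s \<in> V" "t \<in> V" "set xs \<subseteq> V" "set xs' \<subseteq> V"
      using less.prems snoc by (auto simp: reduced_def ascent_def)
    have red: "length xs \<le> length ys" if "set ys \<subseteq> V" "pr ys = pr xs" for ys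
      using less.prems that by (auto simp: reduced_def)
    have asc: "length xs \<le> length ys" if "set ys \<subseteq> V" "pr ys = pr (xs @ [s])" for ys
      using less.prems that by (auto simp: ascent_def)
    have "t \<noteq> s"
    proof
      assume "t = s"
      then have "pr xs' = pr (xs @ [s])" using snoc V pr_square'[of s xs' "[]"] by simp
      then show False using asc[of xs'] snoc V by simp
    qed
    \<comment> \<open>\<open>P v\<close> says that letters \<open>s\<close> and \<open>t\<close>
      complete \<open>v\<close> to a word for the element of \<open>xs\<close> without extra length.
      A shortest such \<open>v\<close> is the minimal representative of the coset modulo the
      subgroup generated by \<open>s\<close> and \<open>t\<close>.\<close>
    define P where "P v \<longleftrightarrow> (\<exists>u. set v \<subseteq> V \<and> set u \<subseteq> {s, t} \<and> pr (v @ u) = pr xs \<and> length v + length u = length xs)" for v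
    have "P xs'" unfolding P_def using snoc V by (intro exI[of _ "[t]"]) auto
    then obtain v where "P v" and min: "\<And>v'. P v' \<Longrightarrow> length v \<le> length v'"
      using ex_has_least_nat[of P xs' length] by blast
    then obtain u where u: "set v \<subseteq> V" "set u \<subseteq> {s, t}" "pr (v @ u) = pr xs" "length v + length u = length xs"
      by (auto simp: P_def)
    have uV: "set u \<subseteq> V" using u V by auto
    have v: "length v < length xs" using min[OF \<open>P xs'\<close>] snoc by simp
    have redv: "reduced v" unfolding reduced_def
    proof (intro conjI allI impI)
      fix ys assume ys: "set ys \<subseteq> V" "pr ys = pr v"
      then have "pr (ys @ u) = pr xs" using u uV pr_append_cong[of ys v u u] by simp
      then show "length v \<le> length ys" using red[of "ys @ u"] ys u uV by simp
    qed (use u in auto)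
    have asv: "ascent v a" if a: "a \<in> {s, t}" for a unfolding ascent_def
    proof (intro conjI allI impI)
      show aV: "a \<in> V" using that V by auto
      fix ys assume ys: "set ys \<subseteq> V" "pr ys = pr (v @ [a])"
      show "length v \<le> length ys"
      proof (rule ccontr)
        assume less: "\<not> length v \<le> length ys"
        \<comment> \<open>A word \<open>ys\<close> for \<open>v @ [a]\<close> that is shorter than
          \<open>v\<close> would allow the letter \<open>a\<close> to pass into the right factor,
          and then \<open>ys\<close> would beat the minimal choice \<open>v\<close>.\<close>
        have "pr (ys @ a # u) = pr ((v @ [a]) @ a # u)"
          using ys u uV aV by (intro pr_append_cong) auto
        also have "\<dots> = pr xs" using pr_square'[OF aV u(1) uV] u by simp
        finally have *: "pr (ys @ a # u) = pr xs" .
        then have "length xs \<le> length ys + Suc (length u)" using red[of "ys @ a # u"] ys u uV aV by simp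
        then have "length ys + length (a # u) = length xs" using less u by simp
        then have "P ys" unfolding P_def using ys * u a by (intro exI[of _ "a # u"]) auto
        then show False using min less by auto
      qed
    qed
    have redu: "length u \<le> length u'" if "set u' \<subseteq> V" "pr u' = pr u" for u'
    proof -
      have "pr (v @ u') = pr xs" using that u uV pr_append_cong[of v v u' u] by simp
      then show ?thesis using red[of "v @ u'"] that u by simp
    qed
    have ascu: "length u \<le> length u'" if "set u' \<subseteq> V" "pr u' = pr (u @ [s])" for u'
    proof -
      have "pr (v @ u') = pr ((v @ u) @ [s])"
        using that u uV V pr_append_cong[of v v u' "u @ [s]"] by simp
      also have "\<dots> = pr (xs @ [s])" using u uV V by (intro pr_append_cong) auto
      finally show ?thesis using asc[of "v @ u'"] that u by simp
    qed
    let ?q = "length u"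
    have "rev u = alt_list t s (length (rev u))"
    proof (rule alt_listI)
      show "set (rev u) \<subseteq> {t, s}" using u by auto
      show "rev u \<noteq> p @ [a, a] @ q" for p a q
      proof
        assume "rev u = p @ [a, a] @ q"
        then have e: "u = rev q @ [a, a] @ rev p" by (simp add: rev_swap)
        then have "pr (rev q @ rev p) = pr u" using uV by (simp add: pr_square'[symmetric] del: append_Cons)
        then show False using redu[of "rev q @ rev p"] e uV by auto
      qed
      show "rev u = [] \<or> hd (rev u) = t"
      proof (cases u rule: rev_cases)
        case (snoc u' a)
        have "a \<noteq> s"
        proof
          assume "a = s"
          then have "pr u' = pr (u @ [s])" using snoc uV V pr_square'[of s u' "[]"] by simp
          then show False using ascu[of u'] snoc uV by simp
        qed
        then show ?thesis using snoc u by auto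
      qed simp
    qed
    then have urev: "u = rev (alt_list t s ?q)" by (metis length_rev rev_rev_ident)
    obtain m where m: "M s t = enat m" using fin[of s t] V by auto
    have mt: "M t s = enat m" using m V M_sym by auto
    have m2: "2 \<le> m" using label_angle(1) V m \<open>t \<noteq> s\<close> by metis
    \<comment> \<open>Otherwise the last \<open>m\<close> letters of \<open>u\<close> can be braided
      so that they end in \<open>s\<close>; appending \<open>s\<close> then cancels, which
      contradicts the ascent at \<open>s\<close>.\<close>
    have "?q < m"
    proof (rule ccontr)
      assume "\<not> ?q < m"
      then have mq: "m \<le> ?q" by simp
      define r where "r = rev (drop m (alt_list t s ?q))"
      define a where "a = alt_list t s m"
      have ur: "u = r @ rev a"
        using urev take_alt_list[OF mq, of t s] append_take_drop_id[of m "alt_list t s ?q"]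
        unfolding r_def a_def by (metis rev_append)
      have sets: "set r \<subseteq> V" "set (alt_list x y k) \<subseteq> V" if "{x, y} = {s, t}" for x y k
        using ur uV set_alt_list[of x y k] that V by auto
      obtain m' where m': "m = Suc m'" using m2 by (cases m) auto
      have "pr (rev (alt_list t s m)) = pr (rev (alt_list s t m))"
        using pr_rev[symmetric] pr_braid'[OF V(2,1) \<open>t \<noteq> s\<close> mt] sets by (metis insert_commute)
      also have "rev (alt_list s t m) = rev (alt_list t s m') @ [s]" using m' by simp
      finally have "pr (u @ [s]) = pr ((r @ rev (alt_list t s m') @ [s]) @ [s])"
        unfolding ur a_def using sets[of t s] sets[of s t] V by (intro pr_append_cong) (auto simp: insert_commute)
      also have "\<dots> = pr (r @ rev (alt_list t s m'))"
        using pr_square'[of s "r @ rev (alt_list t s m')" "[]"] sets[of t s] V by (auto simp: insert_commute)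
      finally have "length u \<le> length (r @ rev (alt_list t s m'))"
        using ascu[of "r @ rev (alt_list t s m')"] sets[of t s] by (auto simp: insert_commute)
      then show False using ur m' a_def by simp
    qed
    have mpos: "0 < pi / m" using m2 by simp
    define \<alpha> where "\<alpha> = act u (unitv s)"
    have sin: "0 < sin (pi / m)" using label_angle(4) V m \<open>t \<noteq> s\<close> by metis
    have \<alpha>: "0 \<le> \<alpha> k" for k
    proof -
      have "real (Suc ?q) * (pi / m) \<le> real m * (pi / m)"
        using \<open>?q < m\<close> mpos by (intro mult_right_mono) auto
      then have "pi / m + real ?q * (pi / m) \<le> pi" using m2 by (simp add: algebra_simps add_divide_distrib)
      from alt_list_act_nonneg[OF V(1,2) \<open>t \<noteq> s\<close>[symmetric] m order_refl this, of k]
      have "0 \<le> act u (\<lambda>k. if k = s then sin (pi / m) else if k = t then sin (pi / m - pi / m) else 0) k"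
        using urev by simp
      moreover have "(\<lambda>k. if k = s then sin (pi / m) else if k = t then sin (pi / m - pi / m) else 0) = (\<lambda>k. sin (pi / m) * unitv s k)"
        by (auto simp: unitv_def)
      ultimately show ?thesis unfolding \<alpha>_def using sin by (simp add: act_scale zero_le_mult_iff)
    qed
    have "\<alpha> k = 0" if "k \<notin> {s, t}" for k
      unfolding \<alpha>_def using act_outside[of k u "unitv s"] u that by (auto simp: unitv_def)
    then have \<alpha>': "\<alpha> = (\<lambda>k. \<alpha> s * unitv s k + \<alpha> t * unitv t k)"
      using \<open>t \<noteq> s\<close> by (auto simp: fun_eq_iff unitv_def)
    have "act xs = act (v @ u)" using act_eq[of xs "v @ u"] u uV V by simp
    then have "act xs (unitv s) k = act v \<alpha> k" by (simp add: \<alpha>_def)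
    also have "\<dots> = \<alpha> s * act v (unitv s) k + \<alpha> t * act v (unitv t) k"
      by (subst \<alpha>') (simp add: act_lin)
    also have "\<dots> \<ge> 0"
      using \<alpha> less.hyps[OF v redv] asv by (intro add_nonneg_nonneg mult_nonneg_nonneg) auto
    finally show ?thesis .
  qed
qed

text \<open>A nonempty reduced word with last letter \<open>t\<close> sends the root
  \<open>t\<close> to minus a vector with nonnegative coordinates, so its coordinate at
  \<open>t\<close> cannot be 1. This is why the hypothesis asks only for diagonal entries.\<close>

theorem act_faithful:
  assumes fin: "\<And>i j. i \<in> V \<Longrightarrow> j \<in> V \<Longrightarrow> M i j \<noteq> \<infinity>"
    and xs: "set xs \<subseteq> V" and id: "\<And>s. s \<in> V \<Longrightarrow> act xs (unitv s) s = 1"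
  shows "pr xs = \<one>\<^bsub>W\<^esub>"
proof -
  obtain ys where ys: "reduced ys" "pr ys = pr xs" using reduced_exists[OF xs] by blast
  show ?thesis
  proof (cases ys rule: rev_cases)
    case (snoc zs t)
    have V: "t \<in> V" "set zs \<subseteq> V" using ys snoc by (auto simp: reduced_def)
    have "ascent zs t" using ys snoc V unfolding reduced_def ascent_def
      by (metis Suc_leD length_append_singleton)
    moreover have "reduced zs" unfolding reduced_def
    proof (intro conjI allI impI)
      fix vs assume vs: "set vs \<subseteq> V" "pr vs = pr zs"
      then have "pr (vs @ [t]) = pr ys" using V snoc pr_append_cong[of vs zs "[t]" "[t]"] by simp
      moreover have "set (vs @ [t]) \<subseteq> V" using vs V by simp
      ultimately have "length ys \<le> length (vs @ [t])" using ys unfolding reduced_def by metis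
      then show "length zs \<le> length vs" using snoc by simp
    qed (rule V)
    ultimately have 1: "0 \<le> act zs (unitv t) t" using act_unitv_nonneg[OF fin] by blast
    have "refl t (unitv t) = (\<lambda>k. (-1) * unitv t k)"
      using cp_unitv[OF V(1), of t] by (simp add: refl_def fun_eq_iff)
    then have "act ys (unitv t) t = - act zs (unitv t) t"
      using act_scale[of zs "-1" "unitv t"] snoc by simp
    moreover have "act ys = act xs" using ys xs by (intro act_eq) (auto simp: reduced_def)
    ultimately show ?thesis using 1 id[OF V(1)] by simp
  qed (use ys in simp)
qed

end

section \<open>Positive definiteness and the center\<close>

context coxeter
begin

definition dot :: "(nat \<Rightarrow> real) \<Rightarrow> (nat \<Rightarrow> real) \<Rightarrow> real" where
  "dot x y = (\<Sum>k\<in>V. x k * y k)"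

definition bil :: "(nat \<Rightarrow> real) \<Rightarrow> (nat \<Rightarrow> real) \<Rightarrow> real" where
  "bil x y = (\<Sum>i\<in>V. x i * cp i y)"

definition ip :: "(nat \<Rightarrow> real) \<Rightarrow> (nat \<Rightarrow> real) \<Rightarrow> real" where
  "ip x y = (\<Sum>w\<in>carrier W. dot (rho w x) (rho w y))"

lemma rho_lin: "rho w (\<lambda>k. a * x k + c * y k) = (\<lambda>k. a * rho w x k + c * rho w y k)"
  unfolding rho_def by (rule act_lin)

lemma rho_cong: "(\<And>k. k \<in> V \<Longrightarrow> x k = y k) \<Longrightarrow> k \<in> V \<Longrightarrow> rho w x k = rho w y k"
  unfolding rho_def by (rule act_cong)

lemma rho_gen: "i \<in> V \<Longrightarrow> rho (pr [i]) = refl i"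
  by (simp add: rho_pr fun_eq_iff)

lemma rho_one [simp]: "rho \<one>\<^bsub>W\<^esub> x = x"
  using rho_pr[of "[]"] by simp

lemma refl_unitv: "i \<in> V \<Longrightarrow> refl i (unitv i) = (\<lambda>k. - unitv i k)"
  using cp_unitv[of i i] by (auto simp: refl_def unitv_def fun_eq_iff)

lemma refl_expand: "refl i x = (\<lambda>k. 1 * x k + (- 2 * cp i x) * unitv i k)"
  by (auto simp: refl_def unitv_def fun_eq_iff)

lemma ip_sym: "ip x y = ip y x"
  by (simp add: ip_def dot_def mult.commute)

lemma ip_lin: "ip (\<lambda>k. a * x k + c * y k) z = a * ip x z + c * ip y z"
  by (simp add: ip_def dot_def rho_lin sum.distrib sum_distrib_left algebra_simps)

lemma ip_neg: "ip (\<lambda>k. - x k) z = - ip x z"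
  using ip_lin[of "-1" x 0 x z] by simp

lemma ip_cong: "(\<And>k. k \<in> V \<Longrightarrow> x k = y k) \<Longrightarrow> ip x z = ip y z"
  unfolding ip_def dot_def by (intro sum.cong HOL.refl arg_cong2[where f = "(*)"] rho_cong) auto

lemma ip_sum: "finite A \<Longrightarrow> ip (\<lambda>k. \<Sum>i\<in>A. x i * f i k) z = (\<Sum>i\<in>A. x i * ip (f i) z)"
proof (induction rule: finite_induct)
  case empty
  show ?case using ip_lin[of 0 "\<lambda>k. 0" 0 "\<lambda>k. 0" z] by simp
next
  case (insert j A)
  then show ?case using ip_lin[of "x j" "f j" 1 "\<lambda>k. \<Sum>i\<in>A. x i * f i k" z] by simp
qed

lemma ip_rho: 
  assumes g: "g \<in> carrier W" shows "ip (rho g x) (rho g y) = ip x y"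
proof -
  have "(\<Sum>w\<in>carrier W. dot (rho (w \<otimes>\<^bsub>W\<^esub> g) x) (rho (w \<otimes>\<^bsub>W\<^esub> g) y)) = ip x y"
    unfolding ip_def
    by (rule sum.reindex_bij_witness[where i = "\<lambda>w. w \<otimes>\<^bsub>W\<^esub> inv\<^bsub>W\<^esub> g" and j = "\<lambda>w. w \<otimes>\<^bsub>W\<^esub> g"])
      (use g in \<open>auto simp: W.m_assoc\<close>)
  then show ?thesis using g by (simp add: ip_def rho_mult)
qed

text \<open>As \<open>refl i\<close> preserves the averaged product, it is the orthogonal reflection in \<open>unitv i\<close>.\<close>

lemma ip_unitv:
  assumes i: "i \<in> V" shows "ip x (unitv i) = cp i x * ip (unitv i) (unitv i)"
proof -
  have "ip (refl i x) (refl i (unitv i)) = ip x (unitv i)"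
    using ip_rho[of "pr [i]"] i by (simp add: rho_gen)
  moreover have "ip (refl i x) (refl i (unitv i)) = - ip (refl i x) (unitv i)"
    unfolding refl_unitv[OF i] using ip_sym ip_neg by metis
  moreover have "ip (refl i x) (unitv i) = ip x (unitv i) - 2 * cp i x * ip (unitv i) (unitv i)"
    unfolding refl_expand[of i x] ip_lin by simp
  ultimately show ?thesis by simp
qed

section \<open>Entries of the Gram matrix in terms of the labels\<close>

lemma edge_angle:
  assumes "i \<in> V" "j \<in> V" "i \<noteq> j" "0 < k" "enat k \<le> M i j"
  shows "b i j \<le> - cos (pi / k)"
proof (cases "M i j")
  case (enat m)
  then have "k \<le> m" using assms by simp
  then have "cos (pi / k) \<le> cos (pi / m)" using assms(4)
    by (intro cos_monotone_0_pi_le) (auto simp: field_simps mult_le_cancel_left1)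
  then show ?thesis using assms enat by (simp add: b_def)
next
  case infinity
  then show ?thesis using assms by (simp add: b_def)
qed

lemma b_edge: "i \<in> V \<Longrightarrow> j \<in> V \<Longrightarrow> i \<noteq> j \<Longrightarrow> 3 \<le> M i j \<Longrightarrow> b i j \<le> - (1 / 2)"
  using edge_angle[of i j 3] by (simp add: cos_60 numeral_eq_enat)

lemma b_four: "i \<in> V \<Longrightarrow> j \<in> V \<Longrightarrow> i \<noteq> j \<Longrightarrow> 4 \<le> M i j \<Longrightarrow> b i j \<le> - (sqrt 2 / 2)"
  using edge_angle[of i j 4] by (simp add: cos_45 numeral_eq_enat)

lemma b_3: "i \<noteq> j \<Longrightarrow> M i j = 3 \<Longrightarrow> b i j = - (1 / 2)"
  by (simp add: b_def cos_60 numeral_eq_enat)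

lemma b_2: "i \<noteq> j \<Longrightarrow> M i j = 2 \<Longrightarrow> b i j = 0"
  by (simp add: b_def numeral_eq_enat)

lemma b_nonpos: 
  assumes "i \<in> V" "j \<in> V" "i \<noteq> j" shows "b i j \<le> 0"
  using edge_angle[of i j 2] M_ge2 assms by (simp add: numeral_eq_enat)

end

locale finite_coxeter = coxeter +
  assumes finite_W: "finite (carrier W)" and connected: "coxeter_connected n M"
begin

lemma connected_induct:
  assumes "i \<in> V" "j \<in> V" "P i"
    and step: "\<And>i j. i \<in> V \<Longrightarrow> j \<in> V \<Longrightarrow> i \<noteq> j \<Longrightarrow> 3 \<le> M i j \<Longrightarrow> P i \<Longrightarrow> P j"
  shows "P j"
proof -
  have "(i, j) \<in> (coxeter_edges n M)\<^sup>*"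
    using connected assms(1,2) by (auto simp: coxeter_connected_def)
  then show ?thesis
    by (induction rule: rtrancl_induct) (use assms in \<open>auto simp: coxeter_edges_def\<close>)
qed

lemma one_in_V: "1 \<in> V"
  using connected by (auto simp: coxeter_connected_def)

lemma ip_pos:
  assumes "k \<in> V" "x k \<noteq> 0" shows "0 < ip x x"
proof -
  have "0 < dot x x" unfolding dot_def
    using assms by (intro sum_pos2[of _ k]) (auto simp: zero_less_mult_iff)
  moreover have "0 \<le> dot y y" for y unfolding dot_def by (intro sum_nonneg) auto
  ultimately show ?thesis unfolding ip_def
    using finite_W by (intro sum_pos2[of _ "\<one>\<^bsub>W\<^esub>"]) auto
qed

text \<open>By \<open>ip_unitv\<close> the averaged product is the canonical form scaled root by
  root. Symmetry and the nonzero entries along edges make the scale constant on the connected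
  graph.\<close>

lemma ip_bil: obtains c where "0 < c" "\<And>x. ip x x = c * bil x x"
proof -
  define c where "c = ip (unitv 1) (unitv 1)"
  have c: "ip (unitv i) (unitv i) = c" if "i \<in> V" for i
  proof (rule connected_induct[OF one_in_V that])
    fix i j assume *: "i \<in> V" "j \<in> V" "i \<noteq> j" "3 \<le> M i j" "ip (unitv i) (unitv i) = c"
    have "b i j * ip (unitv i) (unitv i) = b j i * ip (unitv j) (unitv j)"
      using ip_unitv[of i "unitv j"] ip_unitv[of j "unitv i"] * ip_sym[of "unitv i" "unitv j"]
      by (simp add: cp_unitv)
    moreover have "b i j = b j i" "b i j \<noteq> 0" using b_sym b_edge[of i j] * by auto
    ultimately show "ip (unitv j) (unitv j) = c" using * by simp
  qed (simp add: c_def)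
  have "ip x x = c * bil x x" for x
  proof -
    have "ip x x = ip (\<lambda>k. \<Sum>i\<in>V. x i * unitv i k) x"
      by (intro ip_cong) (auto simp: sum_unitv)
    also have "\<dots> = (\<Sum>i\<in>V. x i * ip (unitv i) x)" by (rule ip_sum) simp
    also have "\<dots> = (\<Sum>i\<in>V. x i * (c * cp i x))"
    proof (intro sum.cong HOL.refl)
      fix i assume "i \<in> V"
      then show "x i * ip (unitv i) x = x i * (c * cp i x)"
        using ip_unitv[of i x] ip_sym[of x "unitv i"] c by simp
    qed
    finally show ?thesis by (simp add: bil_def sum_distrib_left mult.left_commute)
  qed
  moreover have "0 < c" unfolding c_def using one_in_V by (intro ip_pos[of 1]) (auto simp: unitv_def)
  ultimately show ?thesis using that by blast
qed

lemma bil_pos: "k \<in> V \<Longrightarrow> x k \<noteq> 0 \<Longrightarrow> 0 < bil x x"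
  by (rule ip_bil) (metis ip_pos zero_less_mult_pos)

text \<open>Under an infinite label two simple roots have product -1, so their sum would be a
  nonzero null vector.\<close>

lemma M_finite: 
  assumes "i \<in> V" "j \<in> V" shows "M i j \<noteq> \<infinity>"
proof
  assume inf: "M i j = \<infinity>"
  have ij: "i \<noteq> j" using inf assms by auto
  let ?x = "\<lambda>k. 1 * unitv i k + 1 * unitv j k"
  have "b i j = -1" using inf ij by (simp add: b_def)
  moreover from this have "b j i = -1" using assms b_sym by simp
  ultimately have cp: "cp i ?x = 0" "cp j ?x = 0" unfolding cp_lin using assms by (simp_all add: cp_unitv)
  have "bil ?x ?x = 0" unfolding bil_def
    by (intro sum.neutral) (use cp in \<open>auto simp: unitv_def\<close>)
  then show False using bil_pos[of i ?x] assms ij by simp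
qed

section \<open>Injectivity of the representation and the central elements\<close>

lemma rho_faithful:
  assumes "w \<in> carrier W" "\<And>i. i \<in> V \<Longrightarrow> rho w (unitv i) i = 1" shows "w = \<one>\<^bsub>W\<^esub>"
proof -
  obtain xs where xs: "set xs \<subseteq> V" "w = pr xs" using pr_surj assms(1) by blast
  show ?thesis unfolding xs(2)
    by (rule act_faithful[OF M_finite xs(1)]) (use assms(2) rho_pr xs in auto)
qed

lemma rho_inj:
  assumes v: "v \<in> carrier W" and w: "w \<in> carrier W"
    and eq: "\<And>i k. i \<in> V \<Longrightarrow> k \<in> V \<Longrightarrow> rho v (unitv i) k = rho w (unitv i) k"
  shows "v = w"
proof -
  have "rho (inv\<^bsub>W\<^esub> w \<otimes>\<^bsub>W\<^esub> v) (unitv i) i = 1" if i: "i \<in> V" for i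
  proof -
    have "rho (inv\<^bsub>W\<^esub> w) (rho v (unitv i)) i = rho (inv\<^bsub>W\<^esub> w) (rho w (unitv i)) i"
      using eq i by (intro rho_cong) auto
    then show ?thesis using v w by (simp add: rho_mult[symmetric])
  qed
  then have "inv\<^bsub>W\<^esub> w \<otimes>\<^bsub>W\<^esub> v = \<one>\<^bsub>W\<^esub>" using v w by (intro rho_faithful) auto
  then show ?thesis using v w by (metis W.inv_equality W.inv_inv W.inv_closed)
qed

lemma rho_unitv_expand: "k \<in> V \<Longrightarrow> rho w x k = (\<Sum>i\<in>V. x i * rho w (unitv i) k)"
  unfolding rho_def by (rule act_expand)

text \<open>A central element commutes with each reflection and so preserves its (-1)-eigenline, the
  line of a simple root. An edge forces equal eigenvalues at its ends, and invariance of the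
  averaged product makes the square of the eigenvalue 1.\<close>

lemma center_scalar:
  assumes z: "z \<in> group_center W"
  obtains c where "c = 1 \<or> c = -1" "\<And>i k. i \<in> V \<Longrightarrow> k \<in> V \<Longrightarrow> rho z (unitv i) k = c * unitv i k"
proof -
  have zW: "z \<in> carrier W" and comm: "\<And>g. g \<in> carrier W \<Longrightarrow> g \<otimes>\<^bsub>W\<^esub> z = z \<otimes>\<^bsub>W\<^esub> g"
    using z by (auto simp: group_center_def)
  have swap: "refl i (rho z x) = rho z (refl i x)" if "i \<in> V" for i x
    using comm[of "pr [i]"] that rho_mult[of "pr [i]" z x] rho_mult[of z "pr [i]" x] zW
    by (simp add: rho_gen)
  define l where "l i = rho z (unitv i) i" for i
  have diag: "rho z (unitv i) k = l i * unitv i k" if "i \<in> V" for i k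
  proof (cases "k = i")
    case False
    have "rho z (\<lambda>k. - unitv i k) = (\<lambda>k. - rho z (unitv i) k)"
      using rho_lin[of z "-1" "unitv i" 0 "unitv i"] by simp
    then have "refl i (rho z (unitv i)) k = - rho z (unitv i) k"
      using swap[OF that, of "unitv i"] refl_unitv[OF that] by simp
    then show ?thesis using False by (simp add: refl_def unitv_def)
  qed (simp add: l_def unitv_def)
  have l: "l i = l 1" if "i \<in> V" for i
  proof (rule connected_induct[OF one_in_V that])
    fix i j assume *: "i \<in> V" "j \<in> V" "i \<noteq> j" "3 \<le> M i j" "l i = l 1"
    have "refl j (rho z (unitv i)) j = rho z (refl j (unitv i)) j" using swap * by simp
    moreover have "rho z (unitv i) = (\<lambda>k. l i * unitv i k + 0 * unitv i k)" using diag * by auto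
    then have "cp j (rho z (unitv i)) = l i * b j i" using * by (simp only: cp_lin cp_unitv)
    ultimately have "l i * b j i = l j * b j i"
      unfolding refl_expand rho_lin using diag * by (simp add: cp_unitv)
    moreover have "b j i \<noteq> 0" using b_edge[of i j] b_sym * by auto
    ultimately show "l j = l 1" using * by simp
  qed simp
  have "rho z (unitv 1) = (\<lambda>k. l 1 * unitv 1 k + 0 * unitv 1 k)" using diag one_in_V by auto
  then have "ip (unitv 1) (unitv 1) = l 1 * (l 1 * ip (unitv 1) (unitv 1))"
    using ip_rho[OF zW, of "unitv 1" "unitv 1"] ip_lin[of "l 1" "unitv 1" 0 "unitv 1"] ip_sym by simp
  moreover have "ip (unitv 1) (unitv 1) \<noteq> 0"
    using ip_pos[of 1 "unitv 1"] one_in_V by (simp add: unitv_def)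
  ultimately have "l 1 * l 1 = 1" by simp
  then have "l 1 = 1 \<or> l 1 = -1" by (simp add: square_eq_1_iff)
  then show ?thesis using that diag l by metis
qed

lemma center_minus:
  assumes z: "z \<in> group_center W" "z \<noteq> \<one>\<^bsub>W\<^esub>" and "k \<in> V"
  shows "rho z x k = - x k"
proof -
  obtain c where c: "c = 1 \<or> c = -1" "\<And>i k. i \<in> V \<Longrightarrow> k \<in> V \<Longrightarrow> rho z (unitv i) k = c * unitv i k"
    using center_scalar z(1) by blast
  have "c \<noteq> 1" 
  proof
    assume "c = 1"
    then have "z = \<one>\<^bsub>W\<^esub>" using c z(1) by (intro rho_faithful) (auto simp: group_center_def unitv_def)
    then show False using z by simp
  qed
  then have "rho z x k = (\<Sum>i\<in>V. - x i * unitv i k)"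
    using c rho_unitv_expand[OF \<open>k \<in> V\<close>, of z x] \<open>k \<in> V\<close> by simp
  then show ?thesis using \<open>k \<in> V\<close> sum_unitv[of V "\<lambda>i. - x i" k] by simp
qed

lemma minus_unique:
  assumes "v \<in> carrier W" "w \<in> carrier W"
    and "\<And>x k. k \<in> V \<Longrightarrow> rho v x k = - x k" "\<And>x k. k \<in> V \<Longrightarrow> rho w x k = - x k"
  shows "v = w"
  using assms by (intro rho_inj) auto

lemma center_square: 
  assumes z: "z \<in> group_center W" shows "z \<otimes>\<^bsub>W\<^esub> z = \<one>\<^bsub>W\<^esub>"
proof (cases "z = \<one>\<^bsub>W\<^esub>")
  case False
  have zW: "z \<in> carrier W" using z by (simp add: group_center_def)
  then show ?thesis
    by (intro rho_faithful) (simp_all add: rho_mult center_minus[OF z False])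
qed simp

lemma minus_central:
  assumes w: "w \<in> carrier W" and minus: "\<And>x k. k \<in> V \<Longrightarrow> rho w x k = - x k"
  shows "w \<in> group_center W"
proof -
  have "g \<otimes>\<^bsub>W\<^esub> w = w \<otimes>\<^bsub>W\<^esub> g" if g: "g \<in> carrier W" for g
  proof (rule rho_inj)
    fix i k assume k: "k \<in> V"
    have "rho g (rho w (unitv i)) k = rho g (\<lambda>k. (-1) * unitv i k + 0 * unitv i k) k"
      using k minus by (intro rho_cong) auto
    then show "rho (g \<otimes>\<^bsub>W\<^esub> w) (unitv i) k = rho (w \<otimes>\<^bsub>W\<^esub> g) (unitv i) k"
      using g w k minus by (simp only: rho_mult rho_lin)
  qed (use g w in auto)
  then show ?thesis using w by (simp add: group_center_def)
qed

end

section \<open>Reduction to characters\<close>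

definition pm_group :: "int monoid" where
  "pm_group = \<lparr>carrier = {1, -1}, mult = (*), one = 1\<rparr>"

lemma pm_group_simps [simp]:
  "a \<in> carrier pm_group \<longleftrightarrow> a = 1 \<or> a = -1" "a \<otimes>\<^bsub>pm_group\<^esub> c = a * c" "\<one>\<^bsub>pm_group\<^esub> = 1"
  by (auto simp: pm_group_def)

lemma group_pm_group: "group pm_group"
  by (rule groupI) auto

lemma pm_group_pow: "a [^]\<^bsub>pm_group\<^esub> (k::nat) = a ^ k"
  by (induction k) (simp_all add: nat_pow_def pm_group_def)

context coxeter
begin

section \<open>The canonical epimorphism from the Artin group\<close>

lemma group_artin: "group (artin_group n M)"
  unfolding artin_group_def by (rule group_presented_group)

lemma alt_word_posw: "alt_word i j m = posw (alt_list i j m)"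
proof -
  have *: "word_pow [(i, True), (j, True)] k = posw (concat (replicate k [i, j]))" for k
    using word_pow_posw[of "[i, j]" k] by (simp add: gen_def)
  consider k where "m = 2 * k" | k where "m = Suc (2 * k)" by (metis oddE evenE Suc_eq_plus1)
  then show ?thesis
    by cases (auto simp: alt_word_def * alt_list_even alt_list_odd gen_def simp del: alt_list.simps)
qed

lemma word_eval_pr: "set xs \<subseteq> V \<Longrightarrow> word_eval W (\<lambda>i. pr [i]) (posw xs) = pr xs"
proof (induction xs)
  case (Cons a xs)
  then show ?case using pr_append[of "[a]" xs] by simp
qed simp

text \<open>Through this map every endomorphism of \<open>W\<close> yields a homomorphism from the
  Artin group with the same image; \<open>char_imp_proper\<close> uses it in this way.\<close>

lemma artin_epi:
  obtains h where "h \<in> hom (artin_group n M) W" "h ` carrier (artin_group n M) = carrier W"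
proof -
  let ?R = "{(alt_word i j m, alt_word j i m) | i j m. i \<in> V \<and> j \<in> V \<and> i < j \<and> M i j = enat m}"
  have f: "(\<lambda>i. pr [i]) \<in> V \<rightarrow> carrier W" by auto
  have "word_eval W (\<lambda>i. pr [i]) u = word_eval W (\<lambda>i. pr [i]) v" if uv: "(u, v) \<in> ?R" for u v
  proof -
    obtain i j m where *: "i \<in> V" "j \<in> V" "i < j" "M i j = enat m" "u = alt_word i j m" "v = alt_word j i m"
      using uv by blast
    then have "set (alt_list i j m) \<subseteq> V" "set (alt_list j i m) \<subseteq> V"
      using set_alt_list[of i j m] set_alt_list[of j i m] by auto
    then show ?thesis using * pr_braid'[of i j m] by (simp add: alt_word_posw word_eval_pr)
  qed
  then obtain h where h: "h \<in> hom (artin_group n M) W"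
      "\<And>w. w \<in> words V \<Longrightarrow> h (word_cong V ?R `` {w}) = word_eval W (\<lambda>i. pr [i]) w"
    unfolding artin_group_def by (rule presented_group_hom[OF W.is_group f, of ?R]) blast+
  have "x \<in> h ` carrier (artin_group n M)" if x: "x \<in> carrier W" for x
  proof -
    obtain xs where xs: "set xs \<subseteq> V" "x = pr xs" using pr_surj x by blast
    have "word_cong V ?R `` {posw xs} \<in> carrier (artin_group n M)"
      using xs by (auto simp: artin_group_def presented_group_def quotient_def)
    moreover have "h (word_cong V ?R `` {posw xs}) = x" using xs h(2)[of "posw xs"] by (simp add: word_eval_pr)
    ultimately show ?thesis by blast
  qed
  then have "h ` carrier (artin_group n M) = carrier W" using h(1) by (auto simp: hom_def)
  then show ?thesis using h(1) that by blast
qed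

lemma char_exists:
  assumes f: "\<And>i. f i = 1 \<or> f i = (-1::int)"
    and br: "\<And>i j m. i \<in> V \<Longrightarrow> j \<in> V \<Longrightarrow> i \<noteq> j \<Longrightarrow> M i j = enat m \<Longrightarrow> (f i * f j) ^ m = 1"
  obtains \<chi> where "\<chi> \<in> hom W pm_group" "\<And>i. i \<in> V \<Longrightarrow> \<chi> (pr [i]) = f i"
proof (rule coxeter_hom[OF group_pm_group, of f])
  show "f \<in> V \<rightarrow> carrier pm_group" using f by simp
  fix i show "f i \<otimes>\<^bsub>pm_group\<^esub> f i = \<one>\<^bsub>pm_group\<^esub>" using f[of i] by auto
next
  fix i j and m :: nat assume "i \<in> V" "j \<in> V" "i \<noteq> j" "M i j = enat m"
  then show "(f i \<otimes>\<^bsub>pm_group\<^esub> f j) [^]\<^bsub>pm_group\<^esub> m = \<one>\<^bsub>pm_group\<^esub>"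
    using br by (simp add: pm_group_pow)
qed (use that in blast)

section \<open>Characters with values 1 and -1\<close>

context
  fixes \<chi> assumes \<chi>: "\<chi> \<in> hom W pm_group"
begin

lemma char_mult: "x \<in> carrier W \<Longrightarrow> y \<in> carrier W \<Longrightarrow> \<chi> (x \<otimes>\<^bsub>W\<^esub> y) = \<chi> x * \<chi> y"
  using hom_mult[OF \<chi>] by simp

lemma char_values: "x \<in> carrier W \<Longrightarrow> \<chi> x = 1 \<or> \<chi> x = -1"
  using hom_in_carrier[OF \<chi>] by simp

lemma char_one: "\<chi> \<one>\<^bsub>W\<^esub> = 1"
  using char_mult[of "\<one>\<^bsub>W\<^esub>" "\<one>\<^bsub>W\<^esub>"] char_values[of "\<one>\<^bsub>W\<^esub>"] by auto

lemma char_pr: "set xs \<subseteq> V \<Longrightarrow> \<chi> (pr xs) = (\<Prod>i\<leftarrow>xs. \<chi> (pr [i]))"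
proof (induction xs)
  case (Cons a xs)
  then show ?case using char_mult[of "pr [a]" "pr xs"] pr_append[of "[a]" xs] by simp
qed (simp add: char_one)

lemma char_replicate: "set xs \<subseteq> V \<Longrightarrow> \<chi> (pr (concat (replicate k xs))) = \<chi> (pr xs) ^ k"
proof (induction k)
  case (Suc k)
  have "set (concat (replicate k xs)) \<subseteq> V" using Suc.prems by auto
  then have "\<chi> (pr (xs @ concat (replicate k xs))) = \<chi> (pr xs) * \<chi> (pr (concat (replicate k xs)))"
    using Suc.prems by (simp add: pr_append char_mult)
  then show ?case using Suc by simp
qed (simp add: char_one)

lemma char_braid:
  assumes "i \<in> V" "j \<in> V" "i \<noteq> j" "M i j = enat m" "\<chi> (pr [i]) \<noteq> \<chi> (pr [j])"
  shows "even m"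
proof -
  have "\<chi> (pr [i]) * \<chi> (pr [j]) = -1" using assms char_values[of "pr [i]"] char_values[of "pr [j]"] by auto
  then have "\<chi> (pr [i, j]) = -1" using assms char_pr[of "[i, j]"] by simp
  moreover have "pr (concat (replicate m [i, j])) = \<one>\<^bsub>W\<^esub>" using assms pr_braid pr_pow[of "[i, j]" m] by simp
  then have "\<chi> (pr [i, j]) ^ m = 1" using assms char_replicate[of "[i, j]" m] char_one by simp
  ultimately show ?thesis by (metis minus_one_power_iff one_neq_neg_one)
qed

end

end

lemma set_mult_iff: "x \<in> H <#>\<^bsub>G\<^esub> K \<longleftrightarrow> (\<exists>h\<in>H. \<exists>k\<in>K. x = h \<otimes>\<^bsub>G\<^esub> k)"
  by (auto simp: set_mult_def)

context finite_coxeter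
begin

abbreviation "A \<equiv> artin_group n M"

section \<open>Complements of the center and characters\<close>

lemma center_carrier: "z \<in> group_center W \<Longrightarrow> z \<in> carrier W"
  by (simp add: group_center_def)

text \<open>If the image contained the center it would absorb it and be all of \<open>W\<close>, so
  some central \<open>z\<close> is missed. Any nontrivial central element acts as -1, hence equals
  \<open>z\<close> by faithfulness.\<close>

lemma proper_center:
  assumes "proper_up_to_center_epi A W \<phi>"
  obtains z where "z \<in> group_center W" "z \<notin> \<phi> ` carrier A" "z \<noteq> \<one>\<^bsub>W\<^esub>" "group_center W = {\<one>\<^bsub>W\<^esub>, z}"
    "subgroup (\<phi> ` carrier A) W" "carrier W = \<phi> ` carrier A <#>\<^bsub>W\<^esub> group_center W"
proof -
  have \<phi>: "\<phi> \<in> hom A W" "carrier W = \<phi> ` carrier A <#>\<^bsub>W\<^esub> group_center W" "\<phi> \<notin> epi A W"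
    using assms by (auto simp: proper_up_to_center_epi_def up_to_center_epi_def)
  interpret A: group A by (rule group_artin)
  interpret \<phi>: group_hom A W \<phi>
    using \<phi>(1) by (simp add: group_hom_def group_hom_axioms_def A.is_group W.is_group)
  have H: "subgroup (\<phi> ` carrier A) W" by (rule \<phi>.img_is_subgroup)
  have "\<not> group_center W \<subseteq> \<phi> ` carrier A"
  proof
    assume "group_center W \<subseteq> \<phi> ` carrier A"
    then have "h \<otimes>\<^bsub>W\<^esub> k \<in> \<phi> ` carrier A" if "h \<in> \<phi> ` carrier A" "k \<in> group_center W" for h k
      using that by (intro subgroup.m_closed[OF H]) auto
    then have "\<phi> ` carrier A <#>\<^bsub>W\<^esub> group_center W \<subseteq> \<phi> ` carrier A"
      unfolding set_mult_def by blast
    then have "carrier W \<subseteq> \<phi> ` carrier A" unfolding \<phi>(2)[symmetric] .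
    then show False using \<phi>(1,3) by (auto simp: epi_def hom_def)
  qed
  then obtain z where z: "z \<in> group_center W" "z \<notin> \<phi> ` carrier A" by blast
  have z1: "z \<noteq> \<one>\<^bsub>W\<^esub>" using z(2) subgroup.one_closed[OF H] by metis
  have "y = \<one>\<^bsub>W\<^esub> \<or> y = z" if "y \<in> group_center W" for y
  proof (cases "y = \<one>\<^bsub>W\<^esub>")
    case False
    then have "y = z"
      using that z(1) z1 by (intro minus_unique) (simp_all add: center_carrier center_minus)
    then show ?thesis ..
  qed simp
  moreover have "\<one>\<^bsub>W\<^esub> \<in> group_center W" by (simp add: group_center_def)
  ultimately have "group_center W = {\<one>\<^bsub>W\<^esub>, z}" using z(1) by blast
  then show ?thesis by (rule that[OF z z1 _ H \<phi>(2)])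
qed

lemma proper_direct_product:
  assumes "proper_up_to_center_epi A W \<phi>"
  shows "internal_direct_product W (\<phi> ` carrier A) (group_center W)"
proof -
  let ?H = "\<phi> ` carrier A"
  obtain z where z: "z \<in> group_center W" "z \<notin> ?H" "z \<noteq> \<one>\<^bsub>W\<^esub>" "group_center W = {\<one>\<^bsub>W\<^esub>, z}"
    "subgroup ?H W" "carrier W = ?H <#>\<^bsub>W\<^esub> group_center W"
    by (rule proper_center[OF assms])
  note HW = subgroup.mem_carrier[OF z(5)]
  have comm: "g \<otimes>\<^bsub>W\<^esub> y = y \<otimes>\<^bsub>W\<^esub> g" if "y \<in> group_center W" "g \<in> carrier W" for y g
    using that by (simp add: group_center_def)
  have "?H \<lhd> W"
  proof (rule W.normal_invI[OF z(5)])
    fix g h assume g: "g \<in> carrier W" and h: "h \<in> ?H"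
    \<comment> \<open>The factor \<open>y\<close> is central, so conjugation by \<open>g\<close> is
      conjugation by \<open>h'\<close>.\<close>
    obtain h' y where *: "h' \<in> ?H" "y \<in> group_center W" "g = h' \<otimes>\<^bsub>W\<^esub> y"
      using g[unfolded z(6) set_mult_iff] by blast
    have c: "h \<in> carrier W" "h' \<in> carrier W" "y \<in> carrier W" using * h HW center_carrier by auto
    have "g \<otimes>\<^bsub>W\<^esub> h \<otimes>\<^bsub>W\<^esub> inv\<^bsub>W\<^esub> g = h' \<otimes>\<^bsub>W\<^esub> (y \<otimes>\<^bsub>W\<^esub> h) \<otimes>\<^bsub>W\<^esub> (inv\<^bsub>W\<^esub> y \<otimes>\<^bsub>W\<^esub> inv\<^bsub>W\<^esub> h')"
      using c by (simp add: * W.inv_mult_group W.m_assoc)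
    also have "\<dots> = h' \<otimes>\<^bsub>W\<^esub> (h \<otimes>\<^bsub>W\<^esub> y) \<otimes>\<^bsub>W\<^esub> (inv\<^bsub>W\<^esub> y \<otimes>\<^bsub>W\<^esub> inv\<^bsub>W\<^esub> h')"
      unfolding comm[OF *(2) c(1)] ..
    also have "\<dots> = h' \<otimes>\<^bsub>W\<^esub> h \<otimes>\<^bsub>W\<^esub> (y \<otimes>\<^bsub>W\<^esub> inv\<^bsub>W\<^esub> y) \<otimes>\<^bsub>W\<^esub> inv\<^bsub>W\<^esub> h'"
      using c by (simp only: W.m_assoc W.m_closed W.inv_closed)
    also have "\<dots> = h' \<otimes>\<^bsub>W\<^esub> h \<otimes>\<^bsub>W\<^esub> inv\<^bsub>W\<^esub> h'" using c by simp
    finally show "g \<otimes>\<^bsub>W\<^esub> h \<otimes>\<^bsub>W\<^esub> inv\<^bsub>W\<^esub> g \<in> ?H"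
      using h *(1) z(5) by (simp add: subgroup.m_closed subgroup.m_inv_closed)
  qed
  moreover have "group_center W \<lhd> W"
  proof (rule W.normal_invI)
    have "inv\<^bsub>W\<^esub> z = z" using center_square[OF z(1)] center_carrier[OF z(1)] by (intro W.inv_equality)
    then show "subgroup (group_center W) W"
      using center_square[OF z(1)] center_carrier[OF z(1)] by (unfold_locales) (auto simp: z(4))
    fix g y assume g: "g \<in> carrier W" and y: "y \<in> group_center W"
    have "g \<otimes>\<^bsub>W\<^esub> y \<otimes>\<^bsub>W\<^esub> inv\<^bsub>W\<^esub> g = y"
      unfolding comm[OF y g] using g center_carrier[OF y] by (simp add: W.m_assoc)
    then show "g \<otimes>\<^bsub>W\<^esub> y \<otimes>\<^bsub>W\<^esub> inv\<^bsub>W\<^esub> g \<in> group_center W" using y by simp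
  qed
  moreover have "?H \<inter> group_center W = {\<one>\<^bsub>W\<^esub>}"
    using z(2) subgroup.one_closed[OF z(5)] by (auto simp: z(4))
  ultimately show ?thesis using z(6) by (simp add: internal_direct_product_def)
qed

text \<open>As the center is \<open>z\<close> and the identity and \<open>z\<close> is missed,
  \<open>W\<close> is the disjoint union of the image and its coset by \<open>z\<close>. The
  character is the sign that separates the two cosets.\<close>

lemma proper_imp_char:
  assumes "proper_up_to_center_epi A W \<phi>"
  obtains \<chi> z where "\<chi> \<in> hom W pm_group" "z \<in> group_center W" "\<chi> z = -1"
proof -
  let ?H = "\<phi> ` carrier A"
  obtain z where z: "z \<in> group_center W" "z \<notin> ?H" "z \<noteq> \<one>\<^bsub>W\<^esub>" "group_center W = {\<one>\<^bsub>W\<^esub>, z}"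
    "subgroup ?H W" "carrier W = ?H <#>\<^bsub>W\<^esub> group_center W"
    by (rule proper_center[OF assms])
  interpret H: subgroup ?H W by (rule z(5))
  have zW: "z \<in> carrier W" using z center_carrier by auto
  have split: "\<exists>h\<in>?H. w = h \<otimes>\<^bsub>W\<^esub> z" if w: "w \<in> carrier W" "w \<notin> ?H" for w
  proof -
    obtain h y where *: "h \<in> ?H" "y \<in> group_center W" "w = h \<otimes>\<^bsub>W\<^esub> y"
      using w(1)[unfolded z(6) set_mult_iff] by blast
    then have "y \<noteq> \<one>\<^bsub>W\<^esub>" using w(2) by auto
    then show ?thesis using * z(4) by auto
  qed
  have cancel: "y \<in> ?H" if "x \<in> ?H" "x \<otimes>\<^bsub>W\<^esub> y \<in> ?H" "y \<in> carrier W" for x y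
  proof -
    have "inv\<^bsub>W\<^esub> x \<otimes>\<^bsub>W\<^esub> (x \<otimes>\<^bsub>W\<^esub> y) \<in> ?H" using that by blast
    then show ?thesis using that H.mem_carrier by (simp flip: W.m_assoc)
  qed
  have cancel': "x \<in> ?H" if "y \<in> ?H" "x \<otimes>\<^bsub>W\<^esub> y \<in> ?H" "x \<in> carrier W" for x y
  proof -
    have "(x \<otimes>\<^bsub>W\<^esub> y) \<otimes>\<^bsub>W\<^esub> inv\<^bsub>W\<^esub> y \<in> ?H" using that by blast
    then show ?thesis using that H.mem_carrier by (simp add: W.m_assoc)
  qed
  have both: "x \<otimes>\<^bsub>W\<^esub> y \<in> ?H" if xy: "x \<notin> ?H" "y \<notin> ?H" "x \<in> carrier W" "y \<in> carrier W" for x y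
  proof -
    obtain h k where *: "h \<in> ?H" "x = h \<otimes>\<^bsub>W\<^esub> z" "k \<in> ?H" "y = k \<otimes>\<^bsub>W\<^esub> z" using split xy by meson
    have c: "h \<in> carrier W" "k \<in> carrier W" using * H.mem_carrier by auto
    then have "k \<otimes>\<^bsub>W\<^esub> z = z \<otimes>\<^bsub>W\<^esub> k" using z(1) by (simp add: group_center_def)
    then have "x \<otimes>\<^bsub>W\<^esub> y = h \<otimes>\<^bsub>W\<^esub> ((z \<otimes>\<^bsub>W\<^esub> z) \<otimes>\<^bsub>W\<^esub> k)" using * c zW by (simp add: W.m_assoc)
    then have "x \<otimes>\<^bsub>W\<^esub> y = h \<otimes>\<^bsub>W\<^esub> k" using center_square[OF z(1)] c by simp
    then show ?thesis using * by simp
  qed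
  define \<chi> where "\<chi> w = (if w \<in> ?H then 1 else -1 :: int)" for w
  have "\<chi> \<in> hom W pm_group"
  proof (rule homI)
    fix x y assume xy: "x \<in> carrier W" "y \<in> carrier W"
    then show "\<chi> (x \<otimes>\<^bsub>W\<^esub> y) = \<chi> x \<otimes>\<^bsub>pm_group\<^esub> \<chi> y"
      using cancel[of x y] cancel'[of y x] both[of x y] H.m_closed[of x y] by (auto simp only: \<chi>_def pm_group_simps split: if_splits)
  qed (simp add: \<chi>_def)
  moreover have "\<chi> z = -1" using z(2) by (simp add: \<chi>_def)
  ultimately show ?thesis using that z(1) by blast
qed

text \<open>The image is to be the kernel of \<chi>. The retraction \<pi> onto it multiplies by
  \<open>z\<close> wherever \<chi> is -1; it is multiplicative because \<open>z\<close> is a central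
  involution. Composing with the canonical epimorphism gives the map.\<close>

lemma char_imp_proper:
  assumes \<chi>: "\<chi> \<in> hom W pm_group" and z: "z \<in> group_center W" and \<chi>z: "\<chi> z = -1"
  shows "\<exists>\<phi>. proper_up_to_center_epi A W \<phi>"
proof -
  note mult = char_mult[OF \<chi>] and vals = char_values[OF \<chi>] and one = char_one[OF \<chi>]
  obtain h where h: "h \<in> hom A W" "h ` carrier A = carrier W" using artin_epi by blast
  define \<pi> where "\<pi> w = (if \<chi> w = 1 then w else w \<otimes>\<^bsub>W\<^esub> z)" for w
  have zW: "z \<in> carrier W" and zz: "z \<otimes>\<^bsub>W\<^esub> z = \<one>\<^bsub>W\<^esub>" using z center_carrier center_square by auto
  have zc: "z \<otimes>\<^bsub>W\<^esub> w = w \<otimes>\<^bsub>W\<^esub> z" if "w \<in> carrier W" for w using that z by (simp add: group_center_def)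
  have "\<pi> \<in> hom W W"
  proof (rule homI)
    fix x y assume xy: "x \<in> carrier W" "y \<in> carrier W"
    have "x \<otimes>\<^bsub>W\<^esub> z \<otimes>\<^bsub>W\<^esub> (y \<otimes>\<^bsub>W\<^esub> z) = x \<otimes>\<^bsub>W\<^esub> (z \<otimes>\<^bsub>W\<^esub> y) \<otimes>\<^bsub>W\<^esub> z" using xy zW by (simp add: W.m_assoc)
    also have "\<dots> = x \<otimes>\<^bsub>W\<^esub> y \<otimes>\<^bsub>W\<^esub> (z \<otimes>\<^bsub>W\<^esub> z)"
      unfolding zc[OF xy(2)] using xy zW by (simp add: W.m_assoc)
    finally have "x \<otimes>\<^bsub>W\<^esub> z \<otimes>\<^bsub>W\<^esub> (y \<otimes>\<^bsub>W\<^esub> z) = x \<otimes>\<^bsub>W\<^esub> y" using xy zz by simp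
    moreover have "x \<otimes>\<^bsub>W\<^esub> z \<otimes>\<^bsub>W\<^esub> y = x \<otimes>\<^bsub>W\<^esub> y \<otimes>\<^bsub>W\<^esub> z" "x \<otimes>\<^bsub>W\<^esub> (y \<otimes>\<^bsub>W\<^esub> z) = x \<otimes>\<^bsub>W\<^esub> y \<otimes>\<^bsub>W\<^esub> z"
      using xy zW zc[OF xy(2)] by (simp_all add: W.m_assoc)
    ultimately show "\<pi> (x \<otimes>\<^bsub>W\<^esub> y) = \<pi> x \<otimes>\<^bsub>W\<^esub> \<pi> y"
      using vals[of x] vals[of y] xy by (auto simp: \<pi>_def mult)
  qed (auto simp: \<pi>_def zW)
  then have hom: "\<pi> \<circ> h \<in> hom A W" using hom_compose[OF h(1)] by (simp add: comp_def hom_def)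
  have img: "(\<pi> \<circ> h) ` carrier A = \<pi> ` carrier W" using h(2) by (metis image_comp)
  have "z \<notin> \<pi> ` carrier W"
  proof
    assume "z \<in> \<pi> ` carrier W"
    then obtain w where w: "w \<in> carrier W" "z = \<pi> w" by blast
    show False
    proof (cases "\<chi> w = 1")
      case True then show ?thesis using w \<chi>z by (simp add: \<pi>_def)
    next
      case False
      then have "w = \<one>\<^bsub>W\<^esub>" using w zW by (metis \<pi>_def W.r_cancel_one')
      then show ?thesis using False one by simp
    qed
  qed
  then have nepi: "\<pi> \<circ> h \<notin> epi A W" using img zW by (auto simp: epi_def)
  have "w \<in> \<pi> ` carrier W <#>\<^bsub>W\<^esub> group_center W" if w: "w \<in> carrier W" for w
  proof (cases "\<chi> w = 1")
    case True
    then have "w = \<pi> w \<otimes>\<^bsub>W\<^esub> \<one>\<^bsub>W\<^esub>" using w by (simp add: \<pi>_def)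
    moreover have "\<one>\<^bsub>W\<^esub> \<in> group_center W" by (simp add: group_center_def)
    ultimately show ?thesis using w unfolding set_mult_iff by blast
  next
    case False
    then have "w = \<pi> w \<otimes>\<^bsub>W\<^esub> z" using w zW zz by (simp add: \<pi>_def W.m_assoc)
    then show ?thesis using w z unfolding set_mult_iff by blast
  qed
  moreover have "\<pi> ` carrier W <#>\<^bsub>W\<^esub> group_center W \<subseteq> carrier W"
    using zW center_carrier by (auto simp: set_mult_def \<pi>_def)
  ultimately have "proper_up_to_center_epi A W (\<pi> \<circ> h)"
    using hom nepi img by (auto simp: proper_up_to_center_epi_def up_to_center_epi_def)
  then show ?thesis by blast
qed

lemma word_imp_proper:
  assumes \<chi>: "\<chi> \<in> hom W pm_group" and xs: "set xs \<subseteq> V" "\<And>x k. k \<in> V \<Longrightarrow> act xs x k = - x k"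
    and "\<chi> (pr xs) = -1"
  shows "\<exists>\<phi>. proper_up_to_center_epi A W \<phi>"
  using assms by (intro char_imp_proper[OF \<chi>, of "pr xs"] minus_central) (auto simp: rho_pr)

text \<open>The character is the sign, -1 on every generator, so its value on a word is the parity
  of the length.\<close>

lemma odd_word_imp_proper:
  assumes xs: "set xs \<subseteq> V" "\<And>x k. k \<in> V \<Longrightarrow> act xs x k = - x k" and odd: "odd (length xs)"
  shows "\<exists>\<phi>. proper_up_to_center_epi A W \<phi>"
proof -
  obtain \<chi> where \<chi>: "\<chi> \<in> hom W pm_group" "\<And>i. i \<in> V \<Longrightarrow> \<chi> (pr [i]) = -1"
    using char_exists[of "\<lambda>_. -1"] by auto
  have "set xs \<subseteq> V \<Longrightarrow> (\<Prod>i\<leftarrow>xs. \<chi> (pr [i])) = (-1) ^ length xs"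
    using \<chi>(2) by (induction xs) auto
  then have "\<chi> (pr xs) = -1" using char_pr[OF \<chi>(1) xs(1)] xs(1) odd by simp
  then show ?thesis using word_imp_proper[OF \<chi>(1) xs] by blast
qed

lemma central_eq_pr:
  assumes "z \<in> group_center W" "z \<noteq> \<one>\<^bsub>W\<^esub>" "set xs \<subseteq> V" "\<And>x k. k \<in> V \<Longrightarrow> act xs x k = - x k"
  shows "z = pr xs"
  using assms by (intro minus_unique) (auto simp: center_minus center_carrier rho_pr)

end

section \<open>Words acting as minus the identity\<close>

text \<open>Stated with explicit rank and matrix outside the locale, so that it can be proved for a
  standard graph and carried to \<open>M\<close> along an isomorphism.\<close>

definition minus_word :: "nat \<Rightarrow> (nat \<Rightarrow> nat \<Rightarrow> enat) \<Rightarrow> nat list \<Rightarrow> bool" where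
  "minus_word n M w \<longleftrightarrow> set w \<subseteq> {1..n} \<and> (\<forall>x. \<forall>k\<in>{1..n}. foldr (coxeter.refl n M) w x k = - x k)"

context coxeter
begin

text \<open>Renumbering the simple roots intertwines the reflections. The premise on
  \<open>w\<close> is conditional because \<open>M'\<close> inherits the property of being a Coxeter
  matrix from \<open>M\<close> through the isomorphism.\<close>

lemma minus_word_iso:
  assumes iso: "coxeter_graph_iso n M m M'" and w: "coxeter m M' \<Longrightarrow> minus_word m M' w"
  obtains g where "n = m" "bij_betw g V V" "\<And>i j. i \<in> V \<Longrightarrow> j \<in> V \<Longrightarrow> M (g i) (g j) = M' i j"
    "minus_word n M (map g w)"
proof -
  obtain f where f: "bij_betw f V {1..m}" "\<And>i j. i \<in> V \<Longrightarrow> j \<in> V \<Longrightarrow> M' (f i) (f j) = M i j"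
    using iso by (auto simp: coxeter_graph_iso_def)
  have nm: "n = m" using bij_betw_same_card[OF f(1)] by simp
  define g where "g = inv_into V f"
  have g: "bij_betw g V V" using bij_betw_inv_into[OF f(1)] unfolding g_def nm .
  have gV: "g i \<in> V" if "i \<in> V" for i using g that by (auto simp: bij_betw_def)
  have fg: "f (g i) = i" if "i \<in> V" for i
    using bij_betw_inv_into_right[OF f(1)] that unfolding g_def nm by simp
  have M': "M (g i) (g j) = M' i j" if "i \<in> V" "j \<in> V" for i j
    using f(2)[of "g i" "g j"] gV fg that by simp
  have g_inj: "g i = g j \<longleftrightarrow> i = j" if "i \<in> V" "j \<in> V" for i j using fg that by metis
  interpret C: coxeter n M'
  proof
    show "Defs.coxeter_matrix n M'"
      unfolding coxeter_matrix_def using M' gV g_inj M_sym M_ge2 M_diag by (metis (no_types, lifting))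
  qed
  have b: "C.b i j = b (g i) (g j)" if "i \<in> V" "j \<in> V" for i j
    using M'[OF that] g_inj[OF that] by (simp add: C.b_def b_def)
  have cp: "C.cp i (\<lambda>l. x (g l)) = cp (g i) x" if "i \<in> V" for i x
  proof -
    have "C.cp i (\<lambda>l. x (g l)) = (\<Sum>j\<in>V. b (g i) (g j) * x (g j))"
      unfolding C.cp_def using b that by (intro sum.cong) auto
    also have "\<dots> = cp (g i) x" unfolding cp_def by (rule sum.reindex_bij_betw[OF g])
    finally show ?thesis .
  qed
  have act: "C.act ks (\<lambda>l. x (g l)) l = act (map g ks) x (g l)" if "set ks \<subseteq> V" "l \<in> V" for ks x l
    using that
  proof (induction ks arbitrary: l)
    case (Cons k ks)
    define X where "X = C.act ks (\<lambda>l. x (g l))"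
    define X' where "X' = act (map g ks) x"
    have X: "X l = X' (g l)" if "l \<in> V" for l using Cons that by (simp add: X_def X'_def)
    have "C.cp k X = C.cp k (\<lambda>l. X' (g l))" using X by (rule C.cp_cong)
    also have "\<dots> = cp (g k) X'" using Cons.prems by (intro cp) simp
    finally have "C.refl k X l = refl (g k) X' (g l)"
      using Cons.prems X g_inj[of l k] by (simp add: C.refl_def refl_def)
    then show ?case by (simp add: X_def X'_def)
  qed simp
  have wm: "minus_word n M' w" using w C.coxeter_axioms nm by simp
  have "minus_word n M (map g w)" unfolding minus_word_def
  proof (intro conjI allI ballI)
    show "set (map g w) \<subseteq> V" using wm gV by (auto simp: minus_word_def)
    fix x k assume "k \<in> V"
    then have "k \<in> g ` V" using g by (simp add: bij_betw_def)
    then obtain l where l: "l \<in> V" "k = g l" by blast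
    show "act (map g w) x k = - x k"
      using act[of w l x] wm l by (simp add: minus_word_def)
  qed
  then show ?thesis using that nm g M' by blast
qed

section \<open>Powers of Coxeter elements equal to minus the identity\<close>

lemma minus_word_A1: "n = 1 \<Longrightarrow> minus_word n M [1]"
proof -
  assume "n = 1"
  then have V: "V = {1}" by auto
  then have "refl 1 x 1 = - x 1" for x unfolding refl_def cp_def V by simp
  then show ?thesis unfolding minus_word_def V by simp
qed

end

text \<open>The exponent is half of the Coxeter number 18. It is reached as the cube of the cube
  \<open>d\<close>, which keeps the integer linear forms short.\<close>

lemma minus_word_E7:
  assumes "coxeter 7 cox_E"
  shows "minus_word 7 cox_E (concat (replicate 9 [1, 2, 3, 4, 5, 6, 7]))"
proof -
  interpret coxeter 7 cox_E by (rule assms)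
  have V: "{1..7::nat} = {1, 2, 3, 4, 5, 6, 7}" by auto
  have b: "b i j = (if i = j then 1
     else if {i, j} \<in> {{1, 3}, {2, 4}, {3, 4}, {4, 5}, {5, 6}, {6, 7}, {7, 8}} then - (1 / 2) else 0)" for i j
    by (auto simp: b_3 b_2 cox_E_def)
  have r: "refl 1 x = x(1 := x 3 - x 1)" "refl 2 x = x(2 := x 4 - x 2)"
    "refl 3 x = x(3 := x 1 + x 4 - x 3)" "refl 4 x = x(4 := x 2 + x 3 + x 5 - x 4)"
    "refl 5 x = x(5 := x 4 + x 6 - x 5)" "refl 6 x = x(6 := x 5 + x 7 - x 6)"
    "refl 7 x = x(7 := x 6 - x 7)" for x
    by (simp_all add: refl_def cp_def V b doubleton_eq_iff algebra_simps)
  define c where "c = act [1, 2, 3, 4, 5, 6, 7]"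
  have c: "c x 1 = x 2 - x 7" "c x 2 = x 3 - x 7" "c x 3 = x 1 + x 2 - x 7" "c x 4 = x 2 + x 3 - x 7"
    "c x 5 = x 4 - x 7" "c x 6 = x 5 - x 7" "c x 7 = x 6 - x 7" for x
    by (simp_all add: c_def r)
  define d where "d x = c (c (c x))" for x
  have d: "d x 1 = x 1 + x 2 - x 5" "d x 2 = x 2 + x 3 - x 5 - x 7"
    "d x 3 = x 1 + x 2 + x 3 - x 5 - x 6" "d x 4 = x 1 + 2 * x 2 + x 3 - x 5 - x 6 - x 7"
    "d x 5 = x 1 + x 2 + x 3 - x 5 - x 7" "d x 6 = x 2 + x 3 - x 5" "d x 7 = x 4 - x 5" for x
    by (simp_all add: d_def c)
  have "act (concat (replicate 9 [1, 2, 3, 4, 5, 6, 7])) x = d (d (d x))" for x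
    unfolding act_replicate c_def[symmetric] d_def by (simp add: numeral_eq_Suc)
  then show ?thesis by (auto simp: minus_word_def V d simp del: foldr.simps)
qed

text \<open>This graph has an even label, so it has to be recognized in order to be excluded in even
  rank.\<close>

definition cox_F4 :: "nat \<Rightarrow> nat \<Rightarrow> enat" where
  "cox_F4 i j = (if i = j then 1 else if {i, j} = {2, 3} then 4 else if {i, j} = {1, 2} \<or> {i, j} = {3, 4} then 3 else 2)"

text \<open>The exponent is half of the Coxeter number 12, reached as the square of the cube
  \<open>d\<close>.\<close>

lemma minus_word_F4:
  assumes "coxeter 4 cox_F4"
  shows "minus_word 4 cox_F4 (concat (replicate 6 [1, 2, 3, 4]))"
proof -
  interpret coxeter 4 cox_F4 by (rule assms)
  have V: "{1..4::nat} = {1, 2, 3, 4}" by auto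
  have b: "b 1 2 = - (1 / 2)" "b 2 1 = - (1 / 2)" "b 3 4 = - (1 / 2)" "b 4 3 = - (1 / 2)"
    "b 1 3 = 0" "b 3 1 = 0" "b 1 4 = 0" "b 4 1 = 0" "b 2 4 = 0" "b 4 2 = 0"
    by (simp_all add: b_3 b_2 cox_F4_def doubleton_eq_iff)
  have b': "b 2 3 = - (sqrt 2 / 2)" "b 3 2 = - (sqrt 2 / 2)"
    by (simp_all add: b_def cox_F4_def doubleton_eq_iff cos_45 numeral_eq_enat)
  have r: "refl 1 x = x(1 := x 2 - x 1)" "refl 2 x = x(2 := x 1 + sqrt 2 * x 3 - x 2)"
    "refl 3 x = x(3 := sqrt 2 * x 2 + x 4 - x 3)" "refl 4 x = x(4 := x 3 - x 4)" for x
    by (simp_all add: refl_def cp_def V b b' algebra_simps)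
  have s: "sqrt 2 * (sqrt 2 * t) = 2 * t" for t :: real by (simp flip: mult.assoc)
  define c where "c = act [1, 2, 3, 4]"
  have c: "c x 1 = x 2 - sqrt 2 * x 4" "c x 2 = x 1 + x 2 - sqrt 2 * x 4" "c x 3 = sqrt 2 * x 2 - x 4"
    "c x 4 = x 3 - x 4" for x
    by (simp_all add: c_def r algebra_simps s)
  define d where "d x = c (c (c x))" for x
  have d: "d x 1 = x 1 - sqrt 2 * x 4" "d x 2 = 2 * x 1 + x 2 - sqrt 2 * x 3 - sqrt 2 * x 4"
    "d x 3 = sqrt 2 * x 1 + sqrt 2 * x 2 - x 3 - 2 * x 4" "d x 4 = sqrt 2 * x 1 - x 4" for x
    by (simp_all add: d_def c algebra_simps s)
  have "act (concat (replicate 6 [1, 2, 3, 4])) x = d (d x)" for x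
    unfolding act_replicate c_def[symmetric] d_def by (simp add: numeral_eq_Suc)
  then show ?thesis by (auto simp: minus_word_def V d algebra_simps s simp del: foldr.simps)
qed

text \<open>At the angle pi / 5 the cosine of the triple angle is minus that of the double angle. In
  the resulting cubic the factor cos (pi / 5) + 1 is positive and splits off.\<close>

lemma golden_ratio_cos: 
  fixes c :: real defines "c \<equiv> 2 * cos (pi / 5)"
  shows "c * c = c + 1" "0 < c"
proof -
  let ?c = "cos (pi / 5)"
  have pos: "0 < ?c" by (intro cos_gt_zero_pi) (use pi_gt_zero in linarith)+
  have "cos (3 * (pi / 5)) = - cos (2 * (pi / 5))"
    using cos_minus_pi[of "2 * (pi / 5)"] cos_pi_minus[of "2 * (pi / 5)"] by (simp add: field_simps)
  then have "4 * ?c ^ 3 - 3 * ?c = 1 - 2 * ?c ^ 2"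
    unfolding cos_treble_cos cos_double_cos by simp
  then have "(?c + 1) * (4 * ?c ^ 2 - 2 * ?c - 1) = 0"
    by (simp add: algebra_simps power2_eq_square power3_eq_cube)
  then have "4 * ?c ^ 2 - 2 * ?c - 1 = 0" using pos by simp
  then show "c * c = c + 1" by (simp add: c_def power2_eq_square)
  show "0 < c" using pos by (simp add: c_def)
qed

text \<open>The exponent is half of the Coxeter number 10. Rewriting with p * p = p + 1 keeps all
  coefficients linear in the golden ratio \<open>p\<close>.\<close>

lemma minus_word_H3:
  assumes "coxeter 3 cox_H"
  shows "minus_word 3 cox_H (concat (replicate 5 [1, 2, 3]))"
proof -
  interpret coxeter 3 cox_H by (rule assms)
  have V: "{1..3::nat} = {1, 2, 3}" by auto
  define p where "p = 2 * cos (pi / 5)"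
  have cos: "cos (pi / 5) = p / 2" by (simp add: p_def)
  have s: "p * (p * t) = p * t + t" "p * p = p + 1" for t :: real
    using golden_ratio_cos(1) by (simp_all add: p_def distrib_right flip: mult.assoc)
  have b: "b 1 2 = - (p / 2)" "b 2 1 = - (p / 2)" "b 2 3 = - (1 / 2)" "b 3 2 = - (1 / 2)" "b 1 3 = 0" "b 3 1 = 0"
    by (simp_all add: b_3 b_2 cox_H_def doubleton_eq_iff) 
      (simp_all add: b_def cox_H_def doubleton_eq_iff numeral_eq_enat cos)
  have r: "refl 1 x = x(1 := p * x 2 - x 1)" "refl 2 x = x(2 := p * x 1 + x 3 - x 2)"
    "refl 3 x = x(3 := x 2 - x 3)" for x
    by (simp_all add: refl_def cp_def V b algebra_simps)
  define c where "c = act [1, 2, 3]"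
  have c: "c x 1 = p * x 1 - p * x 3" "c x 2 = p * x 1 - x 3" "c x 3 = x 2 - x 3" for x
    by (simp_all add: c_def r algebra_simps s)
  define d where "d x = c (c x)" for x
  have d: "d x 1 = p * x 1 + x 1 - p * x 2 - x 3" "d x 2 = p * x 1 + x 1 - x 2 - p * x 3"
    "d x 3 = p * x 1 - x 2" for x
    by (simp_all add: d_def c algebra_simps s)
  have "act (concat (replicate 5 [1, 2, 3])) x = d (d (c x))" for x
    unfolding act_replicate c_def[symmetric] d_def by (simp add: numeral_eq_Suc)
  then show ?thesis by (auto simp: minus_word_def V d c algebra_simps s simp del: foldr.simps)
qed

text \<open>In rank two only 0 is orthogonal to both roots, so the fixed part \<open>y\<close>
  vanishes on \<open>V\<close>. After \<open>q\<close> rounds the phase has dropped by pi, which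
  reverses the sign.\<close>

lemma (in coxeter) minus_word_dihedral:
  assumes V: "V = {i, j}" "i \<noteq> j" and m: "M i j = enat (2 * q)"
  shows "minus_word n M (concat (replicate q [j, i]))"
proof -
  have ij: "i \<in> V" "j \<in> V" using V by auto
  let ?\<theta> = "pi / real (2 * q)"
  have q: "q \<noteq> 0" and b: "b i j = - cos ?\<theta>" "b j i = - cos ?\<theta>" and s: "0 < sin ?\<theta>"
    using label_angle[OF ij V(2) m] by auto
  show ?thesis unfolding minus_word_def
  proof (intro conjI allI ballI)
    show "set (concat (replicate q [j, i])) \<subseteq> V" using ij by auto
    fix x k assume k: "k \<in> V"
    obtain y P Q where y: "cp i y = 0" "cp j y = 0" and act: "\<forall>k. act (concat (replicate k [j, i])) x =
      y(i := y i + (P * sin ((1 - 2 * real k) * ?\<theta>) + Q * cos ((1 - 2 * real k) * ?\<theta>)),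
        j := y j + (P * sin (- 2 * real k * ?\<theta>) + Q * cos (- 2 * real k * ?\<theta>)))"
      by (rule dihedral_repr[OF ij V(2) m])
    have "y i - cos ?\<theta> * y j = 0" "y j - cos ?\<theta> * y i = 0"
      using y b V(2) unfolding cp_def V(1) by auto
    moreover have "u * (1 - c * c) = (u - c * v) + c * (v - c * u)" for u v c :: real
      by (simp add: algebra_simps)
    ultimately have "y i * (1 - cos ?\<theta> * cos ?\<theta>) = 0" "y j * (1 - cos ?\<theta> * cos ?\<theta>) = 0"
      by (metis add_0_left mult_zero_right)+
    moreover have "1 - cos ?\<theta> * cos ?\<theta> = sin ?\<theta> * sin ?\<theta>"
      using sin_cos_squared_add3[of ?\<theta>] by linarith
    ultimately have y0: "y i = 0" "y j = 0" using s by auto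
    have e: "(1 - 2 * real q) * ?\<theta> = ?\<theta> - pi" "- 2 * real q * ?\<theta> = - pi"
      using q by (simp_all add: field_simps)
    have "act (concat (replicate q [j, i])) x k = - act (concat (replicate 0 [j, i])) x k"
      unfolding act[rule_format] e using k V y0 by (auto simp: sin_diff cos_diff)
    then show "act (concat (replicate q [j, i])) x k = - x k" by simp
  qed
qed

lemma minus_word_B:
  assumes C: "coxeter n (cox_B n)" and n: "2 \<le> n"
  shows "minus_word n (cox_B n) (concat (replicate n [1..<Suc n]))"
proof -
  interpret coxeter n "cox_B n" by (rule C)
  \<comment> \<open>\<open>Y\<close> below are coordinates in which \<open>W\<close> acts by signed permutations and the Coxeter element
    by a negacyclic shift.\<close>
  define s where "s k = (if k = n then sqrt 2 else 1)" for k
  define Z where "Z x k = (if k \<in> V then s k * x k else 0)" for x k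
  define t :: "nat \<Rightarrow> real" where "t k = (if k = n then 2 else 1)" for k
  have s0: "s k \<noteq> 0" for k by (simp add: s_def)
  have b: "b k j = (if j = k then 1 else 0) + (if j = k + 1 then - (s j * s k / 2) else 0) +
       (if j = k - 1 then - (s j * s k / 2) else 0)" if kj: "k \<in> V" "j \<in> V" for k j
  proof -
    consider "j = k" | "j \<noteq> k" "{k, j} = {n - 1, n}" | "j \<noteq> k" "{k, j} \<noteq> {n - 1, n}" "k = Suc j \<or> j = Suc k"
      | "j \<noteq> k" "{k, j} \<noteq> {n - 1, n}" "\<not> (k = Suc j \<or> j = Suc k)" by blast
    then show ?thesis
    proof cases
      case 1 then show ?thesis using kj by auto
    next
      case 2
      then have "cox_B n k j = enat 4" by (simp add: cox_B_def numeral_eq_enat)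
      then have "b k j = - (sqrt 2 / 2)" using 2 by (simp add: b_def cos_45)
      moreover have "k = n - 1 \<and> j = n \<or> k = n \<and> j = n - 1" using 2 by (auto simp: doubleton_eq_iff)
      moreover obtain m where "n = Suc (Suc m)" using n by (metis add_2_eq_Suc le_Suc_ex)
      ultimately show ?thesis by (auto simp: s_def)
    next
      case 3
      then have "b k j = - (1 / 2)" by (intro b_3) (auto simp: cox_B_def)
      moreover have "k \<noteq> n" "j \<noteq> n" using 3 kj n by (auto simp: doubleton_eq_iff)
      ultimately show ?thesis using 3 by (auto simp: s_def)
    next
      case 4
      then have "b k j = 0" by (intro b_2) (auto simp: cox_B_def)
      then show ?thesis using 4 kj by auto
    qed
  qed
  have cp: "2 * s k * cp k x = 2 * Z x k - t k * Z x (k - 1) - Z x (k + 1)" if k: "k \<in> V" for k x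
  proof -
    have "cp k x = (\<Sum>j\<in>V. (if j = k then x k else 0) + (if j = k + 1 then - (s j * s k / 2) * x (k + 1) else 0) +
       (if j = k - 1 then - (s j * s k / 2) * x (k - 1) else 0))"
      unfolding cp_def using b k by (intro sum.cong) (auto simp: algebra_simps)
    also have "\<dots> = x k + (if k + 1 \<in> V then - (s (k + 1) * s k / 2) * x (k + 1) else 0) +
       (if k - 1 \<in> V then - (s (k - 1) * s k / 2) * x (k - 1) else 0)"
      using k by (simp add: sum.distrib)
    finally show ?thesis using k by (auto simp: Z_def t_def s_def algebra_simps)
  qed
  have Zr: "Z (refl k x) = (Z x)(k := t k * Z x (k - 1) + Z x (k + 1) - Z x k)" if k: "k \<in> V" for k x
  proof -
    have "Z (refl k x) k = Z x k - 2 * s k * cp k x" using k by (simp add: Z_def refl_def algebra_simps)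
    then have "Z (refl k x) k = t k * Z x (k - 1) + Z x (k + 1) - Z x k" using cp[OF k, of x] by simp
    moreover have "Z (refl k x) l = Z x l" if "l \<noteq> k" for l using that by (simp add: Z_def refl_def)
    ultimately show ?thesis by auto
  qed
  define Y where "Y x k = Z x k - Z x (k - 1)" for x k
  have Z0: "Z x 0 = 0" "Z x (Suc n) = 0" for x by (simp_all add: Z_def)
  have Yr: "Y (refl k x) l = (if l = k then Y x (Suc k) else if l = Suc k then Y x k else Y x l)"
    if "k \<in> V" "k < n" "l \<in> V" for k l x
    using that by (auto simp: Y_def Zr t_def simp flip: Suc_eq_plus1)
  have Yn: "Y (refl n x) l = (if l = n then - Y x n else Y x l)" if "l \<in> V" for l x
    using that n Z0 by (auto simp: Y_def Zr t_def simp flip: Suc_eq_plus1)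
  have Yc: "Y (act [m..<Suc n] x) l = (if l < m then Y x l else if l = m then - Y x n else Y x (l - 1))"
    if "1 \<le> m" "m \<le> n" "l \<in> V" for m l x
    using that(2,1,3)
  proof (induction m arbitrary: l rule: inc_induct)
    case base
    then show ?case using Yn[of l x] by auto
  next
    case (step m)
    have "[m..<Suc n] = m # [Suc m..<Suc n]" using step by (intro upt_conv_Cons) auto
    then have "act [m..<Suc n] x = refl m (act [Suc m..<Suc n] x)" by simp
    moreover have "m \<in> V" "Suc m \<in> V" using step by auto
    ultimately show ?case using step.IH step.hyps step.prems by (auto simp: Yr)
  qed
  define c where "c = act [1..<Suc n]"
  have c: "Y (c x) l = (if l = 1 then - Y x n else Y x (l - 1))" if "l \<in> V" for x l
    using Yc[of 1 l x] that n unfolding c_def by auto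
  \<comment> \<open>After \<open>j\<close> shifts the entries that have wrapped around carry a sign;
    for j = n all of them have.\<close>
  have Yc': "Y ((c ^^ j) x) l = (if l > j then Y x (l - j) else - Y x (n + l - j))" if "j \<le> n" "l \<in> V" for j l x
    using that
  proof (induction j arbitrary: l)
    case (Suc j)
    show ?case
    proof (cases "l = 1")
      case True
      then show ?thesis using Suc n by (simp add: c)
    next
      case False
      then have "l - 1 \<in> V" using Suc.prems by auto
      then show ?thesis using Suc False by (auto simp: c simp flip: Suc_eq_plus1_left)
    qed
  qed simp
  \<comment> \<open>\<open>Z\<close> is recovered from \<open>Y\<close> by summation starting at
    \<open>Z x 0 = 0\<close>, hence the induction on \<open>k\<close>.\<close>
  have minus: "Z ((c ^^ n) x) k = - Z x k" for x k
  proof (induction k)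
    case (Suc k)
    show ?case
    proof (cases "Suc k \<in> V")
      case True
      then have "Y ((c ^^ n) x) (Suc k) = - Y x (Suc k)" using Yc'[of n "Suc k" x] by simp
      then show ?thesis using Suc by (simp add: Y_def)
    qed (simp add: Z_def)
  qed (simp add: Z0)
  show ?thesis unfolding minus_word_def
  proof (intro conjI allI ballI)
    show "set (concat (replicate n [1..<Suc n])) \<subseteq> V" by auto
    fix x k assume "k \<in> V"
    then have "s k * (c ^^ n) x k = s k * (- x k)" using minus[of x k] by (simp add: Z_def)
    then have "(c ^^ n) x k = - x k" using s0[of k] by (metis mult_cancel_left)
    then show "act (concat (replicate n [1..<Suc n])) x k = - x k" by (simp add: act_replicate c_def)
  qed
qed

section \<open>Parity and integrality constraints\<close>

context coxeter
begin

text \<open>Matrix indices start at 0 and vertices at 1, hence the \<open>Suc\<close>.\<close>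

definition act_mat :: "nat list \<Rightarrow> real mat" where
  "act_mat xs = mat n n (\<lambda>(r, c). act xs (unitv (Suc c)) (Suc r))"

definition refl_mat :: "nat \<Rightarrow> real mat" where
  "refl_mat i = mat n n (\<lambda>(r, k). (if r = k then 1 else 0) - (if Suc r = i then 2 * b i (Suc k) else 0))"

lemma act_mat_carrier [simp]: "act_mat xs \<in> carrier_mat n n" "refl_mat i \<in> carrier_mat n n"
  by (simp_all add: act_mat_def refl_mat_def)

lemma act_mat_Cons: "act_mat (i # xs) = refl_mat i * act_mat xs"
proof (rule eq_matI)
  fix r c assume "r < dim_row (refl_mat i * act_mat xs)" "c < dim_col (refl_mat i * act_mat xs)"
  then have rc: "r < n" "c < n" by (simp_all add: act_mat_def refl_mat_def)
  define y where "y = act xs (unitv (Suc c))"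
  have "(refl_mat i * act_mat xs) $$ (r, c) =
     (\<Sum>k = 0..<n. ((if r = k then 1 else 0) - (if Suc r = i then 2 * b i (Suc k) else 0)) * y (Suc k))"
    using rc by (simp add: refl_mat_def act_mat_def scalar_prod_def y_def)
  also have "\<dots> = (\<Sum>k = 0..<n. (if k = r then y (Suc r) else 0) - (if Suc r = i then 2 * (b i (Suc k) * y (Suc k)) else 0))"
    by (intro sum.cong) (auto simp: algebra_simps)
  also have "\<dots> = y (Suc r) - (if Suc r = i then 2 * (\<Sum>k = 0..<n. b i (Suc k) * y (Suc k)) else 0)"
    using rc by (simp add: sum_subtractf sum_distrib_left)
  also have "(\<Sum>k = 0..<n. b i (Suc k) * y (Suc k)) = cp i y"
    unfolding cp_def using sum.shift_bounds_Suc_ivl[of "\<lambda>k. b i k * y k" 0 n]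
    by (simp add: atLeastLessThanSuc_atLeastAtMost One_nat_def)
  also have "y (Suc r) - (if Suc r = i then 2 * cp i y else 0) = refl i y (Suc r)"
    by (simp add: refl_def)
  also have "\<dots> = act_mat (i # xs) $$ (r, c)" using rc by (simp add: act_mat_def y_def)
  finally show "act_mat (i # xs) $$ (r, c) = (refl_mat i * act_mat xs) $$ (r, c)" ..
qed (simp_all add: act_mat_def refl_mat_def)

text \<open>The matrix differs from the identity in a single row, so only the identity permutation
  survives in the Leibniz formula; the one diagonal entry other than 1 is 1 - 2 = -1.\<close>

lemma det_refl_mat:
  assumes i: "i \<in> V" shows "det (refl_mat i) = -1"
proof -
  obtain i' where i': "i = Suc i'" "i' < n" using i by (cases i) auto
  let ?t = "\<lambda>p. signof p * (\<Prod>k = 0..<n. refl_mat i $$ (k, p k)) :: real"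
  have zero: "?t p = 0" if p: "p permutes {0..<n}" "p \<noteq> id" for p
  proof -
    have "\<exists>k<n. k \<noteq> i' \<and> p k \<noteq> k"
    proof (rule ccontr)
      assume *: "\<not> ?thesis"
      have "p k = k" if "k \<noteq> i'" for k
        using * that p(1) by (cases "k < n") (auto simp: permutes_not_in)
      moreover have "p i' = i'" using calculation permutes_inj[OF p(1)] by (metis injD)
      ultimately show False using p(2) by (metis ext id_apply)
    qed
    then obtain k where k: "k < n" "k \<noteq> i'" "p k \<noteq> k" by blast
    moreover have "p k < n" using permutes_in_image[OF p(1), of k] k by simp
    ultimately have "refl_mat i $$ (k, p k) = 0" by (simp add: refl_mat_def i')
    then have "(\<Prod>k = 0..<n. refl_mat i $$ (k, p k)) = 0" using k(1) by (intro prod_zero) auto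
    then show ?thesis by simp
  qed
  have "det (refl_mat i) = sum ?t {p. p permutes {0..<n}}" by (rule det_def') simp
  also have "\<dots> = sum ?t {id}"
    using zero by (intro sum.mono_neutral_right) (auto simp: finite_permutations permutes_id)
  also have "\<dots> = (\<Prod>k = 0..<n. refl_mat i $$ (k, k))" by simp
  also have "\<dots> = (\<Prod>k = 0..<n. if k = i' then -1 else 1)"
    by (intro prod.cong) (auto simp: refl_mat_def i')
  also have "\<dots> = -1" using i' by simp
  finally show ?thesis .
qed

lemma det_act_mat: "set xs \<subseteq> V \<Longrightarrow> det (act_mat xs) = (-1) ^ length xs"
proof (induction xs)
  case Nil
  have "act_mat [] = 1\<^sub>m n" by (rule eq_matI) (auto simp: act_mat_def unitv_def)
  then show ?case by simp
next
  case (Cons i xs)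
  then show ?case by (simp add: act_mat_Cons det_mult[of _ n] det_refl_mat)
qed

text \<open>The determinant is computed twice: as that of a product of reflections and as that of
  the scalar -1.\<close>

lemma minus_word_parity:
  assumes "minus_word n M xs" shows "even (length xs) \<longleftrightarrow> even n"
proof -
  have xs: "set xs \<subseteq> V" "\<And>x k. k \<in> V \<Longrightarrow> act xs x k = - x k"
    using assms by (auto simp: minus_word_def)
  have "act_mat xs = (-1) \<cdot>\<^sub>m 1\<^sub>m n"
    using xs(2) by (intro eq_matI) (auto simp: act_mat_def unitv_def)
  then have "(-1) ^ length xs = (-1 :: real) ^ n" using det_act_mat[OF xs(1)] by simp
  then show ?thesis by (metis minus_one_power_iff one_neq_neg_one)
qed

text \<open>If all labels are at most \<open>3\<close>, the coordinates with respect to the simple roots describe the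
  root lattice and its translates by weights are invariant.\<close>

lemma weight_integral:
  assumes simply_laced: "\<forall>i\<in>V. \<forall>j\<in>V. M i j \<le> 3"
    and weight: "\<forall>i\<in>V. 2 * cp i x \<in> \<int>"
    and "set xs \<subseteq> V"
  shows "act xs x k - x k \<in> \<int>"
  using assms(3)
proof (induction xs arbitrary: k)
  case (Cons i xs)
  define y where "y = act xs x"
  have i: "i \<in> V" using Cons.prems by simp
  have y: "y k - x k \<in> \<int>" for k using Cons by (simp add: y_def)
  have b: "2 * b i j \<in> \<int>" if "j \<in> V" for j
  proof -
    have "M i j = 2 \<or> M i j = 3" if "i \<noteq> j"
    proof -
      obtain m where "M i j = enat m" using simply_laced[rule_format, OF i \<open>j \<in> V\<close>] by (cases "M i j") auto
      then show ?thesis using simply_laced[rule_format, OF i \<open>j \<in> V\<close>] M_ge2[OF i \<open>j \<in> V\<close> that]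
        by (auto simp: numeral_eq_enat)
    qed
    then show ?thesis by (cases "i = j") (auto simp: b_2 b_3)
  qed
  have "2 * cp i y = 2 * cp i x + (\<Sum>j\<in>V. 2 * b i j * (y j - x j))"
    by (simp add: cp_def sum_distrib_left right_diff_distrib sum_subtractf mult.assoc)
  also have "\<dots> \<in> \<int>"
    by (rule Ints_add[OF weight[rule_format, OF i]], rule Ints_sum, rule Ints_mult) (use b y in auto)
  finally have "2 * cp i y \<in> \<int>" .
  then have "(if k = i then 2 * cp i y else 0) \<in> \<int>" by simp
  with y[of k] have "(y k - x k) - (if k = i then 2 * cp i y else 0) \<in> \<int>" by (rule Ints_diff)
  moreover have "refl i y k - x k = (y k - x k) - (if k = i then 2 * cp i y else 0)"
    by (simp add: refl_def)
  ultimately have "refl i y k - x k \<in> \<int>" by (simp only:)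
  then show ?case by (simp add: y_def)
qed simp

text \<open>The map -1 moves a weight \<open>x\<close> by -2 x, which must lie in the root lattice.
  A weight whose double is not in the root lattice thus keeps -1 out of \<open>W\<close>.\<close>

lemma minus_word_weight:
  assumes "\<forall>i\<in>V. \<forall>j\<in>V. M i j \<le> 3" "\<forall>i\<in>V. 2 * cp i x \<in> \<int>"
    and "minus_word n M xs" "k \<in> V"
  shows "2 * x k \<in> \<int>"
proof -
  have "act xs x k - x k \<in> \<int>" using assms by (intro weight_integral) (auto simp: minus_word_def)
  then have "- x k - x k \<in> \<int>" using assms(3,4) by (simp add: minus_word_def)
  then have "- (- x k - x k) \<in> \<int>" by (rule Ints_minus)
  then show ?thesis by simp
qed

section \<open>Subgraphs of positive definite Coxeter graphs\<close>

lemma bil_alt: "bil x y = (\<Sum>i\<in>V. \<Sum>j\<in>V. b i j * x i * y j)"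
  by (simp add: bil_def cp_def sum_distrib_left mult.left_commute mult.assoc)

lemma bil_sym: "bil x y = bil y x"
  unfolding bil_alt by (subst sum.swap) (intro sum.cong; simp add: b_sym mult.commute mult.left_commute)

lemma bil_add: "bil (\<lambda>k. x k + y k) z = bil x z + bil y z"
  by (simp add: bil_def sum.distrib algebra_simps)

lemma bil_scale: "bil (\<lambda>k. a * x k) z = a * bil x z"
  by (simp add: bil_def sum_distrib_left mult.assoc)

lemma bil_add_right: "bil z (\<lambda>k. x k + y k) = bil z x + bil z y"
  using bil_add bil_sym by metis

lemma bil_scale_right: "bil z (\<lambda>k. a * x k) = a * bil z x"
  using bil_scale bil_sym by metis

lemma bil_unitv: "i \<in> V \<Longrightarrow> bil (unitv i) y = cp i y"
proof -
  assume "i \<in> V"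
  have "bil (unitv i) y = (\<Sum>k\<in>V. if k = i then cp i y else 0)"
    unfolding bil_def by (intro sum.cong) (auto simp: unitv_def)
  then show ?thesis using \<open>i \<in> V\<close> by simp
qed

lemma bil_unitv_right: "i \<in> V \<Longrightarrow> bil y (unitv i) = cp i y"
  using bil_unitv bil_sym by metis

lemma cp_add: "cp i (\<lambda>k. x k + y k) = cp i x + cp i y"
  using cp_lin[of i 1 x 1 y] by simp

lemma cp_scale: "cp i (\<lambda>k. a * x k) = a * cp i x"
  using cp_lin[of i a x 0 x] by simp

lemmas bil_simps = bil_add bil_scale bil_add_right bil_scale_right bil_unitv bil_unitv_right
  cp_add cp_scale cp_unitv

lemma bil_nonpos:
  assumes "\<And>k. 0 \<le> x k" "\<And>k. 0 \<le> y k" "\<And>k. x k = 0 \<or> y k = 0"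
  shows "bil x y \<le> 0"
proof -
  have "b i j * x i * y j \<le> 0" if "i \<in> V" "j \<in> V" for i j
  proof (cases "i = j")
    case True
    then show ?thesis using assms(3)[of i] by auto
  next
    case False
    then have "b i j \<le> 0" using b_nonpos that by blast
    then have "b i j * x i \<le> 0" using assms(1)[of i] by (rule mult_nonpos_nonneg)
    then show ?thesis using assms(2)[of j] by (rule mult_nonpos_nonneg)
  qed
  then show ?thesis unfolding bil_alt by (intro sum_nonpos)
qed

section \<open>Norms of indicator vectors\<close>

definition ind :: "nat set \<Rightarrow> nat \<Rightarrow> real" where
  "ind S k = (if k \<in> S then 1 else 0)"

lemma ind_insert: "v \<notin> S \<Longrightarrow> ind (insert v S) = (\<lambda>k. unitv v k + ind S k)"
  by (auto simp: ind_def unitv_def)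

lemma cp_ind: "S \<subseteq> V \<Longrightarrow> cp i (ind S) = (\<Sum>j\<in>S. b i j)"
  unfolding cp_def ind_def using sum.inter_restrict[of V "b i" S]
  by (simp add: if_distrib Int_absorb1 cong: if_cong)

text \<open>When all labels are at most 3 this is the number of vertices minus the number of edges
  of \<open>S\<close>, hence 1 for a tree; larger labels only decrease it.\<close>

definition size_form :: "nat set \<Rightarrow> real" where
  "size_form S = bil (ind S) (ind S)"

lemma size_form_insert:
  "v \<in> V \<Longrightarrow> v \<notin> S \<Longrightarrow> S \<subseteq> V \<Longrightarrow> size_form (insert v S) = size_form S + 1 + 2 * (\<Sum>j\<in>S. b v j)"
  by (simp add: size_form_def ind_insert bil_simps cp_ind)

lemma size_form_singleton: "v \<in> V \<Longrightarrow> size_form {v} = 1"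
  using size_form_insert[of v "{}"] by (simp add: size_form_def ind_def bil_def cp_def)

lemma adj_neq: "i \<in> V \<Longrightarrow> 3 \<le> M i j \<Longrightarrow> i \<noteq> j" "i \<in> V \<Longrightarrow> 4 \<le> M i j \<Longrightarrow> i \<noteq> j"
  by (auto simp: one_enat_def numeral_eq_enat)

lemma M_cases:
  assumes "i \<in> V" "j \<in> V" "i \<noteq> j" obtains "M i j = 2" | "M i j = 3" | "4 \<le> M i j"
proof (cases "M i j")
  case (enat m)
  then have "2 \<le> m" using M_ge2[OF assms] by (simp add: numeral_eq_enat)
  then consider "m = 2" | "m = 3" | "4 \<le> m" by linarith
  then show ?thesis using that enat by cases (auto simp: numeral_eq_enat)
qed (use that in simp)

lemma adj_if_not_2: "i \<in> V \<Longrightarrow> j \<in> V \<Longrightarrow> i \<noteq> j \<Longrightarrow> M i j \<noteq> 2 \<Longrightarrow> 3 \<le> M i j"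
  by (rule M_cases[of i j]) (auto intro: order_trans[of 3 "4::enat"])

end

context finite_coxeter
begin

lemma size_form_pos: "v \<in> V \<Longrightarrow> v \<in> S \<Longrightarrow> 0 < size_form S"
  unfolding size_form_def by (rule bil_pos[of v]) (auto simp: ind_def)

text \<open>A subset whose indicator function has norm at most \<open>1\<close> has at least as many edges as a tree;
  by positivity a further vertex is attached to it by at most one edge.\<close>

lemma grow_step:
  assumes S: "S \<subseteq> V" "size_form S \<le> 1" and u: "u \<in> S" and v: "v \<in> V" "v \<notin> S" "3 \<le> M v u"
  shows "size_form (insert v S) \<le> 1" "\<And>w. w \<in> S \<Longrightarrow> w \<noteq> u \<Longrightarrow> M v w = 2"
proof -
  have neg: "b v j \<le> 0" if "j \<in> S" for j using that S v by (intro b_nonpos) auto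
  have bu: "b v u \<le> - (1 / 2)" using u S v by (intro b_edge) auto
  have finS: "finite S" using S(1) finite_subset by blast
  have "(\<Sum>j\<in>S. b v j) = b v u + (\<Sum>j\<in>S - {u}. b v j)" using finS u by (simp add: sum.remove)
  moreover have "(\<Sum>j\<in>S - {u}. b v j) \<le> 0" using neg by (intro sum_nonpos) auto
  ultimately show "size_form (insert v S) \<le> 1" using S v bu by (simp add: size_form_insert)
  fix w assume w: "w \<in> S" "w \<noteq> u"
  show "M v w = 2"
  proof (rule ccontr)
    assume "M v w \<noteq> 2"
    then have "3 \<le> M v w" using w v S by (intro adj_if_not_2) auto
    then have bw: "b v w \<le> - (1 / 2)" using w v S by (intro b_edge) auto
    have "(\<Sum>j\<in>S. b v j) = b v u + (b v w + (\<Sum>j\<in>S - {u} - {w}. b v j))"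
      using finS u w by (simp add: sum.remove)
    moreover have "(\<Sum>j\<in>S - {u} - {w}. b v j) \<le> 0" using neg by (intro sum_nonpos) auto
    ultimately have "size_form (insert v S) \<le> 0" using bw bu S v by (simp add: size_form_insert)
    then show False using size_form_pos[OF v(1), of "insert v S"] by simp
  qed
qed

text \<open>Connectedness supplies a vertex adjacent to \<open>S\<close>, and
  \<open>grow_step\<close> makes its neighbour in \<open>S\<close> unique. This turns the tree
  property of the graph into an induction principle, used below for each shape of tree.\<close>

lemma grow:
  assumes "S \<subseteq> V" "S \<noteq> {}" "size_form S \<le> 1" "P S"
    and step: "\<And>S u v. P S \<Longrightarrow> S \<subseteq> V \<Longrightarrow> u \<in> S \<Longrightarrow> v \<in> V \<Longrightarrow> v \<notin> S \<Longrightarrow> 3 \<le> M v u \<Longrightarrow>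
      (\<And>w. w \<in> S \<Longrightarrow> w \<noteq> u \<Longrightarrow> M v w = 2) \<Longrightarrow> P (insert v S)"
  shows "P V"
  using assms(1-4)
proof (induction "card (V - S)" arbitrary: S rule: less_induct)
  case less
  show ?case
  proof (cases "S = V")
    case False
    then obtain t where t: "t \<in> V" "t \<notin> S" using less.prems by blast
    obtain s where s: "s \<in> S" using less.prems by blast
    have "\<exists>u\<in>S. \<exists>v\<in>V. v \<notin> S \<and> 3 \<le> M v u"
    proof (rule ccontr)
      assume *: "\<not> ?thesis"
      have "t \<in> S"
      proof (rule connected_induct[of s t "\<lambda>i. i \<in> S"])
        fix i j assume ij: "i \<in> V" "j \<in> V" "3 \<le> M i j" "i \<in> S"
        then have "3 \<le> M j i" using M_sym by metis
        then show "j \<in> S" using * ij by blast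
      qed (use s t less.prems in auto)
      then show False using t by simp
    qed
    then obtain u v where uv: "u \<in> S" "v \<in> V" "v \<notin> S" "3 \<le> M v u" by blast
    note g = grow_step[OF less.prems(1,3) uv]
    have "V - insert v S \<subset> V - S" using uv(2,3) by blast
    then have "card (V - insert v S) < card (V - S)" by (intro psubset_card_mono) auto
    moreover have "P (insert v S)" using step[OF less.prems(4,1) uv] g(2) by simp
    moreover have "insert v S \<subseteq> V" using less.prems(1) uv(2) by simp
    ultimately show ?thesis using less.hyps[of "insert v S"] g(1) by blast
  qed (use less in simp)
qed

definition capset :: "nat \<Rightarrow> nat set \<Rightarrow> bool" where
  "capset h X \<longleftrightarrow> (\<exists>a a'. X = {a, a'} \<and> a \<noteq> a' \<and> a \<in> V \<and> a' \<in> V \<and> 3 \<le> M h a \<and> 3 \<le> M h a') \<or>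
     (\<exists>a. X = {a} \<and> a \<in> V \<and> 4 \<le> M h a)"

text \<open>The two leaves of a fork get weight 1 each, the far end of a heavy edge gets sqrt 2. The
  same two bounds hold in both cases, so the kinds of cap need not be distinguished
  afterwards.\<close>

lemma capset_vector:
  assumes "capset h X" "h \<in> V"
  obtains x where "\<And>k. 0 \<le> x k" "\<And>k. k \<notin> X \<Longrightarrow> x k = 0" "bil x x \<le> 2" "cp h x \<le> -1"
  using assms(1) unfolding capset_def
proof (elim disjE exE conjE)
  fix a a' assume A: "X = {a, a'}" "a \<noteq> a'" "a \<in> V" "a' \<in> V" "3 \<le> M h a" "3 \<le> M h a'"
  let ?x = "\<lambda>k. unitv a k + unitv a' k"
  have "h \<noteq> a" "h \<noteq> a'" using A assms(2) adj_neq by blast+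
  then have "b h a \<le> - (1 / 2)" "b h a' \<le> - (1 / 2)" using A assms(2) by (auto intro: b_edge)
  moreover have "b a a' \<le> 0" "b a' a \<le> 0" using A by (auto intro: b_nonpos)
  ultimately have "bil ?x ?x \<le> 2" "cp h ?x \<le> -1" using A by (simp_all add: bil_simps)
  then show ?thesis using that[of ?x] A(1) by (auto simp: unitv_def)
next
  fix a assume A: "X = {a}" "a \<in> V" "4 \<le> M h a"
  let ?x = "\<lambda>k. sqrt 2 * unitv a k"
  have "h \<noteq> a" using A assms(2) adj_neq by blast
  then have "b h a \<le> - (sqrt 2 / 2)" using A assms(2) by (auto intro: b_four)
  then have "sqrt 2 * b h a \<le> sqrt 2 * - (sqrt 2 / 2)" by (intro mult_left_mono) auto
  then have "cp h ?x \<le> -1" "bil ?x ?x \<le> 2" using A by (simp_all add: bil_simps)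
  then show ?thesis using that[of ?x] A(1) by (auto simp: unitv_def)
qed

text \<open>A path with a branching or a label at least \<open>4\<close> at each end contains an affine diagram of
  type \<open>B\<close>, \<open>C\<close> or \<open>D\<close>, whose null vector has the entry \<open>2\<close> on the path.\<close>

lemma capset_contradiction:
  assumes P: "P \<subseteq> V" "size_form P \<le> 1" and h: "h1 \<in> P" "h2 \<in> P"
    and cap: "capset h1 A1" "capset h2 A2"
    and disj: "A1 \<inter> A2 = {}" "A1 \<inter> P = {}" "A2 \<inter> P = {}"
  shows False
proof -
  obtain x where x: "\<And>k. 0 \<le> x k" "\<And>k. k \<notin> A1 \<Longrightarrow> x k = 0" "bil x x \<le> 2" "cp h1 x \<le> -1"
    using capset_vector[OF cap(1)] h P by blast
  obtain y where y: "\<And>k. 0 \<le> y k" "\<And>k. k \<notin> A2 \<Longrightarrow> y k = 0" "bil y y \<le> 2" "cp h2 y \<le> -1"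
    using capset_vector[OF cap(2)] h P by blast
  have ind: "bil (ind P) z \<le> -1"
    if "h \<in> P" "cp h z \<le> -1" "\<And>k. 0 \<le> z k" "\<And>k. k \<in> P \<Longrightarrow> z k = 0" for h z
  proof -
    have "ind P = (\<lambda>k. unitv h k + ind (P - {h}) k)" using that(1) by (auto simp: ind_def unitv_def)
    then have "bil (ind P) z = cp h z + bil (ind (P - {h})) z" using that P by (simp add: bil_simps subset_iff)
    moreover have "bil (ind (P - {h})) z \<le> 0" using that by (intro bil_nonpos) (auto simp: ind_def)
    ultimately show ?thesis using that by simp
  qed
  let ?z = "\<lambda>k. 2 * ind P k + (x k + y k)"
  have x0: "x k = 0" and y0: "y k = 0" if "k \<in> P" for k
    using that disj x(2) y(2) by blast+
  have "bil (ind P) x \<le> -1" by (rule ind[OF h(1) x(4,1) x0])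
  moreover have "bil (ind P) y \<le> -1" by (rule ind[OF h(2) y(4,1) y0])
  moreover have "x k = 0 \<or> y k = 0" for k using disj(1) x(2) y(2) by blast
  then have "bil x y \<le> 0" by (rule bil_nonpos[OF x(1) y(1)])
  \<comment> \<open>The norm is at most 4 - 4 - 4 + 2 + 2 + 0 = 0.\<close>
  ultimately have "bil ?z ?z \<le> 0"
    using P(2) x(3) y(3) bil_sym[of x "ind P"] bil_sym[of y "ind P"] bil_sym[of y x]
    by (simp add: bil_simps size_form_def)
  moreover have "?z h1 \<noteq> 0" using x(1)[of h1] y(1)[of h1] h by (simp add: ind_def)
  ultimately show False using bil_pos[of h1 ?z] h P by auto
qed

end

section \<open>Chains and stars\<close>

context coxeter
begin

text \<open>An induced path starting at \<open>c\<close>. The non-edges are recorded as labels 2,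
  and since the diagonal entries are 1 they entail distinctness
  (\<open>chain_distinct\<close>).\<close>

primrec chain :: "nat \<Rightarrow> nat list \<Rightarrow> bool" where
  "chain c [] \<longleftrightarrow> True"
| "chain c (x # xs) \<longleftrightarrow> M c x = 3 \<and> (\<forall>y\<in>set xs. M c y = 2) \<and> chain x xs"

text \<open>The weights \<open>r, \<dots>, 2, 1\<close> along a chain make \<open>arm\<close> orthogonal to all its vertices but the first.\<close>

primrec arm :: "nat list \<Rightarrow> nat \<Rightarrow> real" where
  "arm [] = (\<lambda>k. 0)"
| "arm (x # xs) = (\<lambda>k. real (Suc (length xs)) * unitv x k + arm xs k)"

lemma M_self_neq: "i \<in> V \<Longrightarrow> M i i \<noteq> 2" "i \<in> V \<Longrightarrow> M i i \<noteq> 3"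
  by (simp_all add: one_enat_def numeral_eq_enat)

lemma chain_notin: "c \<in> V \<Longrightarrow> chain c xs \<Longrightarrow> c \<notin> set xs"
  using M_self_neq by (cases xs) auto

lemma chain_distinct: "set (c # xs) \<subseteq> V \<Longrightarrow> chain c xs \<Longrightarrow> distinct (c # xs)"
proof (induction xs arbitrary: c)
  case (Cons x xs)
  then show ?case using chain_notin[of c "x # xs"] by auto
qed simp

lemma chain_snoc:
  "chain c (xs @ [v]) \<longleftrightarrow> chain c xs \<and> M (last (c # xs)) v = 3 \<and> (\<forall>w\<in>set (butlast (c # xs)). M w v = 2)"
  by (induction xs arbitrary: c) auto

lemma chain_prefix: "chain c (xs @ ys) \<Longrightarrow> chain c xs"
  by (induction xs arbitrary: c) auto

lemma chain_suffix: "chain c (xs @ u # ys) \<Longrightarrow> chain u ys"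
  by (induction xs arbitrary: c) auto

lemma chain_nth:
  "chain c xs \<Longrightarrow> i < j \<Longrightarrow> j \<le> length xs \<Longrightarrow> M ((c # xs) ! i) ((c # xs) ! j) = (if j = Suc i then 3 else 2)"
proof (induction xs arbitrary: c i j)
  case (Cons x xs)
  obtain j' where j': "j = Suc j'" using Cons.prems by (cases j) auto
  show ?case
  proof (cases i)
    case 0
    then show ?thesis using Cons.prems j' by (cases j') auto
  next
    case (Suc i')
    then show ?thesis using Cons.IH[of x i' j'] Cons.prems j' by simp
  qed
qed simp

lemma b_zero: "i \<in> V \<Longrightarrow> M i j = 2 \<Longrightarrow> b i j = 0"
  using M_self_neq by (intro b_2) auto

lemma b_half: "i \<in> V \<Longrightarrow> M i j = 3 \<Longrightarrow> b i j = - (1 / 2)"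
  using M_self_neq by (intro b_3) auto

lemma size_form_chain: "set (c # xs) \<subseteq> V \<Longrightarrow> chain c xs \<Longrightarrow> size_form (set (c # xs)) = 1"
proof (induction xs arbitrary: c)
  case (Cons x xs)
  have "c \<notin> set (x # xs)" "x \<notin> set xs" using chain_distinct[OF Cons.prems] by auto
  moreover have "(\<Sum>j\<in>set xs. b c j) = 0" using Cons.prems by (intro sum.neutral) (auto simp: b_zero)
  moreover have "size_form (set (x # xs)) = 1" using Cons by simp
  ultimately have "size_form (insert c (set (x # xs))) = 1"
    using Cons.prems by (subst size_form_insert) (auto simp: b_half)
  then show ?case by simp
qed (simp add: size_form_singleton)

lemma arm_notin: "k \<notin> set xs \<Longrightarrow> arm xs k = 0"
  by (induction xs) auto

lemma cp_arm_zero: "set xs \<subseteq> V \<Longrightarrow> i \<in> V \<Longrightarrow> (\<And>y. y \<in> set xs \<Longrightarrow> M i y = 2) \<Longrightarrow> cp i (arm xs) = 0"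
  by (induction xs) (auto simp: bil_simps b_zero, simp add: cp_def)

lemma bil_arm_zero:
  "set xs \<subseteq> V \<Longrightarrow> set ys \<subseteq> V \<Longrightarrow> (\<And>x y. x \<in> set xs \<Longrightarrow> y \<in> set ys \<Longrightarrow> M x y = 2) \<Longrightarrow> bil (arm xs) (arm ys) = 0"
  by (induction xs) (auto simp: bil_simps cp_arm_zero, simp add: bil_def)

lemma cp_arm_chain: "set (c # xs) \<subseteq> V \<Longrightarrow> chain c xs \<Longrightarrow> cp c (arm xs) = - (real (length xs) / 2)"
proof (cases xs)
  case (Cons x ys)
  assume "set (c # xs) \<subseteq> V" "chain c xs"
  then show ?thesis using Cons by (simp add: bil_simps cp_arm_zero b_half)
qed (simp add: cp_def)

lemma bil_arm_chain:
  "set (c # xs) \<subseteq> V \<Longrightarrow> chain c xs \<Longrightarrow>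
   bil (arm (c # xs)) (arm (c # xs)) = real (length (c # xs)) * (real (length (c # xs)) + 1) / 2"
proof (induction xs arbitrary: c)
  case Nil
  then show ?case by (simp add: bil_simps)
next
  case (Cons x xs)
  define r a where "r = real (length (x # xs))" and "a = arm (x # xs)"
  have a: "bil a a = r * (r + 1) / 2" using Cons by (simp add: a_def r_def)
  have "cp c a = - (r / 2)" unfolding a_def r_def using Cons.prems by (intro cp_arm_chain)
  moreover have arm: "arm (c # x # xs) = (\<lambda>k. (r + 1) * unitv c k + a k)"
    by (simp add: r_def a_def add.commute)
  have "bil (arm (c # x # xs)) (arm (c # x # xs)) = (r + 1) * (r + 1) + 2 * (r + 1) * cp c a + bil a a"
    unfolding arm using Cons.prems by (simp add: bil_simps algebra_simps)
  ultimately have "bil (arm (c # x # xs)) (arm (c # x # xs)) = (r + 1) * (r + 1 + 1) / 2"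
    unfolding a by (simp add: field_simps)
  then show ?case by (simp add: r_def add.commute)
qed

text \<open>On a graph that is one chain, this makes \<open>arm (c # xs)\<close> a multiple of the
  fundamental weight at \<open>c\<close>, which \<open>chain_not_minus\<close> and
  \<open>star_D_not_minus\<close> build on.\<close>

lemma cp_arm_weight:
  "set (c # xs) \<subseteq> V \<Longrightarrow> chain c xs \<Longrightarrow>
   cp c (arm (c # xs)) = (real (length xs) + 2) / 2 \<and> (\<forall>u\<in>set xs. cp u (arm (c # xs)) = 0)"
proof (induction xs arbitrary: c)
  case Nil
  then show ?case by (simp add: bil_simps)
next
  case (Cons x xs)
  have IH: "cp x (arm (x # xs)) = (real (length xs) + 2) / 2" "\<forall>u\<in>set xs. cp u (arm (x # xs)) = 0"
    using Cons by auto
  have "M u c = (if u = x then 3 else 2)" if "u \<in> set (x # xs)" for u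
    using that Cons.prems M_sym[of u c] by auto
  then have b: "b u c = (if u = x then - (1 / 2) else 0)" if "u \<in> set (x # xs)" for u
    using that Cons.prems by (auto simp: b_half b_zero subset_iff)
  have a: "arm (c # x # xs) = (\<lambda>k. (real (length xs) + 2) * unitv c k + arm (x # xs) k)"
    by (simp add: add.commute)
  have "cp c (arm (x # xs)) = - (real (length (x # xs)) / 2)" using Cons.prems by (intro cp_arm_chain)
  moreover have "cp u (arm (c # x # xs)) = (real (length xs) + 2) * b u c + cp u (arm (x # xs))"
    if "u \<in> V" for u
    unfolding a using Cons.prems by (simp add: bil_simps del: arm.simps)
  ultimately show ?case using b IH Cons.prems chain_distinct[OF Cons.prems]
    by (auto simp: field_simps simp del: arm.simps)
qed

end

context finite_coxeter
begin

text \<open>The vector \<open>e\<^sub>c + \<Sum> (2 g / (r + 1)) a\<close> minimizes the form over the arms \<open>a\<close> of length \<open>r\<close>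
  attached to the center \<open>c\<close>, \<open>g\<close> being the cosine belonging to the attaching edge.\<close>

lemma star_inequality:
  assumes c: "c \<in> V" and "x c = 0" "y c = 0" "z c = 0"
    and cp: "cp c x = - (g * real p)" "cp c y = - (h * real q)" "cp c z = - (k * real r)"
    and bil: "bil x x = real p * (real p + 1) / 2" "bil y y = real q * (real q + 1) / 2" "bil z z = real r * (real r + 1) / 2"
    and zero: "bil x y = 0" "bil x z = 0" "bil y z = 0"
  shows "2 * g\<^sup>2 * p / (real p + 1) + 2 * h\<^sup>2 * q / (real q + 1) + 2 * k\<^sup>2 * r / (real r + 1) < 1"
proof -
  define s t u where "s = 2 * g / (real p + 1)" and "t = 2 * h / (real q + 1)" and "u = 2 * k / (real r + 1)"
  let ?v = "\<lambda>l. unitv c l + (s * x l + (t * y l + u * z l))"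
  have "bil ?v ?v = 1 + (2 * s * cp c x + s * s * bil x x) + (2 * t * cp c y + t * t * bil y y)
     + (2 * u * cp c z + u * u * bil z z)"
    using c zero bil_sym[of y x] bil_sym[of z x] bil_sym[of z y] by (simp add: bil_simps algebra_simps)
  \<comment> \<open>The contribution of one arm at the minimizing coefficient.\<close>
  moreover have *: "2 * (2 * g / (real p + 1)) * (- (g * real p)) +
      (2 * g / (real p + 1)) * (2 * g / (real p + 1)) * (real p * (real p + 1) / 2) = - (2 * g\<^sup>2 * p / (real p + 1))" for g p
    by (simp add: divide_simps power2_eq_square)
  ultimately have "bil ?v ?v = 1 - 2 * g\<^sup>2 * p / (real p + 1) - 2 * h\<^sup>2 * q / (real q + 1) - 2 * k\<^sup>2 * r / (real r + 1)"
    unfolding cp bil s_def t_def u_def * by simp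
  moreover have "?v c \<noteq> 0" using assms by simp
  ultimately show ?thesis using bil_pos[of c ?v] c by simp
qed

text \<open>The path from \<open>c\<close> to the attaching vertex \<open>u\<close> already has a
  cap at \<open>c\<close>. If \<open>v\<close> were attached before the end, \<open>v\<close> and
  the next vertex of the chain would be a fork at \<open>u\<close>; if its label were at least 4,
  \<open>{v}\<close> would be a cap. So \<open>v\<close> prolongs the chain by a simple
  edge.\<close>

lemma arm_grow:
  assumes V: "set (c # xs) \<subseteq> V" and chain: "chain c xs" and cap: "capset c X" "X \<inter> set (c # xs) = {}"
    and v: "v \<in> V" "v \<notin> set (c # xs)" "v \<notin> X" and u: "u \<in> set (c # xs)" "3 \<le> M v u"
    and others: "\<And>w. w \<in> set (c # xs) \<Longrightarrow> w \<noteq> u \<Longrightarrow> M v w = 2"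
  shows "chain c (xs @ [v])"
proof -
  obtain as bs where split: "c # xs = as @ u # bs" using u(1) by (metis split_list)
  have dist: "distinct (as @ u # bs)" using chain_distinct[OF V chain] split by simp
  have uV: "u \<in> V" using u V by blast
  have Muv: "M u v = M v u" using M_sym uV v by simp
  have "set (as @ [u]) \<subseteq> V" using V unfolding split by auto
  have hd: "c \<in> set (as @ [u])" using split by (cases as) auto
  have size: "size_form (set (as @ [u])) \<le> 1"
  proof (cases as)
    case Nil
    then show ?thesis using uV by (simp add: size_form_singleton)
  next
    case (Cons a as')
    then have "a = c" "xs = (as' @ [u]) @ bs" using split by auto
    then have "chain c (as' @ [u])" using chain chain_prefix by metis
    then show ?thesis using size_form_chain[of c "as' @ [u]"] \<open>set (as @ [u]) \<subseteq> V\<close> Cons \<open>a = c\<close> by simp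
  qed
  have contra: False if "capset u Y" "Y \<inter> set (as @ [u]) = {}" "X \<inter> Y = {}" for Y
  proof (rule capset_contradiction[OF \<open>set (as @ [u]) \<subseteq> V\<close> size hd _ cap(1) that(1,3) _ that(2)])
    show "X \<inter> set (as @ [u]) = {}" using cap(2) unfolding split by auto
  qed simp
  have v': "v \<notin> set (as @ u # bs)" using v(2) unfolding split .
  have X': "X \<inter> set (as @ u # bs) = {}" using cap(2) unfolding split .
  show ?thesis
  proof (cases bs)
    case Nil
    have "u \<noteq> v" using v' by auto
    from uV v(1) this show ?thesis
    proof (cases rule: M_cases)
      case 1
      then show ?thesis using u(2) Muv by simp
    next
      case 2
      have "last (c # xs) = u" "butlast (c # xs) = as" using split Nil by (simp_all del: last.simps butlast.simps)
      moreover have "M w v = 2" if "w \<in> set as" for w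
      proof -
        have "w \<in> set (c # xs)" "w \<noteq> u" using that dist unfolding split by auto
        then show ?thesis using others[of w] M_sym[of v w] V v(1) by auto
      qed
      ultimately show ?thesis using chain 2 by (simp add: chain_snoc del: last.simps butlast.simps)
    next
      case 3
      have "capset u {v}" using 3 v(1) by (auto simp: capset_def)
      then show ?thesis using contra[of "{v}"] v' v(3) by auto
    qed
  next
    case (Cons b' bs')
    have "M u b' = 3"
    proof (cases as)
      case Nil
      then show ?thesis using split Cons chain by auto
    next
      case (Cons a as')
      then have "xs = as' @ u # b' # bs'" using split \<open>bs = b' # bs'\<close> by auto
      then show ?thesis using chain chain_suffix by fastforce
    qed
    moreover have "b' \<in> V" using V unfolding split Cons by auto
    moreover have "b' \<noteq> v" using v' Cons by auto
    ultimately have "capset u {b', v}" using v(1) u(2) Muv unfolding capset_def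
      by (intro disjI1 exI[of _ b'] exI[of _ v]) auto
    moreover have "{b', v} \<inter> set (as @ [u]) = {}" using dist Cons v' by auto
    moreover have "X \<inter> {b', v} = {}" using X' Cons v(3) by auto
    ultimately show ?thesis using contra by blast
  qed
qed

text \<open>Seen from \<open>c\<close> the vertex \<open>d\<close> is a cap, and seen from
  \<open>d\<close> the vertex \<open>c\<close> is one. By \<open>arm_grow\<close> both sides of the
  heavy edge can therefore only grow as chains.\<close>

lemma double_chain:
  assumes cd: "c \<in> V" "d \<in> V" "4 \<le> M c d"
  obtains ys xs where "chain c ys" "chain d xs" "V = set (c # ys) \<union> set (d # xs)"
    "set (c # ys) \<inter> set (d # xs) = {}"
    "\<forall>y\<in>set (c # ys). \<forall>x\<in>set (d # xs). (y, x) \<noteq> (c, d) \<longrightarrow> M y x = 2"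
proof -
  have "c \<noteq> d" using adj_neq cd by blast
  have dc: "4 \<le> M d c" using cd M_sym by metis
  have three: "3 \<le> M d c" using dc by (rule order_trans[rotated]) simp
  have step1: "chain c (ys @ [v])" and step2: "M x v = 2"
    if "chain c ys" "set (c # ys) \<union> set (d # xs) \<subseteq> V" "set (c # ys) \<inter> set (d # xs) = {}" "c \<in> V" "d \<in> V" "4 \<le> M c d"
      "u \<in> set (c # ys)" "v \<in> V" "v \<notin> set (c # ys) \<union> set (d # xs)" "3 \<le> M v u"
      "\<And>w. w \<in> set (c # ys) \<union> set (d # xs) \<Longrightarrow> w \<noteq> u \<Longrightarrow> M v w = 2" "x \<in> set (d # xs)" for c d ys xs u v x
  proof -
    have "capset c {d}" using that by (auto simp: capset_def)
    then show "chain c (ys @ [v])" using that by (intro arm_grow[where X = "{d}" and u = u]) auto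
    have "x \<noteq> u" "x \<in> V" using that by auto
    have "x \<in> set (c # ys) \<union> set (d # xs)" using that(12) by blast
    from that(11)[OF this \<open>x \<noteq> u\<close>] show "M x v = 2" using M_sym[OF that(8) \<open>x \<in> V\<close>] by simp
  qed
  let ?P = "\<lambda>S. \<exists>ys xs. S = set (c # ys) \<union> set (d # xs) \<and> chain c ys \<and> chain d xs \<and>
    set (c # ys) \<inter> set (d # xs) = {} \<and>
    (\<forall>y\<in>set (c # ys). \<forall>x\<in>set (d # xs). (y, x) \<noteq> (c, d) \<longrightarrow> M y x = 2)"
  have "?P V"
  proof (rule grow[of "{c, d}"])
    show "{c, d} \<subseteq> V" "{c, d} \<noteq> {}" using cd by auto
    show "size_form {c, d} \<le> 1"
      using grow_step(1)[of "{c}" c d] cd three \<open>c \<noteq> d\<close> size_form_singleton[of c] by (simp add: insert_commute)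
    show "?P {c, d}" using \<open>c \<noteq> d\<close> by (intro exI[of _ "[]"]) auto
    fix S u v assume "?P S" and S: "S \<subseteq> V" and u: "u \<in> S" and v: "v \<in> V" "v \<notin> S" "3 \<le> M v u"
      and others: "\<And>w. w \<in> S \<Longrightarrow> w \<noteq> u \<Longrightarrow> M v w = 2"
    then obtain ys xs where yx: "S = set (c # ys) \<union> set (d # xs)" "chain c ys" "chain d xs"
      "set (c # ys) \<inter> set (d # xs) = {}"
      and cross: "\<And>y x. y \<in> set (c # ys) \<Longrightarrow> x \<in> set (d # xs) \<Longrightarrow> (y, x) \<noteq> (c, d) \<Longrightarrow> M y x = 2" by blast
    have S': "set (d # xs) \<union> set (c # ys) = S" using yx by blast
    show "?P (insert v S)"
    proof (cases "u \<in> set (c # ys)")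
      case True
      note st = step1[of c ys d xs u v d] step2[of c ys d xs u v]
      have 1: "chain c (ys @ [v])" "\<And>x. x \<in> set (d # xs) \<Longrightarrow> M x v = 2"
        using st yx(2,4) cd S v others True unfolding yx(1) by auto
      then have 2: "M v x = 2" if "x \<in> set (d # xs)" for x
        using that M_sym[of v x] v(1) S yx(1) by auto
      show ?thesis
        by (rule exI[of _ "ys @ [v]"], rule exI[of _ xs]) (use yx 1 2 cross v in auto)
    next
      case False
      then have uD: "u \<in> set (d # xs)" using u yx by blast
      note st = step1[of d xs c ys u v c] step2[of d xs c ys u v]
      have 1: "chain d (xs @ [v])" "\<And>y. y \<in> set (c # ys) \<Longrightarrow> M y v = 2"
        using st yx(3,4) cd dc S v others uD unfolding S'[symmetric] by (auto simp: Int_commute)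
      show ?thesis
        by (rule exI[of _ ys], rule exI[of _ "xs @ [v]"]) (use yx 1 cross v in auto)
    qed
  qed
  then show ?thesis using that by blast
qed

section \<open>Trees with one branch vertex\<close>

definition star :: "nat set \<Rightarrow> nat \<Rightarrow> nat list \<Rightarrow> nat list \<Rightarrow> nat list \<Rightarrow> bool" where
  "star S c xs ys zs \<longleftrightarrow> S = {c} \<union> set xs \<union> set ys \<union> set zs \<and> xs \<noteq> [] \<and> ys \<noteq> [] \<and> zs \<noteq> [] \<and>
     chain c xs \<and> chain c ys \<and> chain c zs \<and> (\<forall>x\<in>set xs. \<forall>y\<in>set ys. M x y = 2) \<and>
     (\<forall>x\<in>set xs. \<forall>z\<in>set zs. M x z = 2) \<and> (\<forall>y\<in>set ys. \<forall>z\<in>set zs. M y z = 2)"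

lemma star_swap:
  assumes "star S c xs ys zs" "S \<subseteq> V"
  shows "star S c ys xs zs" "star S c xs zs ys"
proof -
  have "M a b = 2" if "M b a = 2" "a \<in> S" "b \<in> S" for a b using that M_sym assms(2) by (metis subsetD)
  then show "star S c ys xs zs" "star S c xs zs ys" using assms(1) by (auto simp: star_def)
qed

text \<open>The first vertices of the other two arms form a cap at \<open>c\<close>, so
  \<open>arm_grow\<close> applies.\<close>

lemma star_grow_arm:
  assumes star: "star S c xs ys zs" and S: "S \<subseteq> V" and u: "u \<in> set xs" and v: "v \<in> V" "v \<notin> S" "3 \<le> M v u"
    and others: "\<And>w. w \<in> S \<Longrightarrow> w \<noteq> u \<Longrightarrow> M v w = 2"
  shows "star (insert v S) c (xs @ [v]) ys zs"
proof -
  obtain y ys' z zs' where yz: "ys = y # ys'" "zs = z # zs'" using star by (auto simp: star_def neq_Nil_conv)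
  have S_eq: "S = {c} \<union> set xs \<union> set ys \<union> set zs" using star by (simp add: star_def)
  have y: "y \<in> V" "M c y = 3" and z: "z \<in> V" "M c z = 3" and c: "c \<in> V" and xV: "set xs \<subseteq> V"
    using star S yz by (auto simp: star_def)
  have "M y z = 2" using star yz by (auto simp: star_def)
  then have "y \<noteq> z" using M_self_neq y by metis
  then have "capset c {y, z}" using y z unfolding capset_def
    by (intro disjI1 exI[of _ y] exI[of _ z]) auto
  moreover have "y \<notin> set xs" "z \<notin> set xs" using star yz y z M_self_neq by (fastforce simp: star_def)+
  moreover have "y \<noteq> c" "z \<noteq> c" using y z c M_self_neq by auto
  moreover have "v \<noteq> y" "v \<noteq> z" "v \<notin> set (c # xs)" using v S_eq yz by auto
  ultimately have "chain c (xs @ [v])"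
    using star xV c u v others S_eq by (intro arm_grow[where X = "{y, z}" and u = u]) (auto simp: star_def)
  moreover have "M v w = 2" if "w \<in> set ys \<union> set zs" for w
  proof -
    have "w \<in> V" "M u w = 2" using that star S u by (auto simp: star_def)
    then have "w \<noteq> u" using M_self_neq by metis
    then show ?thesis using others that S_eq by blast
  qed
  ultimately show ?thesis using star by (auto simp: star_def)
qed

lemma star_cover:
  assumes c: "c \<in> V" and xyz: "x \<in> V" "y \<in> V" "z \<in> V" "x \<noteq> y" "x \<noteq> z" "y \<noteq> z"
    and adj: "M c x = 3" "M c y = 3" "M c z = 3"
  obtains xs ys zs where "star V c xs ys zs"
proof -
  have neq: "x \<noteq> c" "y \<noteq> c" "z \<noteq> c" using adj c M_self_neq by auto
  have adj': "M x c = 3" "M y c = 3" "M z c = 3" using adj M_sym c xyz by auto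
  have s1: "size_form {x, c} \<le> 1"
    using grow_step(1)[of "{c}" c x] c xyz neq adj' size_form_singleton[of c] by simp
  note g2 = grow_step[of "{x, c}" c y] 
  have s2: "size_form {y, x, c} \<le> 1" "M y x = 2"
    using g2 s1 c xyz neq adj' by auto
  note g3 = grow_step[of "{y, x, c}" c z] 
  have s3: "size_form {z, y, x, c} \<le> 1" "M z x = 2" "M z y = 2"
    using g3 s2 c xyz neq adj' by auto
  let ?P = "\<lambda>S. \<exists>xs ys zs. star S c xs ys zs"
  have "?P V"
  proof (rule grow[of "{z, y, x, c}" ?P])
    have "star {z, y, x, c} c [x] [y] [z]"
      using s2 s3 adj M_sym[of x y] M_sym[of x z] M_sym[of y z] xyz by (auto simp: star_def)
    then show "?P {z, y, x, c}" by blast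
    fix S u v assume "?P S" and S: "S \<subseteq> V" and u: "u \<in> S" and v: "v \<in> V" "v \<notin> S" "3 \<le> M v u"
      and others: "\<And>w. w \<in> S \<Longrightarrow> w \<noteq> u \<Longrightarrow> M v w = 2"
    then obtain xs ys zs where star: "star S c xs ys zs" by blast
    consider "u = c" | "u \<in> set xs" | "u \<in> set ys" | "u \<in> set zs" using u star by (auto simp: star_def)
    then show "?P (insert v S)"
    proof cases
      case 1
      obtain x' xs' y' ys' z' zs' where *: "xs = x' # xs'" "ys = y' # ys'" "zs = z' # zs'"
        using star by (auto simp: star_def neq_Nil_conv)
      have m: "M c x' = 3" "M c y' = 3" "M c z' = 3" "M x' y' = 2" "M x' z' = 2" "M y' z' = 2"
        using star * by (auto simp: star_def)
      have inV: "x' \<in> V" "y' \<in> V" "z' \<in> V" "x' \<in> S" "y' \<in> S" "z' \<in> S" "c \<in> S"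
        using star * S by (auto simp: star_def)
      have d: "x' \<noteq> y'" "x' \<noteq> z'" "y' \<noteq> z'" "x' \<noteq> c" "y' \<noteq> c" "z' \<noteq> c"
        using m inV c M_self_neq by auto
      have "3 \<le> M c v" using v 1 M_sym c by metis
      have dv: "v \<noteq> x'" "v \<noteq> y'" "v \<noteq> z'" "v \<noteq> c" using v inV by auto
      have "capset c {x', y'}" unfolding capset_def
        by (intro disjI1 exI[of _ x'] exI[of _ y']) (use m inV d in auto)
      moreover have "capset c {z', v}" unfolding capset_def
        by (intro disjI1 exI[of _ z'] exI[of _ v]) (use m inV d dv v \<open>3 \<le> M c v\<close> in auto)
      \<comment> \<open>A fourth neighbour of \<open>c\<close> is impossible: the path consisting of
        \<open>c\<close> alone would carry two disjoint forks, as in the affine diagram of type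
        D_4.\<close>
      ultimately have False
        using capset_contradiction[of "{c}" c c "{x', y'}" "{z', v}"] c d dv size_form_singleton[of c] by auto
      then show ?thesis ..
    next
      case 2
      then show ?thesis using star_grow_arm[OF star S _ v others] by blast
    next
      case 3
      then show ?thesis using star_grow_arm[OF star_swap(1)[OF star S] S _ v others] by blast
    next
      case 4
      have "star S c zs xs ys" using star_swap[OF star S] star_swap(1)[OF _ S] by blast
      then show ?thesis using star_grow_arm[OF _ S _ v others] 4 by blast
    qed
  qed (use c xyz s3 in auto)
  then show ?thesis using that by blast
qed

section \<open>Trees without branch vertex\<close>

lemma chain_cover:
  assumes laced: "\<forall>i\<in>V. \<forall>j\<in>V. M i j \<le> 3"
    and unbranched: "\<nexists>c x y z. {c, x, y, z} \<subseteq> V \<and> x \<noteq> y \<and> x \<noteq> z \<and> y \<noteq> z \<and>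
      M c x = 3 \<and> M c y = 3 \<and> M c z = 3"
  obtains c xs where "chain c xs" "V = set (c # xs)"
proof -
  let ?P = "\<lambda>S. \<exists>c xs. chain c xs \<and> S = set (c # xs)"
  have "?P V"
  proof (rule grow[of "{1}" ?P])
    show "?P {1}" by (intro exI[of _ "1"] exI[of _ "[]"]) simp
    fix S u v assume "?P S" and S: "S \<subseteq> V" and u: "u \<in> S" and v: "v \<in> V" "v \<notin> S" "3 \<le> M v u"
      and others: "\<And>w. w \<in> S \<Longrightarrow> w \<noteq> u \<Longrightarrow> M v w = 2"
    then obtain c xs where cx: "chain c xs" "S = set (c # xs)" by blast
    have uV: "u \<in> V" using u S by blast
    have Mvu: "M v u = 3" "M u v = 3" using v laced uV M_sym[of u v] by (auto intro: antisym)
    obtain as bs where split: "c # xs = as @ u # bs" using u cx(2) by (metis split_list)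
    have dist: "distinct (as @ u # bs)" using chain_distinct[of c xs] S cx split by simp
    show "?P (insert v S)"
    proof (cases "bs = []")
      case True
      then have *: "last (c # xs) = u" "butlast (c # xs) = as" using split by (simp_all del: last.simps butlast.simps)
      have "M w v = 2" if "w \<in> set as" for w
      proof -
        have "w \<in> S" "w \<noteq> u" using that dist unfolding cx(2) split by auto
        then show ?thesis using others[of w] M_sym[of v w] S v(1) by auto
      qed
      then have "chain c (xs @ [v])" using cx(1) Mvu * by (simp add: chain_snoc del: last.simps butlast.simps)
      moreover have "insert v S = set (c # xs @ [v])" unfolding cx(2) by auto
      ultimately show ?thesis by blast
    next
      case False
      then obtain b' bs' where b': "bs = b' # bs'" by (cases bs) auto
      \<comment> \<open>The attaching vertex \<open>u\<close> is not the last one. If it is the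
        first, \<open>v\<close> becomes the new start of the chain; otherwise \<open>u\<close>
        branches to \<open>a\<close>, \<open>b'\<close> and \<open>v\<close>.\<close>
      show ?thesis
      proof (cases as rule: rev_cases)
        case Nil
        then have "u = c" using split by simp
        then have "chain v (c # xs)" using Mvu cx others chain_notin[of c xs] S by auto
        then show ?thesis using cx(2) by (metis list.simps(15))
      next
        case (snoc as' a)
        have "M u b' = 3 \<and> M a u = 3"
        proof (cases as')
          case Nil
          then show ?thesis using split cx(1) snoc b' by auto
        next
          case (Cons a' as'')
          then have "xs = (as'' @ [a]) @ u # b' # bs'" "xs = as'' @ a # u # b' # bs'" using split snoc b' by auto
          then show ?thesis using chain_suffix[of c] cx(1) by (metis chain.simps(2))
        qed
        moreover have "a \<in> S" "b' \<in> S" unfolding cx(2) split snoc b' by auto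
        moreover have "a \<noteq> b'" using dist snoc b' by auto
        moreover have "M u a = 3" using calculation M_sym[of a u] S uV by auto
        moreover have "a \<noteq> v" "b' \<noteq> v" using calculation v by auto
        moreover have "{u, a, b', v} \<subseteq> V" using calculation S uV v by auto
        ultimately have False using unbranched Mvu by blast
        then show ?thesis ..
      qed
    qed
  qed (use one_in_V in \<open>auto simp: size_form_singleton\<close>)
  then show ?thesis using that by blast
qed

end

section \<open>Identification of the graphs\<close>

context coxeter
begin

text \<open>Lets an isomorphism be given by listing the vertices in the order of the standard
  numbering.\<close>

lemma coxeter_graph_iso_listI:
  assumes vs: "distinct vs" "set vs = V" "length vs = m"
    and M': "\<And>i j. i < j \<Longrightarrow> j < m \<Longrightarrow> M (vs ! i) (vs ! j) = M' (Suc i) (Suc j)"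
    and refl: "\<And>i. M' i i = 1" and sym: "\<And>i j. M' i j = M' j i"
  shows "coxeter_graph_iso n M m M'"
proof -
  define g where "g i = vs ! (i - 1)" for i
  have M: "M (vs ! i) (vs ! j) = M' (Suc i) (Suc j)" if "i < m" "j < m" for i j
  proof -
    have V: "vs ! i \<in> V" "vs ! j \<in> V" using vs that by (metis nth_mem)+
    consider "i = j" | "i < j" | "j < i" by linarith
    then show ?thesis
    proof cases
      case 1
      then show ?thesis using V refl by simp
    next
      case 2
      then show ?thesis using M' that by simp
    next
      case 3
      then have "M (vs ! j) (vs ! i) = M' (Suc j) (Suc i)" using M' that by simp
      then show ?thesis using M_sym[OF V] sym[of "Suc i" "Suc j"] by simp
    qed
  qed
  have "bij_betw (\<lambda>i. vs ! i) {..<m} V" using bij_betw_nth[OF vs(1), of "{..<m}" V] vs by simp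
  moreover have "bij_betw (\<lambda>i. i - 1) {1..m} {..<m}"
    by (rule bij_betw_byWitness[where f' = Suc]) auto
  ultimately have g: "bij_betw g {1..m} V"
    using bij_betw_trans[of "\<lambda>i. i - 1" "{1..m}" "{..<m}" "\<lambda>i. vs ! i" V] by (simp add: comp_def g_def[abs_def])
  let ?f = "inv_into {1..m} g"
  have "M' (?f i) (?f j) = M i j" if "i \<in> V" "j \<in> V" for i j
  proof -
    have "?f k \<in> {1..m}" "g (?f k) = k" if "k \<in> V" for k
    proof -
      have "k \<in> g ` {1..m}" using g that by (simp add: bij_betw_def)
      then show "?f k \<in> {1..m}" "g (?f k) = k" by (rule inv_into_into, rule f_inv_into_f)
    qed
    note a = this[OF that(1)] this[OF that(2)]
    have "M (g k) (g l) = M' k l" if "k \<in> {1..m}" "l \<in> {1..m}" for k l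
    proof -
      have "k - 1 < m" "l - 1 < m" "Suc (k - 1) = k" "Suc (l - 1) = l" using that by auto
      then show ?thesis using M[of "k - 1" "l - 1"] by (simp add: g_def)
    qed
    from this[OF a(1,3)] show ?thesis using a by simp
  qed
  then show ?thesis unfolding coxeter_graph_iso_def using bij_betw_inv_into[OF g] by blast
qed

lemma set_length: "distinct vs \<Longrightarrow> set vs = V \<Longrightarrow> length vs = n"
  using distinct_card[of vs] by simp

text \<open>In \<open>cox_B\<close> the label 4 sits at the last two vertices, whereas the chain
  starts at the heavy edge; hence the reversed list.\<close>

lemma iso_B:
  assumes cV: "c \<in> V" and chain: "chain d xs" and cover: "V = set (c # d # xs)" and c: "c \<notin> set (d # xs)"
    and M: "M c d = 4" "\<And>x. x \<in> set xs \<Longrightarrow> M c x = 2"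
  shows "coxeter_graph_iso n M n (cox_B n)"
proof (rule coxeter_graph_iso_listI[of "rev (c # d # xs)"])
  let ?ws = "c # d # xs"
  have dist: "distinct ?ws" using chain_distinct[of d xs] chain cover c by auto
  then show "distinct (rev ?ws)" "set (rev ?ws) = V" using cover by (simp_all del: rev.simps)
  have len: "length ?ws = n" using set_length dist cover by metis
  then show "length (rev ?ws) = n" by simp
  fix i j assume ij: "i < j" "j < n"
  define i' j' where "i' = n - 1 - i" and "j' = n - 1 - j"
  have ij': "j' < i'" "i' < n" using ij by (auto simp: i'_def j'_def)
  have rev: "rev ?ws ! i = ?ws ! i'" "rev ?ws ! j = ?ws ! j'"
    using ij len rev_nth[of i ?ws] rev_nth[of j ?ws] unfolding i'_def j'_def
    by (metis diff_diff_left plus_1_eq_Suc order.strict_trans)+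
  have "?ws ! i' \<in> V" "?ws ! j' \<in> V" using ij' len cover by (metis nth_mem order.strict_trans)+
  then have "M (rev ?ws ! i) (rev ?ws ! j) = M (?ws ! j') (?ws ! i')" unfolding rev using M_sym by blast
  also have "\<dots> = (if i' = Suc j' then if j' = 0 then 4 else 3 else 2)"
  proof (cases j')
    case 0
    then obtain k where k: "i' = Suc k" using ij' by (cases i') auto
    show ?thesis using M 0 ij' len k by (cases k) auto
  next
    case (Suc k)
    then obtain l where "i' = Suc l" using ij' by (cases i') auto
    then show ?thesis using chain_nth[OF chain, of k l] Suc ij' len by simp
  qed
  also have "\<dots> = cox_B n (Suc i) (Suc j)"
    using ij by (auto simp: cox_B_def i'_def j'_def doubleton_eq_iff)
  finally show "M (rev ?ws ! i) (rev ?ws ! j) = cox_B n (Suc i) (Suc j)" .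
qed (auto simp: cox_B_def insert_commute)

lemma iso_A1: "n = 1 \<Longrightarrow> coxeter_graph_iso n M 1 cox_A"
  by (rule coxeter_graph_iso_listI[of "[1]"]) (auto simp: cox_A_def)

lemma iso_I2:
  assumes "V = {i, j}" "i \<noteq> j" "M i j = enat p" shows "coxeter_graph_iso n M 2 (cox_I2 p)"
proof (rule coxeter_graph_iso_listI[of "[i, j]"])
  fix k l :: nat assume "k < l" "l < 2"
  then have "k = 0" "l = 1" by auto
  then show "M ([i, j] ! k) ([i, j] ! l) = cox_I2 p (Suc k) (Suc l)" using assms by (simp add: cox_I2_def One_nat_def)
qed (use assms in \<open>auto simp: cox_I2_def\<close>)

lemma iso_H3:
  assumes "V = {c, d, x}" "distinct [c, d, x]" "M c d = 5" "M d x = 3" "M c x = 2"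
  shows "coxeter_graph_iso n M 3 cox_H"
proof (rule coxeter_graph_iso_listI[of "[c, d, x]"])
  fix k l :: nat assume "k < l" "l < 3"
  then have "k = 0 \<and> l = 1 \<or> k = 0 \<and> l = 2 \<or> k = 1 \<and> l = 2" by auto
  then show "M ([c, d, x] ! k) ([c, d, x] ! l) = cox_H (Suc k) (Suc l)"
    using assms(3-5) by (elim disjE conjE) (simp_all add: cox_H_def doubleton_eq_iff nth_Cons' flip: One_nat_def)
qed (use assms in \<open>auto simp: cox_H_def insert_commute\<close>)

lemma iso_F4:
  assumes "V = {y, c, d, x}" "distinct [y, c, d, x]" "M c d = 4" "M y c = 3" "M d x = 3" "M c x = 2" "M y d = 2" "M y x = 2"
  shows "coxeter_graph_iso n M 4 cox_F4"
proof (rule coxeter_graph_iso_listI[of "[y, c, d, x]"])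
  fix k l :: nat assume "k < l" "l < 4"
  then have "k = 0 \<and> l = 1 \<or> k = 0 \<and> l = 2 \<or> k = 0 \<and> l = 3 \<or> k = 1 \<and> l = 2 \<or> k = 1 \<and> l = 3 \<or> k = 2 \<and> l = 3" by auto
  then show "M ([y, c, d, x] ! k) ([y, c, d, x] ! l) = cox_F4 (Suc k) (Suc l)"
    using assms(3-8) by (elim disjE conjE) (simp_all add: cox_F4_def doubleton_eq_iff nth_Cons' flip: One_nat_def)
qed (use assms in \<open>auto simp: cox_F4_def insert_commute\<close>)

text \<open>The order of the list is the Bourbaki numbering: the branch vertex is 4, the arm of
  length one is 2, that of length two is 3, 1, and that of length three is 5, 6, 7.\<close>

lemma iso_E7:
  assumes V: "V = {z2, y, z1, c, x1, x2, x3}" "distinct [z2, y, z1, c, x1, x2, x3]"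
    and chains: "chain c [y]" "chain c [z1, z2]" "chain c [x1, x2, x3]"
    and cross: "\<And>z. z \<in> {z1, z2} \<Longrightarrow> M y z = 2" "\<And>x. x \<in> {x1, x2, x3} \<Longrightarrow> M y x = 2"
      "\<And>z x. z \<in> {z1, z2} \<Longrightarrow> x \<in> {x1, x2, x3} \<Longrightarrow> M z x = 2"
  shows "coxeter_graph_iso n M 7 cox_E"
proof (rule coxeter_graph_iso_listI[of "[z2, y, z1, c, x1, x2, x3]"])
  have inV: "z2 \<in> V" "y \<in> V" "z1 \<in> V" "c \<in> V" unfolding V by auto
  have s: "M y c = 3" "M z1 c = 3" "M z2 c = 2" "M z2 z1 = 3" "M z2 y = 2" "M z1 y = 2"
    using chains cross(1) M_sym[OF inV(4,2)] M_sym[OF inV(4,3)] M_sym[OF inV(4,1)] M_sym[OF inV(3,1)]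
      M_sym[OF inV(2,1)] M_sym[OF inV(2,3)] by auto
  fix k l :: nat assume kl: "k < l" "l < 7"
  have "l = 1 \<or> l = 2 \<or> l = 3 \<or> l = 4 \<or> l = 5 \<or> l = 6" "k = 0 \<or> k = 1 \<or> k = 2 \<or> k = 3 \<or> k = 4 \<or> k = 5"
    using kl by auto
  then show "M ([z2, y, z1, c, x1, x2, x3] ! k) ([z2, y, z1, c, x1, x2, x3] ! l) = cox_E (Suc k) (Suc l)"
    using kl chains cross s
    by (elim disjE) (simp_all add: cox_E_def doubleton_eq_iff nth_Cons' flip: One_nat_def)
qed (use V in \<open>auto simp: cox_E_def insert_commute\<close>)

end

section \<open>The graphs admitting a proper up-to-center epimorphism\<close>

context finite_coxeter
begin

text \<open>Dividing the arm by n + 1 gives the fundamental weight at \<open>c\<close>. Twice its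
  coordinate there is 2 - 2 / (n + 1), which is not an integer for n at least 2.\<close>

lemma chain_not_minus:
  assumes "2 \<le> n" and laced: "\<forall>i\<in>V. \<forall>j\<in>V. M i j \<le> 3"
    and cover: "chain c xs" "V = set (c # xs)" and minus: "minus_word n M ws"
  shows False
proof -
  have sub: "set (c # xs) \<subseteq> V" using cover by simp
  have len: "length (c # xs) = n" by (rule set_length) (use chain_distinct[OF sub cover(1)] cover in auto)
  let ?w = "\<lambda>k. (1 / (real n + 1)) * arm (c # xs) k"
  have w: "cp c (arm (c # xs)) = (real n + 1) / 2" "\<And>u. u \<in> set xs \<Longrightarrow> cp u (arm (c # xs)) = 0"
    using cp_arm_weight[OF sub cover(1)] len by auto
  have "2 * cp i ?w \<in> \<int>" if "i \<in> V" for i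
  proof (cases "i = c")
    case True
    then have "2 * cp i ?w = 1" unfolding cp_scale True w by (simp add: field_simps)
    then show ?thesis by simp
  next
    case False
    then have "cp i (arm (c # xs)) = 0" using that w(2) unfolding cover(2) by simp
    then have "cp i ?w = 0" unfolding cp_scale by (simp del: arm.simps)
    then show ?thesis by (simp only: mult_zero_right Ints_0)
  qed
  then have "\<forall>i\<in>V. 2 * cp i ?w \<in> \<int>" ..
  moreover have "c \<in> V" using sub by simp
  ultimately have "2 * ?w c \<in> \<int>" by (rule minus_word_weight[where x = ?w, OF laced _ minus])
  moreover have "arm (c # xs) c = real n" using chain_notin[of c xs] sub cover(1) len by (auto simp: arm_notin)
  ultimately have "2 * real n / (real n + 1) \<in> \<int>" by (simp only: mult.commute) (simp add: mult.commute)
  moreover have "2 * real n / (real n + 1) = 2 - 2 / (real n + 1)" by (simp add: field_simps)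
  ultimately have "2 - (2 - 2 / (real n + 1)) \<in> \<int>" by (metis Ints_diff Ints_numeral)
  then obtain k where k: "2 / (real n + 1) = of_int k" by (auto elim: Ints_cases)
  have "0 < 2 / (real n + 1)" "2 / (real n + 1) < 1" using assms(1) by auto
  then show False unfolding k by simp
qed

text \<open>The vector below is the half-spin weight; twice its coordinate at \<open>z\<close> is \<open>n / 2\<close>.\<close>

lemma star_D_not_minus:
  assumes "odd n" and laced: "\<forall>i\<in>V. \<forall>j\<in>V. M i j \<le> 3"
    and star: "star V c [y] [z] zs" and minus: "minus_word n M ws"
  shows False
proof -
  have sub: "set (c # zs) \<subseteq> V" and chain: "chain c zs" and inV: "c \<in> V" "y \<in> V" "z \<in> V"
    and V: "V = {c, y, z} \<union> set zs"
    and m: "M c y = 3" "M c z = 3" "M y z = 2" "\<And>u. u \<in> set zs \<Longrightarrow> M y u = 2" "\<And>u. u \<in> set zs \<Longrightarrow> M z u = 2"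
    using star by (auto simp: star_def)
  have m': "M y c = 3" "M z c = 3" "M z y = 2" using m M_sym[OF inV(1,2)] M_sym[OF inV(1,3)] M_sym[OF inV(2,3)] by auto
  have m'': "M u y = 2" "M u z = 2" if "u \<in> set zs" for u
    using m that M_sym[of u y] M_sym[of u z] inV sub by auto
  have ne: "y \<noteq> z" "y \<noteq> c" "z \<noteq> c" "y \<notin> set zs" "z \<notin> set zs"
    using m(1-3) m(4)[of y] m(5)[of z] M_self_neq inV by auto
  have dist: "distinct (y # z # c # zs)" using ne chain_distinct[OF sub chain] by auto
  define r where "r = real (length zs)"
  have "length (y # z # c # zs) = n" by (rule set_length[OF dist]) (use V in auto)
  then have n: "n = length zs + 3" by simp
  let ?a = "arm (c # zs)"
  have w: "cp c ?a = (r + 2) / 2" "\<And>u. u \<in> set zs \<Longrightarrow> cp u ?a = 0"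
    using cp_arm_weight[OF sub chain] by (auto simp: r_def)
  have wy: "cp v ?a = - ((r + 1) / 2)" if "v \<in> V" "M v c = 3" "\<And>u. u \<in> set zs \<Longrightarrow> M v u = 2" for v
  proof -
    have "cp v (arm zs) = 0" using that sub by (intro cp_arm_zero) auto
    then show ?thesis using that inV by (simp add: bil_simps b_half r_def)
  qed
  \<comment> \<open>With r = n - 3 the last two coefficients are (n - 2) / 4 and n / 4, those of the
    half-spin weight of D_n at its two short arms. The weights 1, 2, ... along the long arm are
    halved.\<close>
  let ?w = "\<lambda>k. (1 / 2) * ?a k + ((r + 1) / 4 * unitv y k + (r + 3) / 4 * unitv z k)"
  have cp: "cp i ?w = cp i ?a / 2 + (r + 1) / 4 * b i y + (r + 3) / 4 * b i z" for i
    unfolding cp_add cp_scale using inV by (simp add: cp_unitv del: arm.simps)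
  have "2 * cp i ?w \<in> \<int>" if i: "i \<in> V" for i
  proof -
    consider "i = c" | "i = y" | "i = z" | "i \<in> set zs" using i V by blast
    then show ?thesis
    proof cases
      case 1
      then have "cp i ?w = 0" unfolding cp using w m inV by (simp add: b_half field_simps del: arm.simps)
      then show ?thesis by simp
    next
      case 2
      then have "cp i ?w = 0" unfolding cp using wy[of y] m m' inV by (simp add: b_zero field_simps del: arm.simps)
      then show ?thesis by simp
    next
      case 3
      then have "2 * cp i ?w = 1" unfolding cp using wy[of z] m m' inV by (simp add: b_zero field_simps del: arm.simps)
      then show ?thesis by simp
    next
      case 4
      then have "cp i ?w = 0" unfolding cp using w(2) m'' i by (simp add: b_zero del: arm.simps)
      then show ?thesis by simp
    qed
  qed
  then have "\<forall>i\<in>V. 2 * cp i ?w \<in> \<int>" ..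
  then have "2 * ?w z \<in> \<int>" by (rule minus_word_weight[where x = ?w, OF laced _ minus inV(3)])
  moreover have "?a z = 0" using ne by (intro arm_notin) auto
  then have "2 * ?w z = (r + 3) / 2" using ne by (simp add: field_simps del: arm.simps)
  ultimately have "(r + 3) / 2 \<in> \<int>" by (simp only:)
  then obtain k where "(r + 3) / 2 = of_int k" by (auto elim: Ints_cases)
  then have "real n = of_int (2 * k)" by (simp add: n r_def)
  then have "int n = 2 * k" by linarith
  then show False using assms(1) by presburger
qed

text \<open>Positivity becomes 1 < 1 / (p + 1) + 1 / (q + 1) + 1 / (r + 1) for the sorted arm
  lengths. Type D has p = q = 1 and is excluded by its weight. What remains is p = 1, q = 2 with r
  between 2 and 4, and the odd rank r + 4 selects r = 3.\<close>

lemma star_minus_E7: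
  assumes "odd n" and laced: "\<forall>i\<in>V. \<forall>j\<in>V. M i j \<le> 3"
    and star: "star V c xs ys zs" and minus: "minus_word n M ws"
  shows "coxeter_graph_iso n M 7 cox_E"
proof -
  have "\<exists>xs ys zs. star V c xs ys zs \<and> length xs \<le> length ys \<and> length ys \<le> length zs"
    using star star_swap[OF _ order_refl] by (metis linorder_linear)
  then obtain xs ys zs where star: "star V c xs ys zs" and le: "length xs \<le> length ys" "length ys \<le> length zs" by blast
  obtain x xs' where xs: "xs = x # xs'" using star by (auto simp: star_def neq_Nil_conv)
  obtain y ys' where ys: "ys = y # ys'" using star by (auto simp: star_def neq_Nil_conv)
  obtain z zs' where zs: "zs = z # zs'" using star by (auto simp: star_def neq_Nil_conv)
  have V: "V = {c} \<union> set xs \<union> set ys \<union> set zs" and c: "c \<in> V"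
    and sub: "set xs \<subseteq> V" "set ys \<subseteq> V" "set zs \<subseteq> V"
    and chains: "chain c xs" "chain c ys" "chain c zs"
    and cross: "\<And>x y. x \<in> set xs \<Longrightarrow> y \<in> set ys \<Longrightarrow> M x y = 2" "\<And>x z. x \<in> set xs \<Longrightarrow> z \<in> set zs \<Longrightarrow> M x z = 2"
     "\<And>y z. y \<in> set ys \<Longrightarrow> z \<in> set zs \<Longrightarrow> M y z = 2"
    using star by (auto simp: star_def)
  have cnot: "c \<notin> set xs" "c \<notin> set ys" "c \<notin> set zs" using chain_notin c chains by auto
  have "distinct xs" "distinct ys" "distinct zs"
    using chain_distinct[of c] chains c sub by auto
  moreover have "set xs \<inter> set ys = {}" "set xs \<inter> set zs = {}" "set ys \<inter> set zs = {}"
    using cross sub M_self_neq by blast+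
  ultimately have dist: "distinct (c # xs @ ys @ zs)" using cnot by auto
  have "length (c # xs @ ys @ zs) = n" by (rule set_length[OF dist]) (use V in auto)
  then have n: "n = Suc (length xs + length ys + length zs)" by simp
  have bilarm: "bil (arm us) (arm us) = real (length us) * (real (length us) + 1) / 2"
    if us: "chain c us" "set us \<subseteq> V" "us \<noteq> []" for us
  proof -
    obtain u us' where u: "us = u # us'" using us(3) by (auto simp: neq_Nil_conv)
    then have "chain u us'" using us by simp
    then show ?thesis using bil_arm_chain[of u us'] us(2) u by simp
  qed
  define p q r where "p = length xs" and "q = length ys" and "r = length zs"
  have "2 * (1 / 2)\<^sup>2 * p / (real p + 1) + 2 * (1 / 2)\<^sup>2 * q / (real q + 1) + 2 * (1 / 2)\<^sup>2 * r / (real r + 1) < 1"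
    unfolding p_def q_def r_def
  proof (rule star_inequality[OF c, of "arm xs" "arm ys" "arm zs"])
    show "cp c (arm xs) = - (1 / 2 * real (length xs))" "cp c (arm ys) = - (1 / 2 * real (length ys))"
      "cp c (arm zs) = - (1 / 2 * real (length zs))"
      using cp_arm_chain chains c sub by simp_all
    show "bil (arm xs) (arm xs) = real (length xs) * (real (length xs) + 1) / 2"
      "bil (arm ys) (arm ys) = real (length ys) * (real (length ys) + 1) / 2"
      "bil (arm zs) (arm zs) = real (length zs) * (real (length zs) + 1) / 2"
      by (intro bilarm chains sub; simp add: xs ys zs)+
    show "bil (arm xs) (arm ys) = 0" "bil (arm xs) (arm zs) = 0" "bil (arm ys) (arm zs) = 0"
      using sub cross by (simp_all add: bil_arm_zero)
  qed (use cnot in \<open>simp_all add: arm_notin\<close>)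
  moreover have *: "2 * (1 / 2)\<^sup>2 * m / (real m + 1) = 1 / 2 - 1 / 2 * (1 / (real m + 1))" for m :: nat
    by (simp add: power2_eq_square field_simps)
  ultimately have ineq: "1 < 1 / (real p + 1) + 1 / (real q + 1) + 1 / (real r + 1)"
    unfolding * by linarith
  have pqr: "1 \<le> p" "p \<le> q" "q \<le> r" using le xs by (auto simp: p_def q_def r_def)
  have inv_le: "1 / (real m + 1) \<le> 1 / (real k + 1)" if "k \<le> m" for k m :: nat
    using that by (simp add: field_simps)
  have third: "1 / (real m + 1) \<le> 1 / 3" if "2 \<le> m" for m :: nat using inv_le[OF that] by simp
  have quarter: "1 / (real m + 1) \<le> 1 / 4" if "3 \<le> m" for m :: nat using inv_le[OF that] by simp
  have sixth: "1 / (real m + 1) \<le> 1 / 6" if "5 \<le> m" for m :: nat using inv_le[OF that] by simp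
  have "p = 1"
  proof (rule ccontr)
    assume "p \<noteq> 1"
    then have "2 \<le> p" "2 \<le> q" "2 \<le> r" using pqr by auto
    then show False using ineq third[of p] third[of q] third[of r] by linarith
  qed
  then have p: "1 / (real p + 1) = 1 / 2" by simp
  have "q \<le> 2"
  proof (rule ccontr)
    assume "\<not> q \<le> 2"
    then have "3 \<le> q" "3 \<le> r" using pqr by auto
    then show False using ineq p quarter[of q] quarter[of r] by linarith
  qed
  moreover have "q \<noteq> 1"
  proof
    assume "q = 1"
    then have "xs = [x]" "ys = [y]" using \<open>p = 1\<close> xs ys by (auto simp: p_def q_def)
    then show False using star_D_not_minus[OF assms(1) laced _ minus] star by blast
  qed
  ultimately have q: "p = 1" "q = 2" using pqr \<open>p = 1\<close> by auto
  have "r \<le> 4"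
  proof (rule ccontr)
    assume "\<not> r \<le> 4"
    then have "5 \<le> r" by simp
    moreover have "1 / (real q + 1) = 1 / 3" using q by simp
    ultimately show False using ineq p sixth[of r] by linarith
  qed
  moreover have "odd r" using n assms(1) q by (simp add: p_def q_def r_def)
  moreover have "2 \<le> r" using pqr q by simp
  ultimately have "r = 3" by presburger
  then obtain z2 z3 y2 where lists: "xs = [x]" "ys = [y, y2]" "zs = [z, z2, z3]"
    using q xs ys zs by (auto simp: p_def q_def r_def length_Suc_conv numeral_eq_Suc)
  show ?thesis
    by (rule iso_E7[of y2 x y c z z2 z3]) (use V dist chains cross lists in auto)
qed

text \<open>An instance of \<open>star_inequality\<close> with center \<open>c\<close>: one arm is
  \<open>ys\<close> through edges labelled 3, the other is \<open>d # xs\<close> entered through the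
  heavy edge, and the third is empty.\<close>

lemma double_chain_inequality:
  assumes cd: "c \<in> V" "d \<in> V" "M c d = enat m" "4 \<le> m" and sub: "set (c # ys) \<subseteq> V" "set (d # xs) \<subseteq> V"
    and chains: "chain c ys" "chain d xs"
    and cross: "\<And>y x. y \<in> set (c # ys) \<Longrightarrow> x \<in> set (d # xs) \<Longrightarrow> (y, x) \<noteq> (c, d) \<Longrightarrow> M y x = 2"
    and disj: "set (c # ys) \<inter> set (d # xs) = {}"
  shows "1 / 2 * (real (length ys) / (real (length ys) + 1)) +
    2 * (cos (pi / m))\<^sup>2 * ((real (length xs) + 1) / (real (length xs) + 2)) < 1"
proof -
  have "2 * (1 / 2)\<^sup>2 * length ys / (real (length ys) + 1) +
     2 * (cos (pi / m))\<^sup>2 * length (d # xs) / (real (length (d # xs)) + 1) + 2 * 0\<^sup>2 * real 0 / (real 0 + 1) < 1"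
  proof (rule star_inequality[OF cd(1), of "arm ys" "arm (d # xs)" "\<lambda>k. 0"])
    have c: "c \<notin> set ys" "c \<notin> set (d # xs)" using chain_notin cd chains disj by auto
    then show "arm ys c = 0" "arm (d # xs) c = 0" by (simp_all add: arm_notin del: arm.simps)
    show "cp c (arm ys) = - (1 / 2 * real (length ys))" using cp_arm_chain[OF sub(1) chains(1)] by simp
    have "cp c (arm xs) = 0"
    proof (rule cp_arm_zero)
      fix x assume "x \<in> set xs"
      then have "x \<in> set (d # xs)" "x \<noteq> d" using chain_notin[OF cd(2) chains(2)] by auto
      then show "M c x = 2" using cross[of c x] by simp
    qed (use sub cd in auto)
    moreover have "b c d = - cos (pi / m)" using c cd by (simp add: b_def)
    ultimately show "cp c (arm (d # xs)) = - (cos (pi / m) * real (length (d # xs)))"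
      using cd by (simp add: bil_simps algebra_simps)
    show "bil (arm (d # xs)) (arm (d # xs)) = real (length (d # xs)) * (real (length (d # xs)) + 1) / 2"
      by (rule bil_arm_chain[OF sub(2) chains(2)])
    show "bil (arm ys) (arm ys) = real (length ys) * (real (length ys) + 1) / 2"
    proof (cases ys)
      case (Cons y ys')
      then have "chain y ys'" using chains(1) by simp
      then show ?thesis using bil_arm_chain[of y ys'] sub(1) Cons by simp
    qed (simp add: bil_def)
    show "bil (arm ys) (arm (d # xs)) = 0"
      by (rule bil_arm_zero) (use sub c cross in \<open>auto simp del: arm.simps\<close>)
  qed (simp_all add: bil_def cp_def)
  then show ?thesis by (simp add: power2_eq_square add.commute)
qed

text \<open>The inequality is read from both ends of the heavy edge. It bounds the label by 5 and
  the two chain lengths \<open>k\<close> and \<open>l\<close> so tightly that the remaining graphs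
  can be identified directly.\<close>

lemma special_edge:
  assumes n: "3 \<le> n" and cd: "c \<in> V" "d \<in> V" "M c d = enat m" "4 \<le> m"
  shows "m = 4 \<and> (coxeter_graph_iso n M n (cox_B n) \<or> coxeter_graph_iso n M 4 cox_F4) \<or>
     m = 5 \<and> (coxeter_graph_iso n M 3 cox_H \<or> even n)"
proof -
  have cd': "4 \<le> M c d" using cd by (simp add: numeral_eq_enat)
  have dc: "M d c = enat m" using cd M_sym by metis
  obtain ys xs where chains: "chain c ys" "chain d xs" and V: "V = set (c # ys) \<union> set (d # xs)"
    and disj: "set (c # ys) \<inter> set (d # xs) = {}"
    and *: "\<forall>y\<in>set (c # ys). \<forall>x\<in>set (d # xs). (y, x) \<noteq> (c, d) \<longrightarrow> M y x = 2"
    by (rule double_chain[OF cd(1,2) cd'])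
  have cross: "M y x = 2" if "y \<in> set (c # ys)" "x \<in> set (d # xs)" "(y, x) \<noteq> (c, d)" for x y
    using * that by blast
  have sub: "set (c # ys) \<subseteq> V" "set (d # xs) \<subseteq> V" using V by auto
  have cross': "M x y = 2" if "x \<in> set (d # xs)" "y \<in> set (c # ys)" "(x, y) \<noteq> (d, c)" for x y
  proof -
    have "x \<in> V" "y \<in> V" using that sub by blast+
    then show ?thesis using cross[of y x] that M_sym[of x y] by auto
  qed
  have dist: "distinct ((c # ys) @ d # xs)"
    using chain_distinct sub chains disj by (simp only: distinct_append)
  have "length ((c # ys) @ d # xs) = n" by (rule set_length[OF dist]) (use V in auto)
  then have len: "n = length ys + length xs + 2" by simp
  define g k l where "g = 2 * (cos (pi / m))\<^sup>2" and "k = length ys" and "l = length xs"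
  have disj': "set (d # xs) \<inter> set (c # ys) = {}" using disj by blast
  have ineq: "1 / 2 * (real k / (real k + 1)) + g * ((real l + 1) / (real l + 2)) < 1"
    "1 / 2 * (real l / (real l + 1)) + g * ((real k + 1) / (real k + 2)) < 1"
    unfolding g_def k_def l_def
    by (rule double_chain_inequality[OF cd sub chains _ disj], rule cross; assumption)
       (rule double_chain_inequality[OF cd(2,1) dc cd(4) sub(2,1) chains(2,1) _ disj'], rule cross'; assumption)
  have kl: "1 \<le> k + l" using n len by (simp add: k_def l_def)
  have frac1: "real u / (real u + 1) \<le> real v / (real v + 1)" if "u \<le> v" for u v
    using that by (simp add: divide_simps) (simp add: algebra_simps)
  have frac2: "(real u + 1) / (real u + 2) \<le> (real v + 1) / (real v + 2)" if "u \<le> v" for u v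
    using that by (simp add: divide_simps) (simp add: algebra_simps)
  \<comment> \<open>The left side grows with both lengths and with \<open>g\<close>, so it is enough
    to refute minimal configurations; the disjunction covers the two readings.\<close>
  have bound: "1 / 2 * (real u / (real u + 1)) + g' * ((real v + 1) / (real v + 2)) < 1"
    if "g' \<le> g" "u \<le> k \<and> v \<le> l \<or> u \<le> l \<and> v \<le> k" "0 \<le> g'" for g' u v
  proof -
    have "1 / 2 * (real u / (real u + 1)) + g' * ((real v + 1) / (real v + 2)) \<le>
      1 / 2 * (real a / (real a + 1)) + g * ((real b + 1) / (real b + 2))" if "u \<le> a" "v \<le> b" for a b
      by (intro add_mono mult_mono frac1 frac2 that) (use \<open>g' \<le> g\<close> \<open>0 \<le> g'\<close> in auto)
    then show ?thesis using that(2) ineq by (meson le_less_trans)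
  qed
  have cosm: "(cos (pi / q))\<^sup>2 \<le> (cos (pi / m))\<^sup>2" if "2 \<le> q" "q \<le> m" for q :: nat
  proof (rule power_mono)
    have q: "0 < real q" "real q \<le> real m" using that by auto
    then have "pi / real m \<le> pi / real q" by (simp add: frac_le)
    moreover have "pi / real q \<le> pi" using that by (simp add: divide_le_eq)
    ultimately show "cos (pi / real q) \<le> cos (pi / real m)" by (intro cos_monotone_0_pi_le) simp_all
    have "pi / real q \<le> pi / 2" using that by (simp add: divide_simps)
    then show "0 \<le> cos (pi / real q)" by (intro cos_ge_zero) (simp_all add: order_trans[of "- (pi / 2)" 0])
  qed
  have "m \<le> 5"
  proof (rule ccontr)
    assume "\<not> m \<le> 5"
    \<comment> \<open>2 (cos (pi / 6))^2 = 3 / 2, and with one further vertex the bound 3 / 2 * (2 /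
      3) = 1 is reached already.\<close>
    then have "3 / 2 \<le> g" using cosm[of 6] by (simp add: g_def cos_30 power_divide)
    from bound[OF this, of 0 1] kl show False
      using bound[OF \<open>3 / 2 \<le> g\<close>, of 1 0] by (cases "1 \<le> l") auto
  qed
  then consider "m = 4" | "m = 5" using cd(4) by linarith
  then show ?thesis
  proof cases
    case 1
    then have g: "g = 1" by (simp add: g_def cos_45 power_divide)
    have kl': "k = 0 \<or> l = 0 \<or> k = 1 \<and> l = 1"
    proof (rule ccontr)
      assume "\<not> ?thesis"
      then have "1 \<le> k \<and> 2 \<le> l \<or> 1 \<le> l \<and> 2 \<le> k" by auto
      \<comment> \<open>Chains of lengths 1 and 2 give 1 / 4 + 3 / 4 = 1, the affine diagram of type
        F_4.\<close>
      then show False using bound[of 1 1 2] g by auto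
    qed
    have four: "M c d = 4" "M d c = 4" using cd(3) dc 1 by (simp_all add: numeral_eq_enat)
    from kl' consider "ys = []" | "xs = []" | y x where "ys = [y]" "xs = [x]"
      by (auto simp: k_def l_def length_Suc_conv One_nat_def)
    then have "coxeter_graph_iso n M n (cox_B n) \<or> coxeter_graph_iso n M 4 cox_F4"
    proof cases
      case A: 1
      have "M c x = 2" if "x \<in> set xs" for x
        using cross[of c x] that chain_notin[OF cd(2) chains(2)] by auto
      then show ?thesis using iso_B[OF cd(1) chains(2)] V disj four A by auto
    next
      case A: 2
      have "M d y = 2" if "y \<in> set ys" for y
        using cross'[of d y] that chain_notin[OF cd(1) chains(1)] by auto
      then show ?thesis using iso_B[OF cd(2) chains(1)] V disj four A by auto
    next
      case A: 3
      have "y \<in> V" using sub A by auto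
      have "coxeter_graph_iso n M 4 cox_F4"
      proof (rule iso_F4[of y c d x])
        show "V = {y, c, d, x}" using V A by auto
        show "distinct [y, c, d, x]" using dist A by auto
        show "M y c = 3" using chains(1) A M_sym[OF \<open>y \<in> V\<close> cd(1)] by simp
        show "M d x = 3" using chains(2) A by simp
        show "M c x = 2" "M y d = 2" "M y x = 2" using cross dist A by auto
      qed (rule four)
      then show ?thesis ..
    qed
    then show ?thesis using 1 by blast
  next
    case 2
    \<comment> \<open>Here g = (p + 1) / 2 for the golden ratio p. The rational bound 8 / 5 for p is
      good enough below, where 13 / 10 * (4 / 5) and 1 / 4 + 13 / 10 * (3 / 4) both exceed
      1.\<close>
    have g: "13 / 10 \<le> g"
    proof -
      define p where "p = 2 * cos (pi / 5)"
      have p: "p * p = p + 1" "0 < p" using golden_ratio_cos by (simp_all add: p_def)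
      have "8 / 5 \<le> p"
      proof (rule ccontr)
        assume "\<not> 8 / 5 \<le> p"
        \<comment> \<open>By p * p = p + 1 this product equals 1 / 25.\<close>
        then have "(p - 8 / 5) * (p + 3 / 5) \<le> 0" using p(2) by (intro mult_nonpos_nonneg) auto
        then show False using p by (simp add: algebra_simps)
      qed
      moreover have "g = p * p / 2" by (simp add: g_def p_def 2 power2_eq_square)
      ultimately show ?thesis using p by simp
    qed
    have "k \<le> 1 \<and> l \<le> 1 \<or> k + l \<le> 2"
    proof (rule ccontr)
      assume "\<not> ?thesis"
      then have "3 \<le> l \<or> 3 \<le> k \<or> 1 \<le> k \<and> 2 \<le> l \<or> 1 \<le> l \<and> 2 \<le> k" by auto
      then show False using bound[OF g, of 0 3] bound[OF g, of 1 2] by auto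
    qed
    then have "k + l = 1 \<or> k + l = 2" using kl by linarith
    then show ?thesis
    proof
      \<comment> \<open>The rank is four. Recording its parity suffices: odd rank excludes the case,
        and in even rank the lemma is applied to an even label only.\<close>
      assume "k + l = 2"
      then have "even n" using len by (simp add: k_def l_def)
      then show ?thesis using 2 by blast
    next
      assume "k + l = 1"
      then consider x where "ys = []" "xs = [x]" | y where "ys = [y]" "xs = []"
        by (auto simp: k_def l_def length_Suc_conv One_nat_def add_is_1)
      moreover have five: "M c d = 5" "M d c = 5" using cd(3) dc 2 by (simp_all add: numeral_eq_enat)
      ultimately have "coxeter_graph_iso n M 3 cox_H"
      proof cases
        case A: 1
        show ?thesis
          by (rule iso_H3[of c d x]) (use V A dist chains cross five in auto)
      next
        case A: 2
        show ?thesis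
          by (rule iso_H3[of d c y]) (use V A dist chains cross' five in auto)
      qed
      then show ?thesis using 2 by blast
    qed
  qed
qed

lemma minus_imp_iso_odd:
  assumes "odd n" "minus_word n M ws"
  shows "coxeter_graph_iso n M n (cox_B n) \<and> 3 \<le> n \<or> coxeter_graph_iso n M 1 cox_A \<or>
     coxeter_graph_iso n M 3 cox_H \<or> coxeter_graph_iso n M 7 cox_E"
proof (cases "n = 1")
  case True
  then show ?thesis using iso_A1 by simp
next
  case False
  have n: "3 \<le> n" using False assms(1) one_in_V by (cases "n = 2") auto
  show ?thesis
  proof (cases "\<exists>c\<in>V. \<exists>d\<in>V. 4 \<le> M c d")
    case True
    then obtain c d where cd: "c \<in> V" "d \<in> V" "4 \<le> M c d" by blast
    obtain m where m: "M c d = enat m" using M_finite cd by blast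
    then have "4 \<le> m" using cd by (simp add: numeral_eq_enat)
    from special_edge[OF n cd(1,2) m this] have "coxeter_graph_iso n M n (cox_B n) \<or> coxeter_graph_iso n M 4 cox_F4 \<or>
       coxeter_graph_iso n M 3 cox_H" using assms(1) by blast
    moreover have "\<not> coxeter_graph_iso n M 4 cox_F4"
    proof
      assume "coxeter_graph_iso n M 4 cox_F4"
      then have "n = 4" unfolding coxeter_graph_iso_def using bij_betw_same_card by fastforce
      then show False using assms(1) by simp
    qed
    ultimately show ?thesis using n by blast
  next
    case False
    have "M i j \<le> 3" if "i \<in> V" "j \<in> V" for i j
    proof (cases "i = j")
      case True
      then show ?thesis using that by (simp add: one_enat_def numeral_eq_enat)
    next
      case ne: False
      show ?thesis by (rule M_cases[OF that ne]) (use False that in \<open>auto simp: numeral_eq_enat\<close>)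
    qed
    then have laced: "\<forall>i\<in>V. \<forall>j\<in>V. M i j \<le> 3" by blast
    show ?thesis
    proof (cases "\<exists>c x y z. {c, x, y, z} \<subseteq> V \<and> x \<noteq> y \<and> x \<noteq> z \<and> y \<noteq> z \<and> M c x = 3 \<and> M c y = 3 \<and> M c z = 3")
      case True
      then obtain c x y z where "{c, x, y, z} \<subseteq> V" "x \<noteq> y" "x \<noteq> z" "y \<noteq> z" "M c x = 3" "M c y = 3" "M c z = 3" by blast
      then obtain xs ys zs where "star V c xs ys zs" using star_cover[of c x y z] by auto
      from star_minus_E7[OF assms(1) laced this assms(2)] show ?thesis by blast
    next
      case unbr: False
      obtain c xs where "chain c xs" "V = set (c # xs)"
        by (rule chain_cover[OF laced unbr])
      then have False using chain_not_minus[OF _ laced _ _ assms(2)] n by auto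
      then show ?thesis ..
    qed
  qed
qed

lemma minus_imp_iso_even:
  assumes "even n" and \<chi>: "\<chi> \<in> hom W pm_group" and z: "z \<in> group_center W" "\<chi> z = -1"
  shows "\<exists>p. 6 \<le> p \<and> [p = 2] (mod 4) \<and> coxeter_graph_iso n M 2 (cox_I2 p)"
proof -
  have z1: "z \<noteq> \<one>\<^bsub>W\<^esub>" using z char_one[OF \<chi>] by auto
  obtain ws where ws: "set ws \<subseteq> V" "z = pr ws" using pr_surj center_carrier[OF z(1)] by blast
  have minus: "minus_word n M ws" unfolding minus_word_def
    using center_minus[OF z(1) z1] rho_pr[OF ws(1)] ws by auto
  have even: "even (length ws)" using minus_word_parity[OF minus] assms(1) by simp
  have prod: "(\<Prod>i\<leftarrow>ws. \<chi> (pr [i])) = -1" using char_pr[OF \<chi> ws(1)] ws z by simp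
  \<comment> \<open>An even power in \<open>W\<close> has character value 1. This excludes F_4 and
    the even B_n and forces \<open>q\<close> to be odd in the dihedral case.\<close>
  have no_power: False if "minus_word n M (concat (replicate k us))" "even k" for k us
  proof (cases "k = 0")
    case True
    then have "x 1 = - x 1" for x :: "nat \<Rightarrow> real" using that(1) one_in_V by (simp add: minus_word_def)
    from this[of "\<lambda>_. 1"] show False by simp
  next
    case False
    have us: "set us \<subseteq> V" using that(1) False by (auto simp: minus_word_def)
    have "z = pr (concat (replicate k us))"
      using that(1) by (intro central_eq_pr[OF z(1) z1]) (auto simp: minus_word_def)
    then have "\<chi> z = \<chi> (pr us) ^ k" using char_replicate[OF \<chi> us] by simp
    also have "\<dots> = 1" using char_values[OF \<chi>, of "pr us"] us that(2) by auto
    finally show False using z by simp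
  qed
  have vals: "\<chi> (pr [i]) = 1 \<or> \<chi> (pr [i]) = -1" if "i \<in> V" for i using char_values[OF \<chi>, of "pr [i]"] that by simp
  have const: "(\<Prod>i\<leftarrow>us. \<chi> (pr [i])) = e ^ length us" if "\<And>i. i \<in> V \<Longrightarrow> \<chi> (pr [i]) = e" "set us \<subseteq> V" for e us
    using that(2) by (induction us) (auto simp: that(1))
  \<comment> \<open>If the character took one value on all generators, its value at \<open>z\<close>
    would be an even power of it, hence 1.\<close>
  have "\<exists>i\<in>V. \<exists>j\<in>V. i \<noteq> j \<and> 3 \<le> M i j \<and> \<chi> (pr [i]) \<noteq> \<chi> (pr [j])"
  proof (rule ccontr)
    assume *: "\<not> ?thesis"
    have "\<chi> (pr [j]) = \<chi> (pr [1])" if "j \<in> V" for j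
    proof (rule connected_induct[OF one_in_V that])
      fix i j assume ij: "i \<in> V" "j \<in> V" "i \<noteq> j" "3 \<le> M i j" "\<chi> (pr [i]) = \<chi> (pr [1])"
      have "\<chi> (pr [i]) = \<chi> (pr [j])" using * ij(1-4) by blast
      then show "\<chi> (pr [j]) = \<chi> (pr [1])" using ij(5) by simp
    qed simp
    from const[OF this ws(1)] have "\<chi> (pr [1]) ^ length ws = -1" using prod by simp
    then show False using vals[OF one_in_V] even by auto
  qed
  then obtain i j where ij: "i \<in> V" "j \<in> V" "i \<noteq> j" "3 \<le> M i j" "\<chi> (pr [i]) \<noteq> \<chi> (pr [j])" by blast
  obtain m where m: "M i j = enat m" using M_finite ij by blast
  have "even m" by (rule char_braid[OF \<chi> ij(1-3) m ij(5)])
  moreover have "3 \<le> m" using ij(4) m by (simp add: numeral_eq_enat)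
  ultimately have m4: "4 \<le> m" by presburger
  have n2: "n = 2"
  proof (rule ccontr)
    assume "n \<noteq> 2"
    then have n: "3 \<le> n" using assms(1) one_in_V by (cases "n = 1") auto
    from special_edge[OF n ij(1,2) m m4] \<open>even m\<close>
    consider "coxeter_graph_iso n M n (cox_B n)" | "coxeter_graph_iso n M 4 cox_F4" by auto
    then show False
    proof cases
      case 1
      obtain g where "minus_word n M (map g (concat (replicate n [1..<Suc n])))"
        by (rule minus_word_iso[OF 1 minus_word_B]) (use n in auto)
      then show False using no_power[of n "map g [1..<Suc n]"] assms(1) by (simp add: map_concat del: upt_Suc)
    next
      case 2
      obtain g where "minus_word n M (map g (concat (replicate 6 [1::nat, 2, 3, 4])))"
        by (rule minus_word_iso[OF 2 minus_word_F4])
      then show False using no_power[of 6 "map g [1, 2, 3, 4]"] by (simp only: map_concat map_replicate) simp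
    qed
  qed
  have V: "V = {i, j}" using ij(1-3) n2 by auto
  obtain q where q: "m = 2 * q" using \<open>even m\<close> by auto
  have "minus_word n M (concat (replicate q [j, i]))" by (rule minus_word_dihedral[OF V ij(3) m[unfolded q]])
  then have "odd q" using no_power by blast
  then have "6 \<le> m" "m mod 4 = 2 mod 4" using m4 q by presburger+
  then have "6 \<le> m" "[m = 2] (mod 4)" by (simp_all add: cong_def)
  then show ?thesis using iso_I2[OF V ij(3) m] by blast
qed

text \<open>Since p is even there is a character that is -1 on one generator and 1 on the other. It
  is -1 on their product, and the element -1 is the power p / 2 of this product, an odd one.\<close>

lemma iso_imp_proper_I2:
  assumes p: "[p = 2] (mod 4)" and iso: "coxeter_graph_iso n M 2 (cox_I2 p)"
  shows "\<exists>\<phi>. proper_up_to_center_epi A W \<phi>"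
proof -
  have "p mod 4 = 2" using p by (simp add: cong_def)
  then have "p = 2 * (p div 2)" "odd (p div 2)" by presburger+
  then obtain q where q: "p = 2 * q" "odd q" by blast
  have "minus_word 2 (cox_I2 p) (concat (replicate q [2, 1]))" if "coxeter 2 (cox_I2 p)"
    by (rule coxeter.minus_word_dihedral[OF that]) (auto simp: cox_I2_def q)
  from minus_word_iso[OF iso this] obtain g where g: "n = 2" "bij_betw g V V"
    "\<And>i j. i \<in> V \<Longrightarrow> j \<in> V \<Longrightarrow> M (g i) (g j) = cox_I2 p i j" "minus_word n M (map g (concat (replicate q [2, 1])))"
    by metis
  let ?f = "\<lambda>k. if k = g 1 then -1 else (1::int)"
  have "1 \<in> V" "2 \<in> V" using g(1) by auto
  then have gV: "g 1 \<in> V" "g 2 \<in> V" "g 2 \<noteq> g 1"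
    using g(2) unfolding bij_betw_def inj_on_def by fastforce+
  have "V = {1, 2}" using g(1) by auto
  then have cover: "V = {g 1, g 2}" using bij_betw_imp_surj_on[OF g(2)] by simp
  have br: "(?f i * ?f j) ^ m = 1" if "i \<in> V" "j \<in> V" "i \<noteq> j" "M i j = enat m" for i j m
  proof -
    have "M (g 1) (g 2) = enat p" "M (g 2) (g 1) = enat p" using g(3) \<open>1 \<in> V\<close> \<open>2 \<in> V\<close> by (auto simp: cox_I2_def)
    moreover have "i = g 1 \<and> j = g 2 \<or> i = g 2 \<and> j = g 1" using that(1-3) unfolding cover by auto
    ultimately have "m = p" using that by auto
    then show ?thesis using q by simp
  qed
  obtain \<chi> where \<chi>: "\<chi> \<in> hom W pm_group" "\<And>i. i \<in> V \<Longrightarrow> \<chi> (pr [i]) = ?f i"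
  proof (rule char_exists[of ?f])
    fix i j and m :: nat assume "i \<in> V" "j \<in> V" "i \<noteq> j" "M i j = enat m"
    then show "(?f i * ?f j) ^ m = 1" by (rule br)
  qed (use that in auto)
  have w: "map g (concat (replicate q [2, 1])) = concat (replicate q [g 2, g 1])" by (simp add: map_concat)
  have "\<chi> (pr [g 2, g 1]) = -1" using char_pr[OF \<chi>(1), of "[g 2, g 1]"] \<chi>(2) gV by simp
  then have "\<chi> (pr (concat (replicate q [g 2, g 1]))) = -1"
    using char_replicate[OF \<chi>(1), of "[g 2, g 1]" q] gV q by simp
  then show ?thesis using g(4) unfolding w by (intro word_imp_proper[OF \<chi>(1)]) (auto simp: minus_word_def)
qed

lemma minus_word_imp_proper: "minus_word n M ws \<Longrightarrow> odd (length ws) \<Longrightarrow> \<exists>\<phi>. proper_up_to_center_epi A W \<phi>"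
  by (rule odd_word_imp_proper[of ws]) (auto simp: minus_word_def)

lemma length_concat_replicate: "length (concat (replicate k ws)) = k * length ws"
  by (induction k) auto

theorem proper_iff:
  "(\<exists>\<phi>. proper_up_to_center_epi A W \<phi>) \<longleftrightarrow>
      (\<exists>p::nat. 6 \<le> p \<and> [p = 2] (mod 4) \<and> coxeter_graph_iso n M 2 (cox_I2 p)) \<or>
      (\<exists>k::nat. 3 \<le> k \<and> odd k \<and> coxeter_graph_iso n M k (cox_B k)) \<or>
      coxeter_graph_iso n M 1 cox_A \<or>
      coxeter_graph_iso n M 3 cox_H \<or>
      coxeter_graph_iso n M 7 cox_E" (is "?L \<longleftrightarrow> ?R")
proof
  assume ?L
  then obtain \<chi> z where \<chi>: "\<chi> \<in> hom W pm_group" and z: "z \<in> group_center W" "\<chi> z = -1"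
    using proper_imp_char by metis
  show ?R
  proof (cases "even n")
    case True
    then show ?thesis using minus_imp_iso_even[OF _ \<chi> z] by blast
  next
    case False
    have z1: "z \<noteq> \<one>\<^bsub>W\<^esub>" using z char_one[OF \<chi>] by auto
    obtain ws where ws: "set ws \<subseteq> V" "z = pr ws" using pr_surj center_carrier[OF z(1)] by blast
    have "minus_word n M ws" unfolding minus_word_def
      using center_minus[OF z(1) z1] rho_pr[OF ws(1)] ws by auto
    then show ?thesis using minus_imp_iso_odd False by blast
  qed
next
  assume ?R
  then consider p where "[p = 2] (mod 4)" "coxeter_graph_iso n M 2 (cox_I2 p)"
    | k where "3 \<le> k" "odd k" "coxeter_graph_iso n M k (cox_B k)"
    | "coxeter_graph_iso n M 1 cox_A" | "coxeter_graph_iso n M 3 cox_H" | "coxeter_graph_iso n M 7 cox_E" by blast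
  then show ?L
  proof cases
    case 1
    then show ?thesis by (rule iso_imp_proper_I2)
  next
    \<comment> \<open>From here on the sign character serves: the words for -1 have the odd lengths
      k * k, 1, 15 and 63.\<close>
    case 2
    obtain g where "minus_word n M (map g (concat (replicate k [1..<Suc k])))"
      by (rule minus_word_iso[OF 2(3) minus_word_B]) (use 2 in auto)
    moreover have "length (map g (concat (replicate k [1..<Suc k]))) = k * k"
      by (simp add: length_concat_replicate del: upt_Suc)
    ultimately show ?thesis using 2(2) minus_word_imp_proper by simp
  next
    case 3
    obtain g where "minus_word n M (map g [1::nat])"
      by (rule minus_word_iso[OF 3 coxeter.minus_word_A1]) auto
    then show ?thesis by (rule minus_word_imp_proper) simp
  next
    case 4
    obtain g where "minus_word n M (map g (concat (replicate 5 [1::nat, 2, 3])))"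
      by (rule minus_word_iso[OF 4 minus_word_H3])
    then show ?thesis by (rule minus_word_imp_proper) (simp add: length_concat_replicate)
  next
    case 5
    obtain g where "minus_word n M (map g (concat (replicate 9 [1::nat, 2, 3, 4, 5, 6, 7])))"
      by (rule minus_word_iso[OF 5 minus_word_E7])
    then show ?thesis by (rule minus_word_imp_proper) (simp add: length_concat_replicate)
  qed
qed

end

theorem lemma2p2:
  fixes n :: nat and M :: "nat \<Rightarrow> nat \<Rightarrow> enat"
  assumes "coxeter_matrix n M"
    and "coxeter_connected n M"
    and "spherical_type n M"
  shows "((\<exists>\<phi>. proper_up_to_center_epi (artin_group n M) (coxeter_group n M) \<phi>) \<longleftrightarrow>
      (\<exists>p::nat. 6 \<le> p \<and> [p = 2] (mod 4) \<and> coxeter_graph_iso n M 2 (cox_I2 p)) \<or>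
      (\<exists>k::nat. 3 \<le> k \<and> odd k \<and> coxeter_graph_iso n M k (cox_B k)) \<or>
      coxeter_graph_iso n M 1 cox_A \<or>
      coxeter_graph_iso n M 3 cox_H \<or>
      coxeter_graph_iso n M 7 cox_E) \<and>
    (\<forall>\<phi>. proper_up_to_center_epi (artin_group n M) (coxeter_group n M) \<phi> \<longrightarrow>
      internal_direct_product (coxeter_group n M)
        (\<phi> ` carrier (artin_group n M)) (group_center (coxeter_group n M)))"
proof -
  interpret finite_coxeter n M
    using assms by unfold_locales (simp_all add: spherical_type_def)
  show ?thesis using proper_iff proper_direct_product by blast
qed

end
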